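(* Let $\tau\in\mathbb C$ with $\operatorname{Im}\tau>0$ and $\lambda\in\mathbb C\setminus(\mathbb Z+\tau\mathbb Z)$. The commutation relations of the Lie algebra $\mathfrak e_\tau(\widehat{\mathfrak{sl}}_2)$ in terms of half-currents can be written in the form: $$[d,L_\lambda^\pm(u)]=-\frac{\partial}{\partial u}L_\lambda^\pm(u),$$ $$[L_{\lambda,1}^\pm(u),L_{\lambda,2}^\pm(v)]=[L_{\lambda,1}^\pm(u)+L_{\lambda,2}^\pm(v),r_\lambda^+(u,v)]+H_1\frac{\partial}{\partial\lambda}L_{\lambda,2}^\pm(v)-H_2\frac{\partial}{\partial\lambda}L_{\lambda,1}^\pm(u)+h\frac{\partial}{\partial\lambda}r_\lambda^+(u,v)$$ (the same sign throughout), and $$[L_{\lambda,1}^+(u),L_{\lambda,2}^-(v)]=[L_{\lambda,1}^+(u)+L_{\lambda,2}^-(v),r_\lambda^+(u,v)]+H_1\frac{\partial}{\partial\lambda}L_{\lambda,2}^-(v)-H_2\frac{\partial}{\partial\lambda}L_{\lambda,1}^+(u)+h\frac{\partial}{\partial\lambda}r_\lambda^+(u,v)+c\cdot\frac{\partial}{\partial u}r_\lambda^+(u,v),$$ where $H=\begin{pmatrix}1&0\\0&-1\end{pmatrix}$ and $h=\hat h[1]$ is the value of the operator $\hat h$ on the constant test function $1$. Moreover the $L$-operators satisfy $$[H+h,L_\lambda^\pm(u)]=0.$$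
   Context: Theta function: $\theta$ is the odd entire function with $\theta(u+1)=-\theta(u)$, $\theta(u+\tau)=-e^{-2\pi i u-\pi i\tau}\theta(u)$, $\theta'(0)=1$. Test functions: $\mathcal K_0$ is the algebra of complex-valued functions meromorphic in some neighbourhood of $0$ whose only possible pole there is at $0$, with scalar product $\langle s,t\rangle=\oint_{C_0}\frac{du}{2\pi i}s(u)t(u)$, $C_0$ a small positively oriented circle around $0$ (the residue at $0$). A sequence in $\mathcal K_0$ converges to zero if for some $N$ all $u^Ns_n(u)$ are regular at the origin and all their Laurent coefficients tend to zero. Distributions are continuous linear functionals on $\mathcal K_0$ (or on tensor powers); $\langle a(u)\rangle_u=\langle a(u),1\rangle$; subscripts on brackets denote partial action. Vector-valued distributions are linear maps from test functions to the vector space. Lie algebra: $\mathfrak{sl}_2$ has basis $h,e,f$ with $[h,e]=2e$, $[h,f]=-2f$, $[e,f]=h$ and invariant form with $(h,h)=2$, $(e,f)=1$, $(h,e)=(h,f)=(e,e)=(f,f)=0$. As a vector space $\mathfrak e_\tau(\widehat{\mathfrak{sl}}_2)=(\mathfrak{sl}_2\otimes\mathcal K_0)\oplus\mathbb C c\oplus\mathbb C d$. Writing $\hat x[s]=x\otimes s$ for $x\in\mathfrak{sl}_2$, $s\in\mathcal K_0$, the bracket is: $c$ is central, $[d,\hat x[s]]=\hat x[s']$, and $$[\hat x[s],\hat y[t]]=[x,y]\otimes st+c\,(x,y)\langle s',t\rangle .$$ The total current $x(u)$ ($x\in\{h,e,f\}$) is the Lie-algebra-valued distribution $\langle x(u),s(u)\rangle=\hat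 x[s]$. Green distributions: $G_\lambda^\pm(u,z)$ and $G(u,z)$ are the distributions on $\mathcal K_0\otimes\mathcal K_0$ with partial actions $$\langle G_\lambda^\pm(u,z),s(u)\rangle_u=\oint_{|u|>|z|\ (+),\ |u|<|z|\ (-)}\frac{du}{2\pi i}\frac{\theta(u-z+\lambda)}{\theta(u-z)\theta(\lambda)}s(u),\qquad\langle G(u,z),s(u)\rangle_u=\oint_{|u|>|z|}\frac{du}{2\pi i}\frac{\theta'(u-z)}{\theta(u-z)}s(u)$$ (small circles around zero satisfying the inequality), and full action $\langle a(u,z),s(u)t(z)\rangle=\big\langle\langle a(u,z),s(u)\rangle_u,t(z)\big\rangle_z$. Their partial actions in either variable map $\mathcal K_0$ to $\mathcal K_0$. Half-currents: $h^+(u)=\langle G(u,v)h(v)\rangle_v$, $h^-(u)=-\langle G(v,u)h(v)\rangle_v$, $e_\lambda^\pm(u)=\langle G_\lambda^\pm(u,v)e(v)\rangle_v$, $f_\lambda^\pm(u)=\langle G_{-\lambda}^\pm(u,v)f(v)\rangle_v$. Here $\langle a(u,v)x(v)\rangle_v$ is the Lie-algebra-valued distribution in $u$ whose value on $s$ is $\hat x\big[\langle a(u,v),s(u)\rangle_u\big]$ (a function of $v$). $L$-operators and $r$-matrix: $$L_\lambda^\pm(u)=\begin{pmatrix}\frac12h^\pm(u)&f_\lambda^\pm(u)\\ e_\lambda^\pm(u)&-\frac12h^\pm(u)\end{pmatrix},$$ $$r_\lambda^+(u,v)=\begin{pmatrix}\frac12G(u,v)&0&0&0\\0&-\frac12G(u,v)&G_{-\lambda}^+(u,v)&0\\0&G_\lambda^+(u,v)&-\frac12G(u,v)&0\\0&0&0&\frac12G(u,v)\end{pmatrix}$$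 acting in $\mathbb C^2\otimes\mathbb C^2$ with the standard ordered basis. Conventions: subscripts $1,2$ indicate the tensor factor of $\operatorname{End}\mathbb C^2\otimes\operatorname{End}\mathbb C^2$ in which a $2\times2$ matrix acts (e.g. $H_1=H\otimes1$, $H_2=1\otimes H$). Matrix entries with values in the Lie algebra are regarded as elements of its universal enveloping algebra, so commutators are taken in $\operatorname{End}(\mathbb C^2)^{\otimes2}$ (respectively $\operatorname{End}\mathbb C^2$) tensored with the universal enveloping algebra; in $[H+h,\cdot]$, $H$ stands for $H\otimes1$ and $h$ for $1\otimes h$. Equalities are equalities of distributions in $u$ (and $v$) with values in this algebra; $\partial/\partial u$, $\partial/\partial\lambda$ are distributional derivatives. A product of a two-variable Green distribution with a current in one of its variables is defined by $\langle a(u,v)x(v),s(u)t(v)\rangle=\langle x(v),t(v)\langle a(u,v),s(u)\rangle_u\rangle$, and analogously in the other variable. *)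

theory Defs
  imports "HOL-Complex_Analysis.Complex_Analysis" "HOL-Library.Poly_Mapping"
begin

class complex_vector = ab_group_add +
  fixes scaleC :: "complex \<Rightarrow> 'a \<Rightarrow> 'a" (infixr "*\<^sub>C" 75)
  assumes scaleC_add_right: "a *\<^sub>C (x + y) = a *\<^sub>C x + a *\<^sub>C y"
    and scaleC_add_left: "(a + b) *\<^sub>C x = a *\<^sub>C x + b *\<^sub>C x"
    and scaleC_scaleC: "a *\<^sub>C b *\<^sub>C x = (a * b) *\<^sub>C x"
    and scaleC_one: "1 *\<^sub>C x = x"

class complex_algebra_1 = complex_vector + ring_1 +
  assumes mult_scaleC_left: "(a *\<^sub>C x) * y = a *\<^sub>C (x * y)"
    and mult_scaleC_right: "x * (a *\<^sub>C y) = a *\<^sub>C (x * y)"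

definition complex_linear :: "('a::complex_vector \<Rightarrow> 'b::complex_vector) \<Rightarrow> bool" where
  "complex_linear f \<longleftrightarrow> (\<forall>x y. f (x + y) = f x + f y) \<and> (\<forall>a x. f (a *\<^sub>C x) = a *\<^sub>C f x)"


section \<open>Test functions\<close>

text \<open>
  Elements of \<open>K0\<close> are germs at 0: two functions are identified if they agree on some
  punctured neighbourhood of 0 (the predicate \<open>f meromorphic_on {0}\<close> says that f is
  given by a convergent Laurent series with finite principal part on such a neighbourhood
  and does not constrain the value at the point 0 itself).
\<close>

definition germ_eq :: "(complex \<Rightarrow> complex) \<Rightarrow> (complex \<Rightarrow> complex) \<Rightarrow> bool" where
  "germ_eq f g \<longleftrightarrow> f meromorphic_on {0} \<and> g meromorphic_on {0} \<and> (\<forall>\<^sub>F u in at 0. f u = g u)"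

quotient_type K0 = "complex \<Rightarrow> complex" / partial: germ_eq
proof (rule part_equivpI)
  show "\<exists>f. germ_eq f f"
    by (rule exI[of _ "\<lambda>_. 0"]) (auto simp: germ_eq_def)
  show "symp germ_eq"
    by (auto simp: germ_eq_def symp_def eq_commute)
  show "transp germ_eq"
    by (auto simp: germ_eq_def transp_def elim: eventually_elim2)
qed

lemma germ_eq_deriv:
  assumes "germ_eq f g"
  shows "germ_eq (deriv f) (deriv g)"
proof -
  have "\<forall>\<^sub>F u in at 0. f u = g u"
    using assms by (simp add: germ_eq_def)
  then obtain e where e: "e > 0" "\<And>u. u \<noteq> 0 \<Longrightarrow> dist u 0 < e \<Longrightarrow> f u = g u"
    unfolding eventually_at by auto
  have "deriv f u = deriv g u" if "u \<noteq> 0" "dist u 0 < e" for u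
  proof (rule deriv_cong_ev)
    have "\<forall>\<^sub>F w in nhds u. w \<in> ball 0 e - {0}"
      using that by (intro eventually_nhds_in_open) (auto simp: dist_commute)
    then show "\<forall>\<^sub>F w in nhds u. f w = g w"
      by eventually_elim (use e in \<open>auto simp: dist_commute\<close>)
  qed simp
  then have "\<forall>\<^sub>F u in at 0. deriv f u = deriv g u"
    unfolding eventually_at using e(1) by auto
  then show ?thesis
    using assms by (auto simp: germ_eq_def intro: meromorphic_intros)
qed

instantiation K0 :: comm_ring_1
begin

lift_definition zero_K0 :: K0 is "\<lambda>_. 0"
  by (auto simp: germ_eq_def)
lift_definition one_K0 :: K0 is "\<lambda>_. 1"
  by (auto simp: germ_eq_def)
lift_definition plus_K0 :: "K0 \<Rightarrow> K0 \<Rightarrow> K0" is "\<lambda>f g u. f u + g u"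
  by (auto simp: germ_eq_def intro!: meromorphic_intros elim: eventually_elim2)
lift_definition times_K0 :: "K0 \<Rightarrow> K0 \<Rightarrow> K0" is "\<lambda>f g u. f u * g u"
  by (auto simp: germ_eq_def intro!: meromorphic_intros elim: eventually_elim2)
lift_definition uminus_K0 :: "K0 \<Rightarrow> K0" is "\<lambda>f u. - f u"
  by (auto simp: germ_eq_def intro!: meromorphic_intros elim: eventually_mono)
lift_definition minus_K0 :: "K0 \<Rightarrow> K0 \<Rightarrow> K0" is "\<lambda>f g u. f u - g u"
  by (auto simp: germ_eq_def intro!: meromorphic_intros elim: eventually_elim2)

instance
  by standard
    (transfer; force simp: germ_eq_def algebra_simps intro!: meromorphic_intros)+

end

instantiation K0 :: complex_algebra_1
begin

lift_definition scaleC_K0 :: "complex \<Rightarrow> K0 \<Rightarrow> K0" is "\<lambda>a f u. a * f u"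
  by (auto simp: germ_eq_def intro!: meromorphic_intros elim: eventually_mono)

instance
  by standard
    (transfer; force simp: germ_eq_def algebra_simps intro!: meromorphic_intros)+

end

lift_definition K0_deriv :: "K0 \<Rightarrow> K0" is deriv
  by (rule germ_eq_deriv)

lift_definition K0_pair :: "K0 \<Rightarrow> K0 \<Rightarrow> complex" is "\<lambda>s t. residue (\<lambda>u. s u * t u) 0"
  by (intro residue_cong) (auto simp: germ_eq_def elim: eventually_elim2)

definition K0_coeff :: "K0 \<Rightarrow> int \<Rightarrow> complex" where
  "K0_coeff s k = fls_nth (laurent_expansion (rep_K0 s) 0) k"

definition K0_null :: "(nat \<Rightarrow> K0) \<Rightarrow> bool" where
  "K0_null S \<longleftrightarrow>
     (\<exists>N::nat. \<forall>n. \<forall>k < - int N. K0_coeff (S n) k = 0) \<and>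
     (\<forall>k. (\<lambda>n. K0_coeff (S n) k) \<longlonglongrightarrow> 0)"


section \<open>The Lie algebra\<close>

datatype sl2_basis = Bh | Be | Bf

instance sl2_basis :: finite
proof
  have "(UNIV :: sl2_basis set) = {Bh, Be, Bf}"
    using sl2_basis.exhaust by auto
  then show "finite (UNIV :: sl2_basis set)"
    by (metis finite.emptyI finite.insertI)
qed

text \<open>Coordinates of the bracket of two basis vectors, and their inner product.\<close>

fun sl2_bracket :: "sl2_basis \<Rightarrow> sl2_basis \<Rightarrow> sl2_basis \<Rightarrow> complex" where
  "sl2_bracket Bh Be = (\<lambda>_. 0)(Be := 2)"
| "sl2_bracket Be Bh = (\<lambda>_. 0)(Be := -2)"
| "sl2_bracket Bh Bf = (\<lambda>_. 0)(Bf := -2)"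
| "sl2_bracket Bf Bh = (\<lambda>_. 0)(Bf := 2)"
| "sl2_bracket Be Bf = (\<lambda>_. 0)(Bh := 1)"
| "sl2_bracket Bf Be = (\<lambda>_. 0)(Bh := -1)"
| "sl2_bracket _ _ = (\<lambda>_. 0)"

fun sl2_form :: "sl2_basis \<Rightarrow> sl2_basis \<Rightarrow> complex" where
  "sl2_form Bh Bh = 2"
| "sl2_form Be Bf = 1"
| "sl2_form Bf Be = 1"
| "sl2_form _ _ = 0"

text \<open>\<open>Affine X a b\<close> stands for \<open>(\<Sum>x. x \<otimes> X x) + a c + b d\<close>, with x running over the basis.\<close>

datatype affine = Affine (cur: "sl2_basis \<Rightarrow> K0") (c_part: complex) (d_part: complex)

instantiation affine :: complex_vector
begin

definition zero_affine :: affine where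
  "0 = Affine (\<lambda>_. 0) 0 0"
definition plus_affine :: "affine \<Rightarrow> affine \<Rightarrow> affine" where
  "X + Y = Affine (\<lambda>x. cur X x + cur Y x) (c_part X + c_part Y) (d_part X + d_part Y)"
definition uminus_affine :: "affine \<Rightarrow> affine" where
  "- X = Affine (\<lambda>x. - cur X x) (- c_part X) (- d_part X)"
definition minus_affine :: "affine \<Rightarrow> affine \<Rightarrow> affine" where
  "X - Y = Affine (\<lambda>x. cur X x - cur Y x) (c_part X - c_part Y) (d_part X - d_part Y)"
definition scaleC_affine :: "complex \<Rightarrow> affine \<Rightarrow> affine" where
  "a *\<^sub>C X = Affine (\<lambda>x. a *\<^sub>C cur X x) (a * c_part X) (a * d_part X)"

instance
  by standard
    (auto simp: zero_affine_def plus_affine_def uminus_affine_def minus_affine_def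
      scaleC_affine_def algebra_simps scaleC_add_left scaleC_add_right scaleC_scaleC scaleC_one)

end

definition hat :: "sl2_basis \<Rightarrow> K0 \<Rightarrow> affine" where
  "hat x s = Affine ((\<lambda>_. 0)(x := s)) 0 0"

definition c_elem :: affine where
  "c_elem = Affine (\<lambda>_. 0) 1 0"

definition d_elem :: affine where
  "d_elem = Affine (\<lambda>_. 0) 0 1"

definition lie :: "affine \<Rightarrow> affine \<Rightarrow> affine" where
  "lie X Y = Affine
     (\<lambda>z. (\<Sum>x\<in>UNIV. \<Sum>y\<in>UNIV. sl2_bracket x y z *\<^sub>C (cur X x * cur Y y))
          + d_part X *\<^sub>C K0_deriv (cur Y z) - d_part Y *\<^sub>C K0_deriv (cur X z))
     (\<Sum>x\<in>UNIV. \<Sum>y\<in>UNIV. sl2_form x y * K0_pair (K0_deriv (cur X x)) (cur Y y))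
     0"

text \<open>
  Derivative of a curve in the Lie algebra, in the topology of \<open>K0 \<oplus> K0 \<oplus> K0 \<oplus> \<complex> \<oplus> \<complex>\<close>
  determined by the convergent sequences of \<open>K0\<close>.
\<close>

definition affine_null :: "(nat \<Rightarrow> affine) \<Rightarrow> bool" where
  "affine_null S \<longleftrightarrow> (\<forall>x. K0_null (\<lambda>n. cur (S n) x)) \<and>
     (\<lambda>n. c_part (S n)) \<longlonglongrightarrow> 0 \<and> (\<lambda>n. d_part (S n)) \<longlonglongrightarrow> 0"

definition affine_has_deriv :: "(complex \<Rightarrow> affine) \<Rightarrow> affine \<Rightarrow> complex \<Rightarrow> bool" where
  "affine_has_deriv X X' a \<longleftrightarrow>
     (\<forall>l. (\<forall>n. l n \<noteq> a) \<and> l \<longlonglongrightarrow> a \<longrightarrow>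
        affine_null (\<lambda>n. (1 / (l n - a)) *\<^sub>C (X (l n) - X a) - X'))"

definition affine_deriv :: "(complex \<Rightarrow> affine) \<Rightarrow> complex \<Rightarrow> affine" where
  "affine_deriv X a = (THE X'. affine_has_deriv X X' a)"


section \<open>The universal enveloping algebra\<close>

text \<open>
  Free unital algebra on the underlying set of the Lie algebra (the monoid algebra of words),
  modulo the ideal that makes the inclusion of generators linear and turns brackets into
  commutators.
\<close>

datatype word = Word "affine list"

instantiation word :: monoid_add
begin

definition zero_word :: word where
  "0 = Word []"
fun plus_word :: "word \<Rightarrow> word \<Rightarrow> word" where
  "Word u + Word v = Word (u @ v)"

instance
proof
  fix a b c :: word
  show "a + b + c = a + (b + c)"
    by (cases a; cases b; cases c) simp
  show "0 + a = a"
    by (cases a) (simp add: zero_word_def)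
  show "a + 0 = a"
    by (cases a) (simp add: zero_word_def)
qed

end

type_synonym free_alg = "word \<Rightarrow>\<^sub>0 complex"

definition free_gen :: "affine \<Rightarrow> free_alg" where
  "free_gen X = Poly_Mapping.single (Word [X]) 1"

definition free_const :: "complex \<Rightarrow> free_alg" where
  "free_const a = Poly_Mapping.single 0 a"

inductive_set env_ideal :: "free_alg set" where
  zero: "0 \<in> env_ideal"
| add: "p \<in> env_ideal \<Longrightarrow> q \<in> env_ideal \<Longrightarrow> p + q \<in> env_ideal"
| mult_left: "p \<in> env_ideal \<Longrightarrow> a * p \<in> env_ideal"
| mult_right: "p \<in> env_ideal \<Longrightarrow> p * a \<in> env_ideal"
| gen_add: "free_gen (X + Y) - (free_gen X + free_gen Y) \<in> env_ideal"
| gen_scale: "free_gen (a *\<^sub>C X) - free_const a * free_gen X \<in> env_ideal"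
| gen_lie: "free_gen (lie X Y) - (free_gen X * free_gen Y - free_gen Y * free_gen X) \<in> env_ideal"

lemma env_ideal_uminus: "p \<in> env_ideal \<Longrightarrow> - p \<in> env_ideal"
  using env_ideal.mult_left[of p "-1"] by simp

lemma env_ideal_diff: "p \<in> env_ideal \<Longrightarrow> q \<in> env_ideal \<Longrightarrow> p - q \<in> env_ideal"
  using env_ideal.add[OF _ env_ideal_uminus, of p q] by simp

lemma free_alg_induct [case_names single sum]:
  fixes p :: free_alg
  assumes single: "\<And>k v. P (Poly_Mapping.single k v)"
    and sum: "\<And>f g. P f \<Longrightarrow> P g \<Longrightarrow> P (f + g)"
  shows "P p"
proof (induction p rule: update_induct)
  case const
  show ?case
    using single[of 0 0] by simp
next
  case (update f a b)
  have "Poly_Mapping.update a b f = Poly_Mapping.single a b + f"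
    using update(1)
    by (intro poly_mapping_eqI)
      (auto simp: lookup_update lookup_add lookup_single when_def in_keys_iff)
  then show ?case
    using sum[OF single update(3)] by simp
qed

lemma lookup_mult_zero_word:
  fixes p q :: free_alg
  shows "Poly_Mapping.lookup (p * q) 0 = Poly_Mapping.lookup p 0 * Poly_Mapping.lookup q 0"
proof -
  have w: "a + b = 0 \<longleftrightarrow> a = 0 \<and> b = (0 :: word)" for a b
    by (cases a; cases b) (auto simp: zero_word_def)
  have s: "Poly_Mapping.lookup (Poly_Mapping.single k v * q) 0 = Poly_Mapping.lookup (Poly_Mapping.single k v) 0 * Poly_Mapping.lookup q 0"
    for k v and q :: free_alg
  proof (induction q rule: free_alg_induct)
    case (single k' v')
    show ?case
      using w[of k k'] by (auto simp: mult_single lookup_single when_def)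
  next
    case (sum f g)
    then show ?case
      by (simp add: algebra_simps lookup_add)
  qed
  show ?thesis
  proof (induction p rule: free_alg_induct)
    case (single k v)
    show ?case by (rule s)
  next
    case (sum f g)
    then show ?case
      by (simp add: algebra_simps lookup_add)
  qed
qed

lemma lookup_free_gen_zero: "Poly_Mapping.lookup (free_gen X) 0 = 0"
  by (simp add: free_gen_def lookup_single when_def zero_word_def)

lemma env_ideal_augmentation: "p \<in> env_ideal \<Longrightarrow> Poly_Mapping.lookup p 0 = 0"
  by (induction rule: env_ideal.induct)
    (auto simp: lookup_add lookup_minus lookup_mult_zero_word lookup_free_gen_zero)

lemma free_const_central: "free_const a * p = p * free_const a"
proof (induction p rule: free_alg_induct)
  case (single k v)
  show ?case
    by (simp add: free_const_def mult_single mult.commute)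
next
  case (sum f g)
  then show ?case
    by (simp add: algebra_simps)
qed

quotient_type env = free_alg / "\<lambda>p q. p - q \<in> env_ideal"
proof (rule equivpI)
  show "reflp (\<lambda>p q. p - q \<in> env_ideal)"
    by (simp add: reflp_def env_ideal.zero)
  show "symp (\<lambda>p q. p - q \<in> env_ideal)"
    by (auto simp: symp_def dest: env_ideal_uminus)
  show "transp (\<lambda>p q. p - q \<in> env_ideal)"
  proof (rule transpI)
    fix p q r assume "p - q \<in> env_ideal" "q - r \<in> env_ideal"
    then show "p - r \<in> env_ideal"
      using env_ideal.add[of "p - q" "q - r"] by simp
  qed
qed

instantiation env :: ring_1
begin

lift_definition zero_env :: env is 0 .
lift_definition one_env :: env is 1 .
lift_definition plus_env :: "env \<Rightarrow> env \<Rightarrow> env" is "(+)"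
  using env_ideal.add by (fastforce simp: algebra_simps)
lift_definition uminus_env :: "env \<Rightarrow> env" is uminus
  using env_ideal_uminus by fastforce
lift_definition minus_env :: "env \<Rightarrow> env \<Rightarrow> env" is "(-)"
  using env_ideal_diff by (fastforce simp: algebra_simps)
lift_definition times_env :: "env \<Rightarrow> env \<Rightarrow> env" is "(*)"
proof -
  fix p p' q q' :: free_alg
  assume "p - p' \<in> env_ideal" "q - q' \<in> env_ideal"
  then have "(p - p') * q + p' * (q - q') \<in> env_ideal"
    by (intro env_ideal.intros)
  then show "p * q - p' * q' \<in> env_ideal"
    by (simp add: algebra_simps)
qed

instance
proof
  show "(0 :: env) \<noteq> 1"
  proof (transfer, rule notI)
    assume "(0 :: free_alg) - 1 \<in> env_ideal"
    from env_ideal_augmentation[OF this] show False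
      by (simp add: lookup_minus lookup_one)
  qed
qed (transfer; simp add: algebra_simps env_ideal.zero)+

end

instantiation env :: complex_algebra_1
begin

lift_definition scaleC_env :: "complex \<Rightarrow> env \<Rightarrow> env" is "\<lambda>a p. free_const a * p"
  using env_ideal.mult_left by (fastforce simp: algebra_simps)

instance
proof
  fix a b :: complex and x y :: env
  show "a *\<^sub>C (x + y) = a *\<^sub>C x + a *\<^sub>C y"
    by transfer (simp add: algebra_simps env_ideal.zero)
  show "(a + b) *\<^sub>C x = a *\<^sub>C x + b *\<^sub>C x"
    by transfer (simp add: free_const_def single_add algebra_simps env_ideal.zero)
  show "a *\<^sub>C b *\<^sub>C x = (a * b) *\<^sub>C x"
    by transfer (simp add: free_const_def mult_single mult.assoc[symmetric] env_ideal.zero)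
  show "1 *\<^sub>C x = x"
    by transfer (simp add: free_const_def env_ideal.zero)
  show "(a *\<^sub>C x) * y = a *\<^sub>C (x * y)"
    by transfer (simp add: mult.assoc env_ideal.zero)
  show "x * (a *\<^sub>C y) = a *\<^sub>C (x * y)"
  proof transfer
    fix a and x y :: free_alg
    have "x * (free_const a * y) = free_const a * (x * y)"
      by (metis free_const_central mult.assoc)
    then show "x * (free_const a * y) - free_const a * (x * y) \<in> env_ideal"
      by (simp add: env_ideal.zero)
  qed
qed

end

lift_definition env_incl :: "affine \<Rightarrow> env" is free_gen .


section \<open>Green distributions and half-currents\<close>

definition theta_function :: "complex \<Rightarrow> (complex \<Rightarrow> complex) \<Rightarrow> bool" where
  "theta_function \<tau> \<theta> \<longleftrightarrow>
     \<theta> holomorphic_on UNIV \<and>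
     (\<forall>u. \<theta> (- u) = - \<theta> u) \<and>
     (\<forall>u. \<theta> (u + 1) = - \<theta> u) \<and>
     (\<forall>u. \<theta> (u + \<tau>) = - exp (- 2 * of_real pi * \<i> * u - of_real pi * \<i> * \<tau>) * \<theta> u) \<and>
     deriv \<theta> 0 = 1"

text \<open>
  A distribution in one variable is a linear map on \<open>K0\<close>, a distribution in two variables
  a bilinear map \<open>a\<close>, with \<open>a s t\<close> its value on \<open>s(u) t(z)\<close>.
\<close>

type_synonym dist2 = "K0 \<Rightarrow> K0 \<Rightarrow> complex"

datatype branch = Plus | Minus

fun contour_side :: "branch \<Rightarrow> real \<Rightarrow> real \<Rightarrow> bool" where
  "contour_side Plus r q \<longleftrightarrow> r > q"
| "contour_side Minus r q \<longleftrightarrow> r < q"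

text \<open>
  The germ of \<open>z \<mapsto> \<ointegral> du / (2 \<pi> \<i>) k(u - z) s(u)\<close> over a small circle \<open>|u| = r\<close>, where
  \<open>r > |z|\<close> for \<open>Plus\<close> and \<open>r < |z|\<close> for \<open>Minus\<close>.
\<close>

definition contour_action :: "branch \<Rightarrow> (complex \<Rightarrow> complex) \<Rightarrow> K0 \<Rightarrow> K0" where
  "contour_action \<epsilon> k s = (THE g. \<exists>\<delta>>0. \<forall>z r.
     0 < norm z \<and> norm z < \<delta> \<and> 0 < r \<and> r < \<delta> \<and> contour_side \<epsilon> r (norm z) \<longrightarrow>
       rep_K0 g z =
         contour_integral (circlepath 0 r) (\<lambda>u. k (u - z) * rep_K0 s u) / (2 * of_real pi * \<i>))"

definition green_lam :: "(complex \<Rightarrow> complex) \<Rightarrow> branch \<Rightarrow> complex \<Rightarrow> dist2" where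
  "green_lam \<theta> \<epsilon> l s t =
     K0_pair (contour_action \<epsilon> (\<lambda>x. \<theta> (x + l) / (\<theta> x * \<theta> l)) s) t"

definition green :: "(complex \<Rightarrow> complex) \<Rightarrow> dist2" where
  "green \<theta> s t = K0_pair (contour_action Plus (\<lambda>x. deriv \<theta> x / \<theta> x) s) t"

text \<open>Partial actions in the first and in the second variable.\<close>

definition partial_fst :: "dist2 \<Rightarrow> K0 \<Rightarrow> K0" where
  "partial_fst a s = (THE g. \<forall>t. K0_pair g t = a s t)"

definition partial_snd :: "dist2 \<Rightarrow> K0 \<Rightarrow> K0" where
  "partial_snd a t = (THE g. \<forall>s. K0_pair g s = a s t)"

text \<open>\<open>smear a x\<close> is the distribution \<open>\<langle>a(u,v) x(v)\<rangle>\<^sub>v\<close> in u.\<close>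

definition smear :: "dist2 \<Rightarrow> sl2_basis \<Rightarrow> K0 \<Rightarrow> affine" where
  "smear a x s = hat x (partial_fst a s)"

fun h_half :: "(complex \<Rightarrow> complex) \<Rightarrow> branch \<Rightarrow> K0 \<Rightarrow> affine" where
  "h_half \<theta> Plus s = smear (green \<theta>) Bh s"
| "h_half \<theta> Minus s = - smear (\<lambda>s t. green \<theta> t s) Bh s"

definition e_half :: "(complex \<Rightarrow> complex) \<Rightarrow> branch \<Rightarrow> complex \<Rightarrow> K0 \<Rightarrow> affine" where
  "e_half \<theta> \<epsilon> l = smear (green_lam \<theta> \<epsilon> l) Be"

definition f_half :: "(complex \<Rightarrow> complex) \<Rightarrow> branch \<Rightarrow> complex \<Rightarrow> K0 \<Rightarrow> affine" where
  "f_half \<theta> \<epsilon> l = smear (green_lam \<theta> \<epsilon> (- l)) Bf"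


section \<open>L-operators and r-matrix\<close>

text \<open>
  \<open>End(\<complex>\<^sup>2) \<otimes> A\<close> is \<open>'a^2^2\<close> and \<open>End(\<complex>\<^sup>2) \<otimes> End(\<complex>\<^sup>2) \<otimes> A\<close> is \<open>'a^(2\<times>2)^(2\<times>2)\<close>, the ordered basis
  of \<open>\<complex>\<^sup>2 \<otimes> \<complex>\<^sup>2\<close> being indexed by (1,1), (1,2), (2,1), (2,2).
\<close>

type_synonym 'a mat2 = "'a^2^2"
type_synonym 'a mat22 = "'a^(2\<times>2)^(2\<times>2)"

definition basis_pos :: "2 \<times> 2 \<Rightarrow> nat" where
  "basis_pos p = (if fst p = 1 then 0 else 2) + (if snd p = 1 then 0 else 1)"

definition mat22_of_rows :: "'a list list \<Rightarrow> 'a mat22" where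
  "mat22_of_rows xss = (\<chi> p q. xss ! basis_pos p ! basis_pos q)"

definition kron :: "'a::semiring_1 mat2 \<Rightarrow> 'a mat2 \<Rightarrow> 'a mat22" where
  "kron A B = (\<chi> p q. A $ fst p $ fst q * B $ snd p $ snd q)"

abbreviation leg1 :: "'a::semiring_1 mat2 \<Rightarrow> 'a mat22" where
  "leg1 A \<equiv> kron A (mat 1)"

abbreviation leg2 :: "'a::semiring_1 mat2 \<Rightarrow> 'a mat22" where
  "leg2 A \<equiv> kron (mat 1) A"

definition commutator :: "'a::ring_1^'n^'n \<Rightarrow> 'a^'n^'n \<Rightarrow> 'a^'n^'n" where
  "commutator A B = A ** B - B ** A"

definition map_mat :: "('a \<Rightarrow> 'b) \<Rightarrow> 'a^'n^'m \<Rightarrow> 'b^'n^'m" where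
  "map_mat f A = (\<chi> i j. f (A $ i $ j))"

definition H_mat :: "'a::ring_1 mat2" where
  "H_mat = vector [vector [1, 0], vector [0, -1]]"

definition L_op :: "(complex \<Rightarrow> complex) \<Rightarrow> branch \<Rightarrow> complex \<Rightarrow> K0 \<Rightarrow> affine mat2" where
  "L_op \<theta> \<epsilon> l s = vector
     [vector [(1/2) *\<^sub>C h_half \<theta> \<epsilon> s, f_half \<theta> \<epsilon> l s],
      vector [e_half \<theta> \<epsilon> l s, - ((1/2) *\<^sub>C h_half \<theta> \<epsilon> s)]]"

definition L_op_dlam :: "(complex \<Rightarrow> complex) \<Rightarrow> branch \<Rightarrow> complex \<Rightarrow> K0 \<Rightarrow> affine mat2" where
  "L_op_dlam \<theta> \<epsilon> l s = (\<chi> i j. affine_deriv (\<lambda>l'. L_op \<theta> \<epsilon> l' s $ i $ j) l)"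

definition r_mat :: "(complex \<Rightarrow> complex) \<Rightarrow> complex \<Rightarrow> K0 \<Rightarrow> K0 \<Rightarrow> complex mat22" where
  "r_mat \<theta> l s t = (let G = green \<theta> s t / 2 in mat22_of_rows
     [[G, 0, 0, 0],
      [0, - G, green_lam \<theta> Plus (- l) s t, 0],
      [0, green_lam \<theta> Plus l s t, - G, 0],
      [0, 0, 0, G]])"

definition r_mat_dlam :: "(complex \<Rightarrow> complex) \<Rightarrow> complex \<Rightarrow> K0 \<Rightarrow> K0 \<Rightarrow> complex mat22" where
  "r_mat_dlam \<theta> l s t = (\<chi> p q. deriv (\<lambda>l'. r_mat \<theta> l' s t $ p $ q) l)"

definition dist_deriv :: "(K0 \<Rightarrow> 'v::ab_group_add) \<Rightarrow> K0 \<Rightarrow> 'v" where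
  "dist_deriv X s = - X (K0_deriv s)"

text \<open>The products \<open>a(u,v) x(u)\<close> and \<open>a(u,v) x(v)\<close>, evaluated on \<open>s(u) t(v)\<close>.\<close>

definition prod_u :: "dist2 \<Rightarrow> (K0 \<Rightarrow> 'v) \<Rightarrow> K0 \<Rightarrow> K0 \<Rightarrow> 'v" where
  "prod_u a x s t = x (s * partial_snd a t)"

definition prod_v :: "dist2 \<Rightarrow> (K0 \<Rightarrow> 'v) \<Rightarrow> K0 \<Rightarrow> K0 \<Rightarrow> 'v" where
  "prod_v a x s t = x (t * partial_fst a s)"

text \<open>
  The commutator \<open>[X, a]\<close> of matrices of distributions, where \<open>X\<close> depends on one of the
  variables u, v only and \<open>P\<close> is the corresponding product \<open>prod_u\<close> or \<open>prod_v\<close>.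
\<close>

definition commutator_dist ::
  "(dist2 \<Rightarrow> (K0 \<Rightarrow> 'v) \<Rightarrow> K0 \<Rightarrow> K0 \<Rightarrow> 'v) \<Rightarrow>
   (K0 \<Rightarrow> 'v::ab_group_add mat22) \<Rightarrow> (K0 \<Rightarrow> K0 \<Rightarrow> complex mat22) \<Rightarrow> K0 \<Rightarrow> K0 \<Rightarrow> 'v mat22" where
  "commutator_dist P X a s t = (\<chi> p q. \<Sum>k\<in>UNIV.
     P (\<lambda>s t. a s t $ k $ q) (\<lambda>s. X s $ p $ k) s t -
     P (\<lambda>s t. a s t $ p $ k) (\<lambda>s. X s $ k $ q) s t)"

text \<open>
  The relations for the images of the L-operators under a linear map \<open>\<rho>\<close> from the Lie algebra
  to an associative algebra.  A distribution depending on one variable only is paired with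
  the test function of the other variable through \<open>\<langle>1, s\<rangle>\<close>.
\<close>

definition L_img ::
  "(affine \<Rightarrow> 'a::complex_algebra_1) \<Rightarrow> (complex \<Rightarrow> complex) \<Rightarrow> branch \<Rightarrow> complex \<Rightarrow> K0 \<Rightarrow> 'a mat2" where
  "L_img \<rho> \<theta> \<epsilon> l s = map_mat \<rho> (L_op \<theta> \<epsilon> l s)"

definition L_img_dlam ::
  "(affine \<Rightarrow> 'a::complex_algebra_1) \<Rightarrow> (complex \<Rightarrow> complex) \<Rightarrow> branch \<Rightarrow> complex \<Rightarrow> K0 \<Rightarrow> 'a mat2" where
  "L_img_dlam \<rho> \<theta> \<epsilon> l s = map_mat \<rho> (L_op_dlam \<theta> \<epsilon> l s)"

definition exchange_rhs ::
  "(affine \<Rightarrow> 'a::complex_algebra_1) \<Rightarrow> (complex \<Rightarrow> complex) \<Rightarrow> branch \<Rightarrow> branch \<Rightarrow> complex \<Rightarrow>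
   K0 \<Rightarrow> K0 \<Rightarrow> 'a mat22" where
  "exchange_rhs \<rho> \<theta> \<epsilon> \<epsilon>' l s t =
     commutator_dist prod_u (\<lambda>s. leg1 (L_img \<rho> \<theta> \<epsilon> l s)) (r_mat \<theta> l) s t +
     commutator_dist prod_v (\<lambda>t. leg2 (L_img \<rho> \<theta> \<epsilon>' l t)) (r_mat \<theta> l) s t +
     map_mat (\<lambda>x. K0_pair 1 s *\<^sub>C x) (leg1 H_mat ** leg2 (L_img_dlam \<rho> \<theta> \<epsilon>' l t)) -
     map_mat (\<lambda>x. K0_pair 1 t *\<^sub>C x) (leg2 H_mat ** leg1 (L_img_dlam \<rho> \<theta> \<epsilon> l s)) +
     map_mat (\<lambda>a. a *\<^sub>C \<rho> (hat Bh 1)) (r_mat_dlam \<theta> l s t)"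

definition half_current_relations ::
  "(affine \<Rightarrow> 'a::complex_algebra_1) \<Rightarrow> (complex \<Rightarrow> complex) \<Rightarrow> complex \<Rightarrow> bool" where
  "half_current_relations \<rho> \<theta> l \<longleftrightarrow>
     (\<forall>\<epsilon> s. commutator (mat (\<rho> d_elem)) (L_img \<rho> \<theta> \<epsilon> l s) = - dist_deriv (L_img \<rho> \<theta> \<epsilon> l) s) \<and>
     (\<forall>\<epsilon> s t. commutator (leg1 (L_img \<rho> \<theta> \<epsilon> l s)) (leg2 (L_img \<rho> \<theta> \<epsilon> l t)) =
        exchange_rhs \<rho> \<theta> \<epsilon> \<epsilon> l s t) \<and>
     (\<forall>s t. commutator (leg1 (L_img \<rho> \<theta> Plus l s)) (leg2 (L_img \<rho> \<theta> Minus l t)) =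
        exchange_rhs \<rho> \<theta> Plus Minus l s t +
        map_mat (\<lambda>a. a *\<^sub>C \<rho> c_elem) (dist_deriv (\<lambda>s. r_mat \<theta> l s t) s))"

end

theory Submission
  imports Defs
begin

text \<open>
  Fix a kernel k with a simple pole of residue 1 at 0.  Integrating k(u - z) s(u) over a small
  circle |u| = r with r < |z| picks out the residue at u = 0; for r > |z| the residue s(z) at
  u = z is added.  So the two half-currents of a current come from two operators on test
  functions with P^+ = 1 + P^-.  The operator P^- sees only the principal part of its argument, and
  P^+ s is regular at 0 because the principal parts cancel; hence P^+ is a projection and
  P^+ P^- = 0 (\<open>outer_inner_part\<close>).  Moreover P^+ for k is minus the adjoint of P^- for the kernel
  - k(- x) (\<open>outer_part_transpose\<close>).  Together with the fact that the operators commute with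
  d/du, this already gives every term containing the central element.

  For the remaining terms write P for the operators of
  g(x) = \<theta>(x + \<lambda>) / (\<theta>(x) \<theta>(\<lambda>)), Q for those of \<theta>'(x) / \<theta>(x), and D for the
  \<lambda>-derivative of P^-.  All relations between a Cartan current and a root current amount to the single
  identity (\<open>cartan_root_identity\<close>)

    Q^- s \<cdot> P^- t = P^- (s \<cdot> P^- t) + P^- (t \<cdot> Q^+ s) + Res(s) D t,

  the other choices of signs being consequences of P^+ = 1 + P^- and Q^+ = 1 + Q^-.  It is the
  trisecant identity

    g(x) g(y) = g(x + y) (\<theta>'(x) / \<theta>(x) + \<theta>'(y) / \<theta>(y)) - (d/d\<lambda>) g(x + y)

  integrated against s and t.  The relation between the two root currents is the adjoint of the
  same identity: pairing it with a third test function and moving every operator to the other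
  side turns it into a formula for the product of P^+ w and P^- t, with - \<lambda> in place of \<lambda> in
  the first factor (\<open>root_root\<close>).

  The trisecant identity compares two entire functions with the same factors of
  automorphy; their quotient is entire and doubly periodic, hence constant
  (\<open>entire_multiplier_unique\<close>).  This uses that \<theta> vanishes exactly on the lattice and to first
  order there (\<open>theta_zeros\<close>), which follows in the same way by comparing \<theta> with the triple
  product, whose zeros can be read off.  The same fact makes \<theta>(\<lambda>) nonzero.

  The action of the r-matrix in either variable is given by the operators with the
  superscripts above.  Therefore, for an arbitrary linear map \<rho> on the Lie algebra,
  each matrix entry of the right-hand side of an exchange relation is \<rho> of the
  bracket of two entries of the L-operators (\<open>exchange_entry\<close>), and the relations say precisely that
  \<rho> turns the brackets of half-currents into commutators.  For the enveloping algebra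
  this holds by construction.  Conversely every current is the difference of its
  half-currents, so that \<rho> respects the brackets of all currents; those with d are
  covered by the first relation, and c is central on both sides.
\<close>

section \<open>Entire functions with given factors of automorphy\<close>

text \<open>
  Near a zero of p both f and p are divisible by the linear factor, and the remaining factor of p does
  not vanish; so the quotient extends holomorphically over the zeros of p.
\<close>

lemma entire_quotient:
  fixes f p :: "complex \<Rightarrow> complex"
  assumes f: "f holomorphic_on UNIV" and p: "p holomorphic_on UNIV"
    and simple: "\<And>z. p z = 0 \<Longrightarrow> deriv p z \<noteq> 0"
    and zeros: "\<And>z. p z = 0 \<Longrightarrow> f z = 0"
  obtains h where "h holomorphic_on UNIV" "\<And>z. f z = p z * h z"
proof -
  define h where "h z = (if p z = 0 then deriv f z / deriv p z else f z / p z)" for z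
  have "h analytic_on {z0}" for z0
  proof (cases "p z0 = 0")
    case False
    have "open {z. p z \<noteq> 0}"
      using p by (intro open_Collect_neq holomorphic_on_imp_continuous_on continuous_on_const)
    moreover have "h holomorphic_on {z. p z \<noteq> 0}"
    proof (rule holomorphic_transform)
      show "(\<lambda>z. f z / p z) holomorphic_on {z. p z \<noteq> 0}"
        using f p by (intro holomorphic_intros) (auto intro: holomorphic_on_subset)
    qed (auto simp: h_def)
    ultimately show ?thesis
      using False analytic_at by blast
  next
    case True
    define F where "F z = (if z = z0 then deriv f z0 else f z / (z - z0))" for z
    define P where "P z = (if z = z0 then deriv p z0 else p z / (z - z0))" for z
    have divided: "(\<lambda>z. if z = z0 then deriv g z0 else g z / (z - z0)) holomorphic_on UNIV"
      if "g holomorphic_on UNIV" "g z0 = 0" for g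
      using pole_theorem[of g UNIV z0 "\<lambda>z. g z / (z - z0)"] that by (simp cong: if_cong)
    have F: "F holomorphic_on UNIV" and P: "P holomorphic_on UNIV"
      unfolding F_def[abs_def] P_def[abs_def] using f p True zeros[OF True] by (auto intro: divided)
    have "open {z. P z \<noteq> 0}"
      using P by (intro open_Collect_neq holomorphic_on_imp_continuous_on continuous_on_const)
    moreover have "h holomorphic_on {z. P z \<noteq> 0}"
    proof (rule holomorphic_transform)
      show "(\<lambda>z. F z / P z) holomorphic_on {z. P z \<noteq> 0}"
        using F P by (intro holomorphic_intros) (auto intro: holomorphic_on_subset)
      show "F z / P z = h z" if "z \<in> {z. P z \<noteq> 0}" for z
        using that True by (auto simp: F_def P_def h_def)
    qed
    moreover have "P z0 \<noteq> 0"
      using simple[OF True] by (simp add: P_def)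
    ultimately show ?thesis
      using analytic_at by blast
  qed
  then have "h holomorphic_on UNIV"
    by (meson analytic_imp_holomorphic analytic_on_analytic_at)
  moreover have "f z = p z * h z" for z
    using zeros[of z] by (auto simp: h_def)
  ultimately show thesis
    using that by blast
qed

lemma int_period:
  fixes f :: "complex \<Rightarrow> 'a"
  assumes "\<And>u. f (u + p) = f u"
  shows "f (u + of_int n * p) = f u"
proof (induction n arbitrary: u rule: int_induct[where k = 0])
  case base
  show ?case by simp
next
  case (step1 i)
  show ?case
    using assms[of "u + of_int i * p"] step1 by (simp add: algebra_simps)
next
  case (step2 i)
  show ?case
    using assms[of "u + of_int (i - 1) * p"] step2 by (simp add: algebra_simps)
qed

text \<open>
  A doubly periodic function takes all its values on the compact period parallelogram, so Liouville's
  theorem applies.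
\<close>

lemma entire_elliptic_constant:
  fixes f :: "complex \<Rightarrow> complex"
  assumes tau: "Im \<tau> > 0" and f: "f holomorphic_on UNIV"
    and per1: "\<And>u. f (u + 1) = f u" and per\<tau>: "\<And>u. f (u + \<tau>) = f u"
  obtains c where "\<And>u. f u = c"
proof -
  define K where "K = (\<lambda>(x, y). of_real x + of_real y * \<tau>) ` ({0..1::real} \<times> {0..1::real})"
  have "compact K"
    unfolding K_def
    by (intro compact_continuous_image compact_Times) (auto simp: case_prod_unfold intro!: continuous_intros)
  then have "bounded (f ` K)"
    using f by (intro compact_imp_bounded compact_continuous_image)
      (auto intro: holomorphic_on_imp_continuous_on holomorphic_on_subset)
  moreover have "range f \<subseteq> f ` K"
  proof clarify
    fix u
    define y where "y = Im u / Im \<tau>"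
    define x where "x = Re u - y * Re \<tau>"
    have u: "u = of_real x + of_real y * \<tau>"
      using tau by (simp add: complex_eq_iff x_def y_def)
    let ?v = "of_real (frac x) + of_real (frac y) * \<tau>"
    have "u = ?v + of_int \<lfloor>x\<rfloor> * 1 + of_int \<lfloor>y\<rfloor> * \<tau>"
      unfolding u frac_def by (simp add: algebra_simps)
    then have "f u = f ?v"
      using int_period[of f \<tau>, OF per\<tau>] int_period[of f 1, OF per1] by metis
    moreover have "?v \<in> K"
      unfolding K_def by (rule image_eqI[where x = "(frac x, frac y)"]) (auto simp: less_imp_le frac_lt_1)
    ultimately show "f u \<in> f ` K" by blast
  qed
  ultimately have "f constant_on UNIV"
    using f bounded_subset by (intro Liouville_theorem) auto
  then show thesis
    using that by (auto simp: constant_on_def)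
qed

text \<open>
  The function is the infinite product of the factors 1 - q^n w, but only its functional equation
  matters.  Solving that equation for the coefficients of a power series leads to Euler's
  series, whose convergence is easier to establish than that of the product.
\<close>

lemma q_exponential_exists:
  fixes q :: complex
  assumes q: "norm q < 1"
  obtains \<phi> where "\<phi> holomorphic_on UNIV" "\<phi> 0 = 1" "\<And>w. \<phi> w = (1 - w) * \<phi> (q * w)"
proof -
  have qn: "q ^ Suc n \<noteq> 1" for n
  proof
    assume "q ^ Suc n = 1"
    then have "norm q ^ Suc n = 1" by (metis norm_one norm_power)
    moreover have "norm q ^ Suc n < 1"
      using q by (intro power_less_one_iff[THEN iffD2]) auto
    ultimately show False by simp
  qed
  \<comment> \<open>The functional equation forces (1 - q^(n + 1)) a (n + 1) = - q^n a n.\<close>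
  define a where "a n = (\<Prod>k<n. - (q ^ k) / (1 - q ^ Suc k))" for n
  have a0: "a 0 = 1" and aS: "a (Suc n) * (1 - q ^ Suc n) = - a n * q ^ n" for n
    using qn[of n] by (auto simp: a_def field_simps)
  have sm: "summable (\<lambda>n. a n * w ^ n)" for w
  proof -
    have lim: "(\<lambda>n. - (q ^ n) / (1 - q ^ Suc n) * w) \<longlonglongrightarrow> - 0 / (1 - 0) * w"
      using q by (intro tendsto_intros LIMSEQ_power_zero LIMSEQ_Suc[OF LIMSEQ_power_zero]) auto
    then have "(\<lambda>n. norm (- (q ^ n) / (1 - q ^ Suc n) * w)) \<longlonglongrightarrow> 0"
      using tendsto_norm_zero by fastforce
    then have "\<forall>\<^sub>F n in sequentially. norm (- (q ^ n) / (1 - q ^ Suc n) * w) < 1 / 2"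
      by (rule order_tendstoD) simp
    then obtain N where N: "\<And>n. n \<ge> N \<Longrightarrow> norm (- (q ^ n) / (1 - q ^ Suc n) * w) < 1 / 2"
      unfolding eventually_sequentially by blast
    have "norm (a (Suc n) * w ^ Suc n) \<le> 1 / 2 * norm (a n * w ^ n)" if "n \<ge> N" for n
    proof -
      have "a (Suc n) * w ^ Suc n = (- (q ^ n) / (1 - q ^ Suc n) * w) * (a n * w ^ n)"
        by (simp add: a_def)
      then have "norm (a (Suc n) * w ^ Suc n)
          = norm (- (q ^ n) / (1 - q ^ Suc n) * w) * norm (a n * w ^ n)"
        by (metis norm_mult)
      also have "\<dots> \<le> 1 / 2 * norm (a n * w ^ n)"
        using N[OF that] by (intro mult_right_mono) auto
      finally show ?thesis .
    qed
    then show ?thesis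
      using summable_ratio_test[of "1/2" N "\<lambda>n. a n * w ^ n"] by simp
  qed
  define \<phi> where "\<phi> w = suminf (\<lambda>n. a n * w ^ n)" for w
  have sums: "(\<lambda>n. a n * w ^ n) sums \<phi> w" for w
    unfolding \<phi>_def using sm by (rule summable_sums)
  have "\<phi> holomorphic_on ball 0 r" for r
    by (rule power_series_holomorphic[where a = a]) (use sums in auto)
  then have "\<phi> analytic_on {z}" for z
    by (metis analytic_at centre_in_ball dist_0_norm linordered_field_no_ub mem_ball open_ball)
  then have 1: "\<phi> holomorphic_on UNIV"
    by (meson analytic_imp_holomorphic analytic_on_analytic_at)
  have 2: "\<phi> 0 = 1"
    using a0 by (simp add: \<phi>_def)
  have 3: "\<phi> w = (1 - w) * \<phi> (q * w)" for w
  proof -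
    have s1: "(\<lambda>n. a (Suc n) * w ^ Suc n) sums (\<phi> w - 1)"
      using sums[of w] a0 by (subst sums_Suc_iff) simp
    have s2: "(\<lambda>n. a (Suc n) * (q * w) ^ Suc n) sums (\<phi> (q * w) - 1)"
      using sums[of "q * w"] a0 by (subst sums_Suc_iff) simp
    have s3: "(\<lambda>n. w * (a n * (q * w) ^ n)) sums (w * \<phi> (q * w))"
      by (intro sums_mult sums)
    have "a (Suc n) * w ^ Suc n = a (Suc n) * (q * w) ^ Suc n - w * (a n * (q * w) ^ n)" for n
    proof -
      have "a (Suc n) * w ^ Suc n - a (Suc n) * (q * w) ^ Suc n
          = (a (Suc n) * (1 - q ^ Suc n)) * w ^ Suc n"
        by (simp add: power_mult_distrib algebra_simps)
      also have "\<dots> = - (w * (a n * (q * w) ^ n))"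
        unfolding aS by (simp add: power_mult_distrib)
      finally show ?thesis by (simp add: algebra_simps)
    qed
    then have "(\<lambda>n. a (Suc n) * w ^ Suc n) sums (\<phi> (q * w) - 1 - w * \<phi> (q * w))"
      using sums_diff[OF s2 s3] by simp
    from sums_unique2[OF s1 this] show ?thesis
      by (simp add: algebra_simps)
  qed
  from 1 2 3 show thesis by (rule that)
qed

text \<open>
  A zero w with no q^n w = 1 would propagate along q^n w to the limit 0, where the function is 1.  A
  multiple zero would propagate likewise; it cannot be w = 1, where the derivative - \<phi>(q) is not 0.
\<close>

lemma q_exponential_zeros:
  fixes q :: complex
  assumes q: "norm q < 1" and hol: "\<phi> holomorphic_on UNIV"
    and one: "\<phi> 0 = 1" and fe: "\<And>w. \<phi> w = (1 - w) * \<phi> (q * w)"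
  shows "\<phi> w = 0 \<longleftrightarrow> (\<exists>n. q ^ n * w = 1)" and "\<phi> w = 0 \<Longrightarrow> deriv \<phi> w \<noteq> 0"
proof -
  have der: "(\<phi> has_field_derivative deriv \<phi> w) (at w)" for w
    using hol by (auto intro: holomorphic_derivI)
  have lim: "(\<lambda>n. \<phi> (q ^ n * w)) \<longlonglongrightarrow> 1" for w
  proof -
    have "(\<lambda>n. q ^ n * w) \<longlonglongrightarrow> 0 * w"
      using q by (intro tendsto_intros LIMSEQ_power_zero) auto
    moreover have "isCont \<phi> 0"
      using der by (rule DERIV_isCont)
    ultimately show ?thesis
      using one isCont_tendsto_compose[of 0 \<phi> "\<lambda>n. q ^ n * w"] by simp
  qed
  have nz: "\<phi> w \<noteq> 0" if "\<And>n. q ^ n * w \<noteq> 1" for w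
  proof
    assume "\<phi> w = 0"
    have "\<phi> (q ^ n * w) = 0" for n
    proof (induction n)
      case (Suc n)
      then show ?case using fe[of "q ^ n * w"] that[of n] by (simp add: mult.assoc)
    qed (simp add: \<open>\<phi> w = 0\<close>)
    then show False
      using lim[of w] LIMSEQ_const_iff[of 0 "1::complex"] by simp
  qed
  have z: "\<phi> w = 0" if "q ^ n * w = 1" for n w
    using that
  proof (induction n arbitrary: w)
    case 0
    then show ?case using fe[of w] by simp
  next
    case (Suc n)
    then show ?case using Suc(1)[of "q * w"] fe[of w] by (simp add: mult_ac)
  qed
  show "\<phi> w = 0 \<longleftrightarrow> (\<exists>n. q ^ n * w = 1)"
    using nz z by blast
  assume w: "\<phi> w = 0"
  show "deriv \<phi> w \<noteq> 0"
  proof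
    assume d: "deriv \<phi> w = 0"
    have fed: "deriv \<phi> w = - \<phi> (q * w) + (1 - w) * (q * deriv \<phi> (q * w))" for w
    proof -
      have "((\<lambda>w. (1 - w) * \<phi> (q * w)) has_field_derivative
           - \<phi> (q * w) + (1 - w) * (q * deriv \<phi> (q * w))) (at w)"
        by (auto intro!: derivative_eq_intros DERIV_chain'[OF _ der] simp: algebra_simps)
      moreover have "(\<lambda>w. (1 - w) * \<phi> (q * w)) = \<phi>"
        by (rule ext) (rule fe[symmetric])
      ultimately show ?thesis
        using DERIV_imp_deriv by fastforce
    qed
    have step: "\<phi> (q * v) = 0 \<and> q * deriv \<phi> (q * v) = 0" if "\<phi> v = 0" "deriv \<phi> v = 0" for v
    proof (cases "v = 1")
      case True
      have "q ^ n * q \<noteq> 1" for n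
      proof -
        have "norm (q ^ Suc n) < 1"
          unfolding norm_power using q by (intro power_less_one_iff[THEN iffD2]) auto
        then show ?thesis by (auto simp: mult.commute)
      qed
      then have "\<phi> (q * v) \<noteq> 0"
        using nz[of q] True by simp
      moreover have "\<phi> (q * v) = 0"
        using fed[of v] that True by simp
      ultimately show ?thesis by simp
    next
      case False
      then show ?thesis using fed[of v] fe[of v] that by auto
    qed
    show False
    proof (cases "q = 0")
      case True
      then show False using step[OF w d] one by simp
    next
      case False
      have "\<phi> (q ^ n * w) = 0 \<and> deriv \<phi> (q ^ n * w) = 0" for n
      proof (induction n)
        case (Suc n)
        then show ?case using step[of "q ^ n * w"] False by (simp add: mult.assoc)
      qed (simp add: w d)
      then show False
        using lim[of w] LIMSEQ_const_iff[of 0 "1::complex"] by simp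
    qed
  qed
qed

text \<open>
  The entire quotient f / p is doubly periodic.  Periodicity is clear where p does not vanish and
  extends to the zeros of p by analytic continuation.
\<close>

lemma entire_multiplier_unique:
  fixes f p \<alpha> \<beta> :: "complex \<Rightarrow> complex"
  assumes tau: "Im \<tau> > 0"
    and f: "f holomorphic_on UNIV" and p: "p holomorphic_on UNIV"
    and simple: "\<And>z. p z = 0 \<Longrightarrow> deriv p z \<noteq> 0"
    and zeros: "\<And>z. p z = 0 \<Longrightarrow> f z = 0"
    and mult: "\<And>u. \<alpha> u \<noteq> 0" "\<And>u. \<beta> u \<noteq> 0"
    and f1: "\<And>u. f (u + 1) = \<alpha> u * f u" and p1: "\<And>u. p (u + 1) = \<alpha> u * p u"
    and f\<tau>: "\<And>u. f (u + \<tau>) = \<beta> u * f u" and p\<tau>: "\<And>u. p (u + \<tau>) = \<beta> u * p u"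
  obtains c where "\<And>u. f u = c * p u"
proof -
  obtain h where h: "h holomorphic_on UNIV" and fh: "\<And>z. f z = p z * h z"
    using entire_quotient[OF f p simple zeros] by blast
  have "{z. p z \<noteq> 0} \<noteq> {}"
  proof
    assume "{z. p z \<noteq> 0} = {}"
    then have "p = (\<lambda>_. 0)" by auto
    with simple[of 0] show False by simp
  qed
  moreover have "open {z. p z \<noteq> 0}"
    using p by (intro open_Collect_neq holomorphic_on_imp_continuous_on continuous_on_const)
  ultimately have period: "h (u + \<omega>) = h u"
    if "\<And>u. \<mu> u \<noteq> 0" "\<And>u. f (u + \<omega>) = \<mu> u * f u" "\<And>u. p (u + \<omega>) = \<mu> u * p u" for u \<omega> \<mu>
  proof -
    have eq: "h (z + \<omega>) = h z" if "p z \<noteq> 0" for z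
    proof -
      have "\<mu> z * p z * h (z + \<omega>) = \<mu> z * p z * h z"
        using \<open>f (z + \<omega>) = \<mu> z * f z\<close> \<open>p (z + \<omega>) = \<mu> z * p z\<close>
        by (simp add: fh mult.assoc)
      with that \<open>\<And>u. \<mu> u \<noteq> 0\<close> show ?thesis by simp
    qed
    have "(h \<circ> (\<lambda>z. z + \<omega>)) holomorphic_on UNIV"
      using h by (intro holomorphic_on_compose holomorphic_intros) (auto intro: holomorphic_on_subset)
    then show ?thesis
      using analytic_continuation_open[of "{z. p z \<noteq> 0}" UNIV "\<lambda>z. h (z + \<omega>)" h u] h eq
        \<open>open {z. p z \<noteq> 0}\<close> \<open>{z. p z \<noteq> 0} \<noteq> {}\<close>
      by (simp add: o_def connected_UNIV)
  qed
  obtain c where "\<And>u. h u = c"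
    using entire_elliptic_constant[OF tau h period[OF mult(1) f1 p1] period[OF mult(2) f\<tau> p\<tau>]]
    by blast
  with fh that[of c] show thesis by (simp add: mult.commute)
qed

section \<open>Zeros of the theta function\<close>

locale theta =
  fixes \<tau> :: complex and \<theta> :: "complex \<Rightarrow> complex"
  assumes tau: "Im \<tau> > 0" and theta_function: "theta_function \<tau> \<theta>"
begin

abbreviation lattice :: "complex set" where
  "lattice \<equiv> {of_int m + \<tau> * of_int n | m n. True}"

text \<open>
  The factor of automorphy of \<theta> for the period \<tau>.
\<close>

definition mu :: "complex \<Rightarrow> complex" where
  "mu u = - exp (- 2 * of_real pi * \<i> * u - of_real pi * \<i> * \<tau>)"

lemma holomorphic_theta: "\<theta> holomorphic_on A"
  and theta_minus: "\<theta> (- u) = - \<theta> u"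
  and theta_plus_1: "\<theta> (u + 1) = - \<theta> u"
  and theta_plus_tau: "\<theta> (u + \<tau>) = mu u * \<theta> u"
  and deriv_theta_0: "deriv \<theta> 0 = 1"
  using theta_function by (auto simp: theta_function_def mu_def intro: holomorphic_on_subset)

lemma holomorphic_theta' [holomorphic_intros]:
  "g holomorphic_on A \<Longrightarrow> (\<lambda>x. \<theta> (g x)) holomorphic_on A"
  using holomorphic_on_compose[OF _ holomorphic_theta] by (simp add: o_def)

lemma holomorphic_deriv_theta' [holomorphic_intros]:
  "g holomorphic_on A \<Longrightarrow> (\<lambda>x. deriv \<theta> (g x)) holomorphic_on A"
  using holomorphic_on_compose[OF _ holomorphic_on_subset[OF holomorphic_deriv[OF holomorphic_theta open_UNIV]]]
  by (simp add: o_def)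

lemma theta_0: "\<theta> 0 = 0"
  using theta_minus[of 0] by simp

lemma mu_nonzero: "mu u \<noteq> 0"
  by (simp add: mu_def)

lemma has_field_derivative_theta: "(\<theta> has_field_derivative deriv \<theta> u) (at u)"
  using holomorphic_theta[of UNIV] by (auto intro: holomorphic_derivI)

lemma has_field_derivative_theta' [derivative_intros]:
  "(g has_field_derivative g') (at u within S) \<Longrightarrow>
     ((\<lambda>x. \<theta> (g x)) has_field_derivative deriv \<theta> (g u) * g') (at u within S)"
  using DERIV_chain2[OF has_field_derivative_theta] by blast

lemma deriv_theta_plus_1: "deriv \<theta> (u + 1) = - deriv \<theta> u"
proof -
  have "((\<lambda>u. \<theta> (u + 1)) has_field_derivative deriv \<theta> (u + 1)) (at u)"
    by (auto intro!: derivative_eq_intros)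
  moreover have "((\<lambda>u. \<theta> (u + 1)) has_field_derivative - deriv \<theta> u) (at u)"
    unfolding theta_plus_1 by (auto intro!: derivative_eq_intros)
  ultimately show ?thesis by (rule DERIV_unique)
qed

lemma deriv_theta_plus_tau:
  "deriv \<theta> (u + \<tau>) = mu u * (deriv \<theta> u - 2 * of_real pi * \<i> * \<theta> u)"
proof -
  have "((\<lambda>u. \<theta> (u + \<tau>)) has_field_derivative deriv \<theta> (u + \<tau>)) (at u)"
    by (auto intro!: derivative_eq_intros)
  moreover have "((\<lambda>u. \<theta> (u + \<tau>)) has_field_derivative
      mu u * (deriv \<theta> u - 2 * of_real pi * \<i> * \<theta> u)) (at u)"
    unfolding theta_plus_tau mu_def by (auto intro!: derivative_eq_intros simp: algebra_simps)
  ultimately show ?thesis by (rule DERIV_unique)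
qed

lemma deriv_theta_minus: "deriv \<theta> (- u) = deriv \<theta> u"
proof -
  have "((\<lambda>u. \<theta> (- u)) has_field_derivative - deriv \<theta> (- u)) (at u)"
    by (auto intro!: derivative_eq_intros)
  moreover have "((\<lambda>u. \<theta> (- u)) has_field_derivative - deriv \<theta> u) (at u)"
    unfolding theta_minus by (auto intro!: derivative_eq_intros)
  ultimately show ?thesis using DERIV_unique by fastforce
qed

lemma theta_lattice: assumes "u \<in> lattice" shows "\<theta> u = 0"
proof -
  obtain m n where u: "u = of_int m + \<tau> * of_int n" using assms by blast
  have "(\<theta> (0 + of_int m * 1 + of_int n * \<tau>) = 0) = (\<theta> 0 = 0)"
    using int_period[of "\<lambda>u. \<theta> u = 0" 1 0 m] int_period[of "\<lambda>u. \<theta> u = 0" \<tau> "0 + of_int m * 1" n]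
    by (simp add: theta_plus_1 theta_plus_tau mu_nonzero)
  then show ?thesis by (simp add: u theta_0 mult.commute)
qed

lemma exp_2pi_eq_1_iff: "exp (2 * of_real pi * \<i> * v) = 1 \<longleftrightarrow> (\<exists>n::int. v = of_int n)"
proof -
  have "exp (2 * of_real pi * \<i> * v) = 1 \<longleftrightarrow> (\<exists>n::int. 2 * of_real pi * \<i> * v = 2 * of_real pi * \<i> * of_int n)"
    using exp_eq[of "2 * of_real pi * \<i> * v" 0] by (simp add: mult_ac)
  then show ?thesis by simp
qed

text \<open>
  With w = exp(2\<pi>iu) and q = exp(2\<pi>i\<tau>), the function p(u) = exp(- \<pi>iu) \<phi>(w) \<phi>(q / w) has the same
  factors of automorphy as \<theta>.  Its zeros are simple and lie in the lattice, where \<theta> vanishes by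
  quasi-periodicity and oddness.  So \<theta> is a multiple of p, and the multiple is not
  zero since \<theta>'(0) = 1.
\<close>

lemma theta_zeros:
  shows theta_eq_0_iff: "\<theta> u = 0 \<longleftrightarrow> u \<in> lattice"
    and theta_zero_simple: "\<theta> u = 0 \<Longrightarrow> deriv \<theta> u \<noteq> 0"
proof -
  define q where "q = exp (2 * of_real pi * \<i> * \<tau>)"
  have q: "norm q < 1" "q \<noteq> 0"
    using tau by (simp_all add: q_def mult_pos_pos)
  obtain \<phi> where hol: "\<phi> holomorphic_on UNIV" and one: "\<phi> 0 = 1"
      and fe: "\<And>w. \<phi> w = (1 - w) * \<phi> (q * w)"
    using q_exponential_exists[OF q(1)] by blast
  note \<phi>_zeros = q_exponential_zeros[OF q(1) hol one fe]
  have der\<phi>: "(\<phi> has_field_derivative deriv \<phi> w) (at w)" for w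
    using hol by (auto intro: holomorphic_derivI)
  define w where "w u = exp (2 * of_real pi * \<i> * u)" for u
  define p where "p u = exp (- of_real pi * \<i> * u) * (\<phi> (w u) * \<phi> (q / w u))" for u
  have w: "w u \<noteq> 0" "w (u + 1) = w u" "w (u + \<tau>) = q * w u" for u
    by (simp_all add: w_def q_def exp_add ring_distribs mult_ac)
  have derw: "(w has_field_derivative 2 * of_real pi * \<i> * w u) (at u)" for u
    unfolding w_def[abs_def] by (auto intro!: derivative_eq_intros)
  have derp: "(p has_field_derivative
      exp (- of_real pi * \<i> * u) * (- of_real pi * \<i>) * (\<phi> (w u) * \<phi> (q / w u)) +
      exp (- of_real pi * \<i> * u) *
       (2 * of_real pi * \<i>) * (w u * deriv \<phi> (w u) * \<phi> (q / w u) - \<phi> (w u) * (q / w u) * deriv \<phi> (q / w u))) (at u)" for u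
  proof -
    have "((\<lambda>u. q / w u) has_field_derivative - (2 * of_real pi * \<i> * (q / w u))) (at u)"
      using w(1)[of u] by (auto intro!: derivative_eq_intros derw simp: field_simps power2_eq_square)
    note 1 = DERIV_chain2[OF der\<phi> derw, of u] and 2 = DERIV_chain2[OF der\<phi> this]
    have 3: "((\<lambda>u. exp (- of_real pi * \<i> * u)) has_field_derivative
        exp (- of_real pi * \<i> * u) * (- of_real pi * \<i>)) (at u)"
      by (auto intro!: derivative_eq_intros)
    show ?thesis
      unfolding p_def[abs_def]
      by (rule DERIV_cong[OF DERIV_mult[OF 3 DERIV_mult[OF 1 2]]]) (simp add: algebra_simps)
  qed
  then have holp: "p holomorphic_on UNIV"
    unfolding holomorphic_on_def field_differentiable_def by blast
  have p_zero: "u \<in> lattice" if "p u = 0" for u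
  proof -
    have pow: "q ^ n * w u = w (of_nat n * \<tau> + u)" for n
      unfolding q_def w_def exp_of_nat_mult[symmetric] exp_add[symmetric]
      by (rule arg_cong[where f = exp]) (simp add: algebra_simps)
    have pow': "q ^ n * (q / w u) = w (of_nat (Suc n) * \<tau> - u)" for n
      unfolding q_def w_def exp_of_nat_mult[symmetric] exp_diff[symmetric] exp_add[symmetric]
      by (rule arg_cong[where f = exp]) (simp add: algebra_simps)
    have "\<phi> (w u) = 0 \<or> \<phi> (q / w u) = 0"
      using that by (simp add: p_def)
    then consider n where "w (of_nat n * \<tau> + u) = 1" | n where "w (of_nat (Suc n) * \<tau> - u) = 1"
      unfolding \<phi>_zeros(1) pow pow' by blast
    then show ?thesis
    proof cases
      case 1
      then obtain m :: int where "of_nat n * \<tau> + u = of_int m"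
        unfolding w_def exp_2pi_eq_1_iff by blast
      then have "u = of_int m + \<tau> * of_int (- int n)" by (simp add: algebra_simps)
      then show ?thesis by blast
    next
      case 2
      then obtain m :: int where "of_nat (Suc n) * \<tau> - u = of_int m"
        unfolding w_def exp_2pi_eq_1_iff by blast
      then have "u = of_int (- m) + \<tau> * of_int (int (Suc n))" by (simp add: algebra_simps)
      then show ?thesis by blast
    qed
  qed
  have p_simple: "deriv p u \<noteq> 0" if "p u = 0" for u
  proof -
    \<comment> \<open>A common zero of both factors would make a positive power of q equal to 1.\<close>
    have disjoint: "\<not> (\<phi> (w u) = 0 \<and> \<phi> (q / w u) = 0)"
    proof
      assume "\<phi> (w u) = 0 \<and> \<phi> (q / w u) = 0"
      then obtain m n where "q ^ m * w u = 1" "q ^ n * (q / w u) = 1"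
        unfolding \<phi>_zeros(1) by blast
      then have "(q ^ m * w u) * (q ^ n * (q / w u)) = 1" by simp
      then have "q ^ Suc (m + n) = 1" using w(1)[of u] by (simp add: power_add mult_ac)
      then have "norm q ^ Suc (m + n) = 1" by (metis norm_one norm_power)
      moreover have "norm q ^ Suc (m + n) < 1"
        using q by (intro power_less_one_iff[THEN iffD2]) auto
      ultimately show False by simp
    qed
    show ?thesis
    proof (cases "\<phi> (w u) = 0")
      case True
      moreover have "\<phi> (q / w u) \<noteq> 0"
        using disjoint True by blast
      ultimately show ?thesis
        unfolding DERIV_imp_deriv[OF derp] using \<phi>_zeros(2)[OF True] w(1)[of u] by simp
    next
      case False
      then have zero: "\<phi> (q / w u) = 0"
        using that by (simp add: p_def)
      show ?thesis
        unfolding DERIV_imp_deriv[OF derp] using \<phi>_zeros(2)[OF zero] zero False w(1)[of u] q(2) by simp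
    qed
  qed
  have p1: "p (u + 1) = - 1 * p u" for u
  proof -
    have "exp (- of_real pi * \<i> * (u + 1)) = - exp (- of_real pi * \<i> * u)"
      using exp_add[of "- of_real pi * \<i> * u" "- of_real pi * \<i>"] exp_pi_i by (simp add: ring_distribs exp_minus)
    then show ?thesis by (simp add: p_def w)
  qed
  have p\<tau>: "p (u + \<tau>) = mu u * p u" for u
  proof -
    have 1: "exp (- of_real pi * \<i> * (u + \<tau>)) = - mu u * w u * exp (- of_real pi * \<i> * u)"
      by (simp add: mu_def w_def exp_add[symmetric] algebra_simps)
    have 2: "w u * (\<phi> (q * w u) * \<phi> (q / (q * w u))) = - (\<phi> (w u) * \<phi> (q / w u))"
    proof -
      have "w u * \<phi> (q / (q * w u)) = (w u - 1) * \<phi> (q / w u)"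
        using fe[of "1 / w u"] w(1)[of u] q(2) by (simp add: field_simps)
      then have "w u * (\<phi> (q * w u) * \<phi> (q / (q * w u))) = \<phi> (q * w u) * ((w u - 1) * \<phi> (q / w u))"
        by (metis mult.left_commute)
      also have "\<dots> = - ((1 - w u) * \<phi> (q * w u)) * \<phi> (q / w u)"
        by (simp add: algebra_simps)
      also have "\<dots> = - \<phi> (w u) * \<phi> (q / w u)"
        unfolding fe[of "w u", symmetric] ..
      finally show ?thesis by simp
    qed
    have "p (u + \<tau>) = - mu u * exp (- of_real pi * \<i> * u) * (w u * (\<phi> (q * w u) * \<phi> (q / (q * w u))))"
      unfolding p_def w 1 by (simp add: mult_ac)
    also have "\<dots> = mu u * p u"
      unfolding 2 by (simp add: p_def)
    finally show ?thesis .
  qed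
  have minus_one_nonzero: "- 1 \<noteq> (0 :: complex)" by simp
  have \<theta>1: "\<theta> (u + 1) = - 1 * \<theta> u" for u
    by (simp add: theta_plus_1)
  obtain c where c: "\<And>u. \<theta> u = c * p u"
    by (rule entire_multiplier_unique[OF tau holomorphic_theta holp p_simple
          theta_lattice[OF p_zero] minus_one_nonzero mu_nonzero \<theta>1 p1 theta_plus_tau p\<tau>]) (assumption, assumption, rule that)
  have derc: "deriv \<theta> u = c * deriv p u" for u
  proof -
    have "((\<lambda>u. c * p u) has_field_derivative c * deriv p u) (at u)"
      using holp by (intro DERIV_cmult holomorphic_derivI[of _ UNIV]) simp_all
    moreover have "(\<lambda>u. c * p u) = \<theta>"
      using c by (intro ext) (rule sym)
    ultimately show ?thesis
      using DERIV_imp_deriv by metis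
  qed
  have "c \<noteq> 0" using deriv_theta_0 derc[of 0] by auto
  have p0: "p u = 0" if "\<theta> u = 0"
    using c[of u] that \<open>c \<noteq> 0\<close> by simp
  show "\<theta> u = 0 \<longleftrightarrow> u \<in> lattice"
    using p_zero[OF p0] theta_lattice by (rule iffI)
  show "deriv \<theta> u \<noteq> 0" if "\<theta> u = 0"
  proof -
    have "c * deriv p u \<noteq> 0"
      by (rule no_zero_divisors[OF \<open>c \<noteq> 0\<close> p_simple[OF p0[OF that]]])
    then show ?thesis
      unfolding derc .
  qed
qed

section \<open>The trisecant identity\<close>

lemma theta_diff_zeros:
  assumes "\<theta> u = 0" "\<theta> v = 0"
  shows "\<theta> (u - v) = 0"
proof -
  obtain m n m' n' where "u = of_int m + \<tau> * of_int n" "v = of_int m' + \<tau> * of_int n'"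
    using assms unfolding theta_eq_0_iff by blast
  then have "u - v = of_int (m - m') + \<tau> * of_int (n - n')" by (simp add: algebra_simps)
  then show ?thesis unfolding theta_eq_0_iff by blast
qed

text \<open>
  As functions of a, both sides have the factors of automorphy of \<theta>(a + b) \<theta>(a + l), and the
  left-hand side vanishes at - b and at - l.  If b and l are not congruent modulo the lattice,
  all zeros of that product are simple, so the two sides are proportional; the constant is found at a = 0.
  The remaining values of b, including the zeros of \<theta>, are reached by analytic continuation in b.
\<close>

lemma fay_identity:
  assumes l: "\<theta> l \<noteq> 0"
  shows "deriv \<theta> a * \<theta> b * \<theta> l * \<theta> (a + b + l) + \<theta> a * deriv \<theta> b * \<theta> l * \<theta> (a + b + l)
    + \<theta> a * \<theta> b * deriv \<theta> l * \<theta> (a + b + l) - \<theta> a * \<theta> b * \<theta> l * deriv \<theta> (a + b + l)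
    = \<theta> (a + b) * \<theta> (b + l) * \<theta> (a + l)"
proof -
  define W where "W b a = deriv \<theta> a * \<theta> b * \<theta> l * \<theta> (a + b + l) + \<theta> a * deriv \<theta> b * \<theta> l * \<theta> (a + b + l)
    + \<theta> a * \<theta> b * deriv \<theta> l * \<theta> (a + b + l) - \<theta> a * \<theta> b * \<theta> l * deriv \<theta> (a + b + l)" for a b
  have generic: "W b a = \<theta> (a + b) * \<theta> (b + l) * \<theta> (a + l)" if b: "\<theta> b * \<theta> (b - l) \<noteq> 0" for b a
  proof -
    define p where "p a = \<theta> (a + b) * \<theta> (a + l)" for a
    have derp: "deriv p a = deriv \<theta> (a + b) * \<theta> (a + l) + \<theta> (a + b) * deriv \<theta> (a + l)" for a
      unfolding p_def[abs_def] by (intro DERIV_imp_deriv) (auto intro!: derivative_eq_intros)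
    have holp: "p holomorphic_on UNIV"
      unfolding p_def[abs_def]
      by (intro holomorphic_intros)
    have holW: "W b holomorphic_on UNIV"
      unfolding W_def[abs_def]
      by (intro holomorphic_intros)
    have W1: "W b (a + 1) = 1 * W b a" for a
    proof -
      have s: "\<theta> (a + 1 + b + l) = - \<theta> (a + b + l)" "deriv \<theta> (a + 1 + b + l) = - deriv \<theta> (a + b + l)"
        using theta_plus_1[of "a + b + l"] deriv_theta_plus_1[of "a + b + l"] by (simp_all add: ac_simps)
      show ?thesis
        unfolding W_def theta_plus_1 deriv_theta_plus_1 s by simp
    qed
    have W\<tau>: "W b (a + \<tau>) = (mu a * mu (a + b + l)) * W b a" for a
    proof -
      have s: "\<theta> (a + \<tau> + b + l) = mu (a + b + l) * \<theta> (a + b + l)"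
        "deriv \<theta> (a + \<tau> + b + l) = mu (a + b + l) * (deriv \<theta> (a + b + l) - 2 * of_real pi * \<i> * \<theta> (a + b + l))"
        using theta_plus_tau[of "a + b + l"] deriv_theta_plus_tau[of "a + b + l"] by (simp_all add: ac_simps)
      show ?thesis
        unfolding W_def theta_plus_tau deriv_theta_plus_tau s by (simp add: algebra_simps)
    qed
    have mumu: "mu (a + b) * mu (a + l) = mu a * mu (a + b + l)" for a
      by (simp add: mu_def exp_add[symmetric] algebra_simps)
    have p1: "p (a + 1) = 1 * p a" for a
      using theta_plus_1[of "a + b"] theta_plus_1[of "a + l"] by (simp add: p_def ac_simps)
    have p\<tau>: "p (a + \<tau>) = (mu a * mu (a + b + l)) * p a" for a
    proof -
      have "\<theta> (a + \<tau> + b) = mu (a + b) * \<theta> (a + b)" "\<theta> (a + \<tau> + l) = mu (a + l) * \<theta> (a + l)"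
        using theta_plus_tau[of "a + b"] theta_plus_tau[of "a + l"] by (simp_all add: ac_simps)
      then show ?thesis
        unfolding p_def mumu[symmetric] by simp
    qed
    have mumu0: "mu a * mu (a + b + l) \<noteq> 0" for a
      by (simp add: mu_nonzero)
    \<comment> \<open>Quasi-periodicity carries the zeros at - b and - l to all their lattice translates.\<close>
    have W_zero: "W b a = 0" if v: "\<theta> (a + v) = 0" and v0: "W b (- v) = 0" for a v
    proof -
      obtain m n where "a + v = of_int m + \<tau> * of_int n"
        using v unfolding theta_eq_0_iff by blast
      then have "a = - v + of_int m * 1 + of_int n * \<tau>"
        by (simp add: algebra_simps)
      moreover have "(W b (- v + of_int m * 1 + of_int n * \<tau>) = 0) = (W b (- v) = 0)"
        using int_period[of "\<lambda>u. W b u = 0" 1 "- v" m]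
          int_period[of "\<lambda>u. W b u = 0" \<tau> "- v + of_int m * 1" n]
        by (simp add: W1 W\<tau> mu_nonzero)
      ultimately show ?thesis using v0 by simp
    qed
    have "W b (- b) = 0" "W b (- l) = 0"
      by (simp_all add: W_def theta_minus deriv_theta_minus)
    then have zeros: "W b a = 0" if "p a = 0" for a
      using that W_zero unfolding p_def by (metis mult_eq_0_iff)
    have simple: "deriv p a \<noteq> 0" if "p a = 0" for a
    proof -
      have "\<not> (\<theta> (a + b) = 0 \<and> \<theta> (a + l) = 0)"
        using b theta_diff_zeros[of "a + b" "a + l"] by fastforce
      then show ?thesis
        using that theta_zero_simple unfolding derp p_def
        by (metis add.left_neutral add.right_neutral mult_eq_0_iff)
    qed
    obtain c where c: "\<And>a. W b a = c * p a"
      by (rule entire_multiplier_unique[OF tau holW holp simple zeros one_neq_zero mumu0 W1 p1 W\<tau> p\<tau>]) (assumption, assumption, rule that)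
    have "W b 0 = \<theta> b * \<theta> l * \<theta> (b + l)"
      by (simp add: W_def theta_0 deriv_theta_0)
    then have "c = \<theta> (b + l)"
      using c[of 0] b l by (simp add: p_def)
    then show ?thesis
      using c[of a] by (simp add: p_def mult_ac)
  qed
  define S where "S = {b. \<theta> b * \<theta> (b - l) \<noteq> 0}"
  have hol: "(\<lambda>b. \<theta> b * \<theta> (b - l)) holomorphic_on UNIV"
    by (intro holomorphic_intros)
  have "open S"
    unfolding S_def using hol by (intro open_Collect_neq holomorphic_on_imp_continuous_on continuous_on_const)
  moreover have "S \<noteq> {}"
  proof
    assume "S = {}"
    then have "(\<lambda>b. \<theta> b * \<theta> (b - l)) = (\<lambda>_. 0)"
      unfolding S_def by blast
    moreover have "((\<lambda>b. \<theta> b * \<theta> (b - l)) has_field_derivative - \<theta> l) (at 0)"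
      by (auto intro!: derivative_eq_intros simp: theta_0 deriv_theta_0 theta_minus)
    ultimately have "- \<theta> l = 0"
      using DERIV_unique[OF _ DERIV_const] by metis
    with l show False by simp
  qed
  ultimately have "W b a = \<theta> (a + b) * \<theta> (b + l) * \<theta> (a + l)"
  proof (intro analytic_continuation_open[of S UNIV "\<lambda>b. W b a" "\<lambda>b. \<theta> (a + b) * \<theta> (b + l) * \<theta> (a + l)" b])
    show "(\<lambda>b. W b a) holomorphic_on UNIV"
      unfolding W_def[abs_def]
      by (intro holomorphic_intros)
    show "(\<lambda>b. \<theta> (a + b) * \<theta> (b + l) * \<theta> (a + l)) holomorphic_on UNIV"
      by (intro holomorphic_intros)
  qed (simp_all add: S_def generic connected_UNIV)
  then show ?thesis by (simp add: W_def)
qed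

definition ker_lam :: "complex \<Rightarrow> complex \<Rightarrow> complex" where
  "ker_lam l x = \<theta> (x + l) / (\<theta> x * \<theta> l)"

definition ker_zeta :: "complex \<Rightarrow> complex" where
  "ker_zeta x = deriv \<theta> x / \<theta> x"

text \<open>
  The derivative of \<open>ker_lam l x\<close> with respect to l.
\<close>

definition ker_dlam :: "complex \<Rightarrow> complex \<Rightarrow> complex" where
  "ker_dlam l x = deriv \<theta> (x + l) / (\<theta> x * \<theta> l) - \<theta> (x + l) * deriv \<theta> l / (\<theta> x * \<theta> l ^ 2)"

text \<open>
  Dividing \<open>fay_identity\<close> by \<theta>(x) \<theta>(y) \<theta>(l)^2 \<theta>(x + y) turns the four products on its left-hand
  side into logarithmic derivatives.
\<close>

lemma fay_kernels:
  assumes "\<theta> l \<noteq> 0" "\<theta> x \<noteq> 0" "\<theta> y \<noteq> 0" "\<theta> (x + y) \<noteq> 0"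
  shows "ker_lam l x * ker_lam l y = ker_lam l (x + y) * (ker_zeta x + ker_zeta y) - ker_dlam l (x + y)"
proof -
  have "ker_lam l x * ker_lam l y
      = \<theta> (x + y) * \<theta> (y + l) * \<theta> (x + l) / (\<theta> x * \<theta> y * \<theta> l ^ 2 * \<theta> (x + y))"
    using assms by (simp add: ker_lam_def power2_eq_square mult_ac)
  also have "\<dots> = ker_lam l (x + y) * (ker_zeta x + ker_zeta y) - ker_dlam l (x + y)"
    unfolding fay_identity[OF assms(1), of x y, symmetric]
    using assms by (simp add: ker_lam_def ker_zeta_def ker_dlam_def field_simps power2_eq_square)
  finally show ?thesis .
qed

end

section \<open>Test functions as Laurent series\<close>

lemma scaleC_simps [simp]:
  fixes x :: "'a :: complex_vector"
  shows "0 *\<^sub>C x = 0" "a *\<^sub>C (0 :: 'a) = 0" "1 *\<^sub>C x = x" "a *\<^sub>C (- x) = - (a *\<^sub>C x)" "(- a) *\<^sub>C x = - (a *\<^sub>C x)"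
    "a *\<^sub>C b *\<^sub>C x = (a * b) *\<^sub>C x"
proof -
  show 0: "0 *\<^sub>C x = 0" for x :: 'a
    using scaleC_add_left[of 0 0 x] by simp
  show 00: "a *\<^sub>C (0 :: 'a) = 0" for a
    using scaleC_add_right[of a 0 "0 :: 'a"] by simp
  show "1 *\<^sub>C x = x" "a *\<^sub>C b *\<^sub>C x = (a * b) *\<^sub>C x"
    by (rule scaleC_one scaleC_scaleC)+
  show "a *\<^sub>C (- x) = - (a *\<^sub>C x)"
    using scaleC_add_right[of a x "- x"] 00[of a] by (simp add: eq_neg_iff_add_eq_0 add.commute)
  show "(- a) *\<^sub>C x = - (a *\<^sub>C x)"
    using scaleC_add_left[of a "- a" x] 0[of x] by (simp add: eq_neg_iff_add_eq_0 add.commute)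
qed

lemma scaleC_diff_right: "a *\<^sub>C (x - y) = a *\<^sub>C x - a *\<^sub>C y" for x y :: "'a :: complex_vector"
  using scaleC_add_right[of a x "- y"] by simp

lemma scaleC_diff_left: "(a - b) *\<^sub>C x = a *\<^sub>C x - b *\<^sub>C x" for x :: "'a :: complex_vector"
  using scaleC_add_left[of a "- b" x] by simp

lemma scaleC_half [simp]: "(1 / 2) *\<^sub>C x + (1 / 2) *\<^sub>C x = x" for x :: "'a :: complex_vector"
  using scaleC_add_left[of "1/2" "1/2" x] by simp

lemma scaleC_half_uminus [simp]: "- ((1 / 2) *\<^sub>C x) - (1 / 2) *\<^sub>C x = - x" for x :: "'a :: complex_vector"
  using scaleC_half[of x] by (metis minus_add_distrib diff_conv_add_uminus)

lemma rep_K0_meromorphic [meromorphic_intros]: "rep_K0 s meromorphic_on {0}"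
  using Quotient3_rep_reflp[OF Quotient3_K0] by (simp add: germ_eq_def)

lemma abs_rep_K0: "abs_K0 (rep_K0 s) = s"
  by (rule Quotient3_abs_rep[OF Quotient3_K0])

lemma abs_K0_eqI:
  assumes "f meromorphic_on {0}" "\<forall>\<^sub>F u in at 0. f u = g u"
  shows "abs_K0 f = abs_K0 g"
proof -
  have "g meromorphic_on {0}"
    using assms meromorphic_on_cong[of "{0}" f g "{0}"] by simp
  then show ?thesis
    using assms Quotient3_rel_abs[OF Quotient3_K0] by (simp add: germ_eq_def)
qed

text \<open>
  A germ and its chosen representative agree only near 0, so all pointwise statements about
  representatives below hold eventually at 0.
\<close>

lemma rep_abs_K0:
  assumes "f meromorphic_on {0}"
  shows "\<forall>\<^sub>F u in at 0. rep_K0 (abs_K0 f) u = f u"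
proof -
  have "germ_eq f f"
    using assms by (simp add: germ_eq_def)
  then have "germ_eq (rep_K0 (abs_K0 f)) f"
    using rep_abs_rsp_left[OF Quotient3_K0] by blast
  then show ?thesis
    by (simp add: germ_eq_def)
qed

lemma K0_eqI:
  assumes "\<forall>\<^sub>F u in at 0. rep_K0 s u = rep_K0 t u"
  shows "s = t"
  using abs_K0_eqI[OF rep_K0_meromorphic assms] by (simp add: abs_rep_K0)

text \<open>
  The Laurent expansion embeds the test functions into the ring of formal Laurent series and
  carries the pairing to the residue of the product; this makes the identities for coefficients algebraic.
\<close>

definition K0_fls :: "K0 \<Rightarrow> complex fls" where
  "K0_fls s = laurent_expansion (rep_K0 s) 0"

lemma K0_coeff_eq: "K0_coeff s k = fls_nth (K0_fls s) k"
  by (simp add: K0_coeff_def K0_fls_def)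

lemma rep_K0_laurent [laurent_expansion_intros]: "rep_K0 s has_laurent_expansion K0_fls s"
  using meromorphic_on_imp_has_laurent_expansion[OF rep_K0_meromorphic, of 0 s]
  by (simp add: K0_fls_def)

lemma laurent_imp_meromorphic: "f has_laurent_expansion F \<Longrightarrow> f meromorphic_on {0}"
  by (auto simp: meromorphic_on_def)

lemma K0_fls_abs:
  assumes "f has_laurent_expansion F"
  shows "K0_fls (abs_K0 f) = F"
proof -
  have "rep_K0 (abs_K0 f) has_laurent_expansion F"
    using assms has_laurent_expansion_cong[OF rep_abs_K0[OF laurent_imp_meromorphic[OF assms]] refl]
    by simp
  then show ?thesis
    using has_laurent_expansion_unique rep_K0_laurent by blast
qed

lemma K0_fls_0 [simp]: "K0_fls 0 = 0"
  and K0_fls_1 [simp]: "K0_fls 1 = 1"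
  and K0_fls_add [simp]: "K0_fls (s + t) = K0_fls s + K0_fls t"
  and K0_fls_diff [simp]: "K0_fls (s - t) = K0_fls s - K0_fls t"
  and K0_fls_uminus [simp]: "K0_fls (- s) = - K0_fls s"
  and K0_fls_mult [simp]: "K0_fls (s * t) = K0_fls s * K0_fls t"
  and K0_fls_scale [simp]: "K0_fls (a *\<^sub>C s) = fls_const a * K0_fls s"
  and K0_fls_deriv [simp]: "K0_fls (K0_deriv s) = fls_deriv (K0_fls s)"
  unfolding zero_K0_def one_K0_def plus_K0_def minus_K0_def uminus_K0_def times_K0_def
    scaleC_K0_def K0_deriv_def map_fun_def id_def o_def
  by (rule K0_fls_abs; auto intro!: laurent_expansion_intros)+

lemma K0_fls_inject: "K0_fls s = K0_fls t \<longleftrightarrow> s = t"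
proof
  assume eq: "K0_fls s = K0_fls t"
  have "(\<lambda>u. rep_K0 s u - rep_K0 t u) has_laurent_expansion K0_fls s - K0_fls t"
    by (intro laurent_expansion_intros)
  then have "\<forall>\<^sub>F u in at 0. rep_K0 s u - rep_K0 t u = 0"
    using eq has_laurent_expansion_eventually_zero_iff[of "\<lambda>u. rep_K0 s u - rep_K0 t u" 0 0] by simp
  then show "s = t"
    by (intro K0_eqI) simp
qed simp

lemma K0_eq_coeffI: "(\<And>k. K0_coeff s k = K0_coeff t k) \<Longrightarrow> s = t"
  unfolding K0_fls_inject[symmetric] K0_coeff_eq by (rule fls_eqI)

lemma K0_coeff_simps [simp]:
  "K0_coeff 0 k = 0"
  "K0_coeff (s + t) k = K0_coeff s k + K0_coeff t k"
  "K0_coeff (s - t) k = K0_coeff s k - K0_coeff t k"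
  "K0_coeff (- s) k = - K0_coeff s k"
  "K0_coeff (a *\<^sub>C s) k = a * K0_coeff s k"
  "K0_coeff (K0_deriv s) k = of_int (k + 1) * K0_coeff s (k + 1)"
  by (simp_all add: K0_coeff_eq fls_mult_const_nth)

lemma K0_pair_fls: "K0_pair s t = fls_nth (K0_fls s * K0_fls t) (-1)"
proof -
  have "K0_pair s t = residue (\<lambda>u. rep_K0 s u * rep_K0 t u) 0"
    by (simp add: K0_pair_def)
  also have "\<dots> = fls_residue (K0_fls s * K0_fls t)"
    by (intro has_laurent_expansion_residue_0 laurent_expansion_intros)
  finally show ?thesis by simp
qed

lemma K0_pair_abs:
  assumes "f meromorphic_on {0}"
  shows "K0_pair (abs_K0 f) t = residue (\<lambda>u. f u * rep_K0 t u) 0"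
  unfolding K0_pair_def map_fun_def id_def o_def
  by (rule residue_cong) (use rep_abs_K0[OF assms] in \<open>auto elim: eventually_mono\<close>)

lemma K0_pair_sym: "K0_pair s t = K0_pair t s"
  by (simp add: K0_pair_fls mult.commute)

lemma K0_pair_assoc: "K0_pair (a * b) t = K0_pair a (b * t)"
  by (simp add: K0_pair_fls mult.assoc)

lemma K0_pair_simps [simp]:
  "K0_pair 0 t = 0" "K0_pair t 0 = 0"
  "K0_pair (r + s) t = K0_pair r t + K0_pair s t"
  "K0_pair t (r + s) = K0_pair t r + K0_pair t s"
  "K0_pair (r - s) t = K0_pair r t - K0_pair s t"
  "K0_pair t (r - s) = K0_pair t r - K0_pair t s"
  "K0_pair (- s) t = - K0_pair s t"
  "K0_pair t (- s) = - K0_pair t s"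
  "K0_pair (a *\<^sub>C s) t = a * K0_pair s t"
  "K0_pair t (a *\<^sub>C s) = a * K0_pair t s"
  by (simp_all add: K0_pair_fls algebra_simps fls_mult_const_nth mult.assoc mult.left_commute[of _ "fls_const a"])

lemma K0_pair_deriv: "K0_pair (K0_deriv s) t = - K0_pair s (K0_deriv t)"
proof -
  have "fls_residue (fls_deriv (K0_fls s * K0_fls t)) = 0"
    by (rule fls_residue_deriv)
  then show ?thesis
    by (simp add: K0_pair_fls algebra_simps add_eq_0_iff del: fls_residue_deriv)
qed

text \<open>
  Bounds on the pole orders may be coarser than the exact subdegrees, which keeps the
  range of summation the same for a whole family of series.
\<close>

lemma fls_times_nth_bounded:
  fixes f g :: "'a :: comm_ring_1 fls"
  assumes f: "\<And>k. k < a \<Longrightarrow> fls_nth f k = 0" and g: "\<And>k. k < b \<Longrightarrow> fls_nth g k = 0"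
  shows "fls_nth (f * g) n = (\<Sum>i=a..n-b. fls_nth f i * fls_nth g (n - i))"
proof (cases "f = 0 \<or> g = 0")
  case True
  then show ?thesis by auto
next
  case False
  then have "a \<le> fls_subdegree f" "b \<le> fls_subdegree g"
    using f g by (auto intro!: fls_subdegree_geI)
  then have sub: "{fls_subdegree f..n - fls_subdegree g} \<subseteq> {a..n - b}"
    by auto
  have "fls_nth (f * g) n = (\<Sum>i=fls_subdegree f..n - fls_subdegree g. fls_nth f i * fls_nth g (n - i))"
    by (rule fls_times_nth(2))
  also have "\<dots> = (\<Sum>i=a..n-b. fls_nth f i * fls_nth g (n - i))"
    by (rule sum.mono_neutral_left[OF _ sub]) auto
  finally show ?thesis .
qed

definition K0_bounded :: "nat \<Rightarrow> K0 \<Rightarrow> bool" where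
  "K0_bounded N s \<longleftrightarrow> (\<forall>k < - int N. K0_coeff s k = 0)"

lemma K0_bounded_exists: obtains N where "K0_bounded N s"
proof
  show "K0_bounded (nat (- fls_subdegree (K0_fls s))) s"
    by (auto simp: K0_bounded_def K0_coeff_eq)
qed

lemma K0_pair_bounded:
  assumes "K0_bounded N s" "K0_bounded M t"
  shows "K0_pair s t = (\<Sum>i=- int N..int M - 1. K0_coeff s i * K0_coeff t (- 1 - i))"
  using fls_times_nth_bounded[of "- int N" "K0_fls s" "- int M" "K0_fls t" "-1"] assms
  by (simp add: K0_bounded_def K0_coeff_eq K0_pair_fls)

lemma K0_pair_regular:
  assumes "K0_bounded 0 s" "K0_bounded M t"
  shows "K0_pair s t = (\<Sum>j<M. K0_coeff s (int j) * K0_coeff t (- 1 - int j))"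
proof -
  have "{0..int M - 1} = int ` {..<M}"
    by (simp add: image_int_atLeastLessThan lessThan_atLeast0 atLeastLessThanPlusOne_atLeastAtMost_int)
      (auto simp: )
  then show ?thesis
    using K0_pair_bounded[OF assms] by (simp add: sum.reindex)
qed

definition K0_monom :: "int \<Rightarrow> K0" where
  "K0_monom k = abs_K0 (\<lambda>u. u powi k)"

lemma K0_fls_monom: "K0_fls (K0_monom k) = fls_X_intpow k"
  unfolding K0_monom_def by (intro K0_fls_abs laurent_expansion_intros)

lemma K0_pair_monom: "K0_pair s (K0_monom k) = K0_coeff s (- 1 - k)"
  by (simp add: K0_pair_fls K0_fls_monom K0_coeff_eq fls_X_intpow_times_conv_shift)

text \<open>
  Pairing with the monomials recovers all coefficients.
\<close>

lemma K0_pair_nondegenerate: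
  assumes "\<And>t. K0_pair s t = K0_pair s' t"
  shows "s = s'"
proof (rule K0_eq_coeffI)
  show "K0_coeff s k = K0_coeff s' k" for k
    using assms[of "K0_monom (- 1 - k)"] by (simp add: K0_pair_monom)
qed

lemma partial_fst_eq: "(\<And>t. a s t = K0_pair g t) \<Longrightarrow> partial_fst a s = g"
  unfolding partial_fst_def by (rule the_equality) (auto intro: K0_pair_nondegenerate)

lemma partial_snd_eq: "(\<And>s. a s t = K0_pair g s) \<Longrightarrow> partial_snd a t = g"
  unfolding partial_snd_def by (rule the_equality) (auto intro: K0_pair_nondegenerate)

section \<open>Contour integrals against a kernel with a simple pole\<close>

text \<open>
  The residue \<kappa> may be 0: this covers the \<lambda>-derivative of a kernel, and also the
  kernel \<theta>(x + \<lambda>) / (\<theta>(x) \<theta>(\<lambda>)) for \<lambda> in the lattice, which is identically 0 since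
  division by 0 yields 0.
\<close>

definition simple_pole :: "complex \<Rightarrow> (complex \<Rightarrow> complex) \<Rightarrow> bool" where
  "simple_pole \<kappa> k \<longleftrightarrow> k meromorphic_on {0} \<and>
     (\<forall>n < -1. fls_nth (laurent_expansion k 0) n = 0) \<and> fls_nth (laurent_expansion k 0) (-1) = \<kappa>"

lemma simple_poleI:
  assumes "k has_laurent_expansion F" "\<And>n. n < -1 \<Longrightarrow> fls_nth F n = 0" "fls_nth F (-1) = \<kappa>"
  shows "simple_pole \<kappa> k"
  using assms laurent_imp_meromorphic[OF assms(1)] laurent_expansion_0_eqI[OF assms(1)]
  by (simp add: simple_pole_def)

lemma simple_pole_laurent:
  "simple_pole \<kappa> k \<Longrightarrow> k has_laurent_expansion laurent_expansion k 0"
  using meromorphic_on_imp_has_laurent_expansion[of k "{0}" 0] by (simp add: simple_pole_def)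

lemma simple_pole_limit:
  assumes "simple_pole \<kappa> k"
  shows "(\<lambda>x. k x * x) \<midarrow>0\<rightarrow> \<kappa>"
proof -
  let ?F = "laurent_expansion k 0 * fls_X"
  have "(\<lambda>x. k x * x) has_laurent_expansion ?F"
    by (intro laurent_expansion_intros simple_pole_laurent[OF assms])
  moreover have nth: "fls_nth ?F n = fls_nth (laurent_expansion k 0) (n - 1)" for n
    by (simp add: fls_X_times_conv_shift)
  then have "fls_subdegree ?F \<ge> 0 \<or> ?F = 0"
    using assms by (auto intro!: fls_subdegree_geI simp: simple_pole_def)
  then have "fls_subdegree ?F \<ge> 0" by auto
  ultimately have "(\<lambda>x. k x * x) \<midarrow>0\<rightarrow> fls_nth ?F 0"
    by (rule has_laurent_expansion_imp_tendsto_0)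
  then show ?thesis
    unfolding nth using assms by (simp add: simple_pole_def)
qed

lemma meromorphic_punctured_ball:
  assumes "f meromorphic_on {0}"
  obtains R where "R > 0" "f holomorphic_on ball 0 R - {0}"
proof -
  have "isolated_singularity_at f 0"
    using assms meromorphic_at_iff by blast
  then show thesis
    using that unfolding isolated_singularity_at_def
    by (metis analytic_imp_holomorphic)
qed

text \<open>
  For fixed z \<noteq> 0 the function u \<mapsto> k(u - z) is regular at u = 0 and hence itself a test
  function; the integral over |u| < |z| is the pairing with it.
\<close>

definition shifted :: "(complex \<Rightarrow> complex) \<Rightarrow> complex \<Rightarrow> K0" where
  "shifted k z = abs_K0 (\<lambda>u. k (u - z))"

text \<open>
  The integral over |u| < |z|; adding the residue \<kappa> s(z) at u = z yields the integral over |u| > |z|,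
  called \<open>outer_part\<close> below.
\<close>

definition inner_part :: "(complex \<Rightarrow> complex) \<Rightarrow> K0 \<Rightarrow> K0" where
  "inner_part k s = abs_K0 (\<lambda>z. K0_pair (shifted k z) s)"

text \<open>
  The Taylor coefficients at u = 0 are the derivatives of k at - z.
\<close>

lemma shifted_coeff:
  assumes k: "k holomorphic_on ball 0 R - {0}" and z: "0 < norm z" "norm z < R"
  shows "(\<lambda>u. k (u - z)) meromorphic_on {0}"
    and "K0_bounded 0 (shifted k z)"
    and "K0_coeff (shifted k z) (int j) = (deriv ^^ j) k (- z) / fact j"
proof -
  define e where "e = min (norm z) (R - norm z)"
  have e: "e > 0" using z by (simp add: e_def)
  have sub: "u - z \<in> ball 0 R - {0}" if "u \<in> ball 0 e" for u
    using that norm_triangle_ineq4[of u z] by (auto simp: e_def)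
  have hol: "(\<lambda>u. k (u - z)) holomorphic_on ball 0 e"
    using holomorphic_on_compose_gen[of "\<lambda>u. u - z" "ball 0 e" k "ball 0 R - {0}"] k sub
    by (force simp: o_def intro!: holomorphic_intros)
  then have "(\<lambda>u. k (u - z)) analytic_on {0}"
    using e by (meson analytic_at centre_in_ball open_ball)
  then have ex: "(\<lambda>u. k (u - z)) has_fps_expansion fps_expansion (\<lambda>u. k (u - z)) 0"
    by (rule analytic_at_imp_has_fps_expansion_0)
  then have lau: "(\<lambda>u. k (u - z)) has_laurent_expansion fps_to_fls (fps_expansion (\<lambda>u. k (u - z)) 0)"
    using has_fps_expansion_to_laurent by blast
  then show "(\<lambda>u. k (u - z)) meromorphic_on {0}"
    by (rule laurent_imp_meromorphic)
  have fls: "K0_fls (shifted k z) = fps_to_fls (fps_expansion (\<lambda>u. k (u - z)) 0)"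
    unfolding shifted_def by (rule K0_fls_abs[OF lau])
  then show "K0_bounded 0 (shifted k z)"
    by (simp add: K0_bounded_def K0_coeff_eq)
  have "(deriv ^^ j) (\<lambda>u. k (1 * u + (- z))) 0 = 1 ^ j * (deriv ^^ j) k (1 * 0 + (- z))"
    using sub e by (intro higher_deriv_compose_linear'[OF k, of "ball 0 e"]) auto
  then show "K0_coeff (shifted k z) (int j) = (deriv ^^ j) k (- z) / fact j"
    using fls by (simp add: K0_coeff_eq fps_expansion_def)
qed

lemma higher_deriv_laurent:
  assumes "k has_laurent_expansion F"
  shows "(deriv ^^ j) k has_laurent_expansion (fls_deriv ^^ j) F"
  by (induction j) (auto intro: assms has_laurent_expansion_deriv)

lemma fls_nth_higher_deriv:
  "fls_nth ((fls_deriv ^^ j) F) n = pochhammer (of_int (n + 1)) j * fls_nth F (n + int j)"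
  for F :: "complex fls"
proof (induction j arbitrary: n)
  case (Suc j)
  have "fls_nth ((fls_deriv ^^ Suc j) F) n = of_int (n + 1) * fls_nth ((fls_deriv ^^ j) F) (n + 1)"
    by simp
  also have "\<dots> = pochhammer (of_int (n + 1)) (Suc j) * fls_nth F (n + int (Suc j))"
    unfolding Suc pochhammer_rec by (simp add: algebra_simps)
  finally show ?case .
qed simp

text \<open>
  Only finitely many coefficients of s have negative index, so the pairing is a finite combination
  of the derivatives of k at - z.  Expanding them in z gives meromorphy and the coefficients; the
  sign comes from z \<mapsto> - z and the rising factorial from differentiating j times.
\<close>

lemma inner_part_laurent:
  assumes k: "k meromorphic_on {0}" and s: "K0_bounded N s"
  shows "(\<lambda>z. K0_pair (shifted k z) s) meromorphic_on {0}"
    and "K0_coeff (inner_part k s) n =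
      (\<Sum>j<N. (-1) powi n * pochhammer (of_int (n + 1)) j / fact j *
        fls_nth (laurent_expansion k 0) (n + int j) * K0_coeff s (- 1 - int j))"
proof -
  let ?K = "laurent_expansion k 0"
  obtain R where R: "R > 0" "k holomorphic_on ball 0 R - {0}"
    using meromorphic_punctured_ball[OF k] .
  have "k has_laurent_expansion ?K"
    using meromorphic_on_imp_has_laurent_expansion[OF k, of 0] by simp
  then have "((deriv ^^ j) k \<circ> (\<lambda>z. - z)) has_laurent_expansion
      fls_compose_fps ((fls_deriv ^^ j) ?K) (fps_const (- 1) * fps_X)" for j
    using has_laurent_expansion_minus[OF has_laurent_expansion_fps_X]
    by (intro has_laurent_expansion_compose higher_deriv_laurent) (auto simp flip: fps_const_neg)
  then have der: "(\<lambda>z. (deriv ^^ j) k (- z)) has_laurent_expansion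
      fls_compose_fps ((fls_deriv ^^ j) ?K) (fps_const (- 1) * fps_X)" for j
    by (simp add: o_def)
  let ?S = "\<Sum>j<N. fls_const (K0_coeff s (- 1 - int j) / fact j) *
     fls_compose_fps ((fls_deriv ^^ j) ?K) (fps_const (- 1) * fps_X)"
  have "(\<lambda>z. \<Sum>j<N. K0_coeff s (- 1 - int j) / fact j * (deriv ^^ j) k (- z)) has_laurent_expansion ?S"
    by (intro laurent_expansion_intros der)
  moreover have ev: "\<forall>\<^sub>F z in at 0. (\<Sum>j<N. K0_coeff s (- 1 - int j) / fact j * (deriv ^^ j) k (- z))
      = K0_pair (shifted k z) s"
  proof -
    have "\<forall>\<^sub>F z in at 0. z \<in> ball 0 R - {0}"
      using R(1) by (intro eventually_at_in_open) auto
    then show ?thesis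
    proof eventually_elim
      case (elim z)
      then show ?case
        using K0_pair_regular[OF shifted_coeff(2)[OF R(2)] s, of z] shifted_coeff(3)[OF R(2), of z]
        by (auto intro!: sum.cong)
    qed
  qed
  ultimately have lau: "(\<lambda>z. K0_pair (shifted k z) s) has_laurent_expansion ?S"
    using has_laurent_expansion_cong[OF ev refl] by simp
  then show "(\<lambda>z. K0_pair (shifted k z) s) meromorphic_on {0}"
    by (rule laurent_imp_meromorphic)
  show "K0_coeff (inner_part k s) n =
      (\<Sum>j<N. (-1) powi n * pochhammer (of_int (n + 1)) j / fact j *
        fls_nth (laurent_expansion k 0) (n + int j) * K0_coeff s (- 1 - int j))"
    unfolding inner_part_def K0_coeff_eq K0_fls_abs[OF lau] fls_nth_sum
    by (intro sum.cong refl)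
      (simp add: fls_nth_fls_compose_fps_linear fls_nth_higher_deriv K0_coeff_eq)
qed

lemma rep_inner_part:
  assumes "k meromorphic_on {0}"
  shows "\<forall>\<^sub>F z in at 0. rep_K0 (inner_part k s) z = K0_pair (shifted k z) s"
  unfolding inner_part_def
  by (rule K0_bounded_exists[of s]) (rule rep_abs_K0[OF inner_part_laurent(1)[OF assms]])

text \<open>
  In this form the coefficient is symmetric in n and j up to the sign (- 1)^n, which is what makes the
  operator for k adjoint to the one for the reflected kernel.
\<close>

lemma inner_part_coeff_nonneg:
  assumes k: "k meromorphic_on {0}" and s: "K0_bounded N s"
  shows "K0_coeff (inner_part k s) (int n) =
      (\<Sum>j<N. (-1) ^ n * fact (n + j) / (fact n * fact j) *
        fls_nth (laurent_expansion k 0) (int n + int j) * K0_coeff s (- 1 - int j))"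
proof -
  have "pochhammer (of_int (int n + 1)) j = (fact (n + j) / fact n :: complex)" for j
  proof -
    have "(fact (n + j) :: complex) = fact n * pochhammer (1 + of_nat n) j"
      using pochhammer_product'[of "1 :: complex" n j] by (simp add: pochhammer_fact)
    then show ?thesis by (simp add: add.commute)
  qed
  then show ?thesis
    unfolding inner_part_laurent(2)[OF assms] by simp
qed

text \<open>
  For n < 0 the rising factorial (n + 1)...(n + j) vanishes for large j and the kernel has no
  coefficient n + j for small j; only the pole term n + j = - 1 is left.
\<close>

lemma inner_part_coeff_neg:
  assumes k: "simple_pole \<kappa> k" and n: "n < 0"
  shows "K0_coeff (inner_part k s) n = - \<kappa> * K0_coeff s n"
proof -
  obtain N where N: "K0_bounded N s" by (rule K0_bounded_exists)
  obtain m where m: "n = - 1 - int m"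
    using n that[of "nat (- 1 - n)"] by simp
  have mero: "k meromorphic_on {0}" using k by (simp add: simple_pole_def)
  have summand: "(-1) powi n * pochhammer (of_int (n + 1)) j / fact j *
        fls_nth (laurent_expansion k 0) (n + int j) * K0_coeff s (- 1 - int j)
      = (if j = m then - \<kappa> * K0_coeff s n else 0)" for j
  proof (cases j m rule: linorder_cases)
    case less
    then show ?thesis using k by (simp add: simple_pole_def m)
  next
    case equal
    have "pochhammer (of_int (n + 1)) m = ((-1) ^ m * fact m :: complex)"
      using pochhammer_minus[of "of_nat m :: complex" m] by (simp add: m pochhammer_fact)
    moreover have "(-1) powi n = (- ((-1) ^ m) :: complex)"
      by (simp add: m power_int_diff power_int_minus minus_one_power_iff)
    ultimately show ?thesis
      using k equal by (simp add: simple_pole_def m flip: power_mult_distrib)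
  next
    case greater
    then have "pochhammer (- of_nat m :: complex) j = 0"
      by (simp add: pochhammer_of_nat_eq_0_iff)
    then show ?thesis using greater by (simp add: m)
  qed
  have "K0_coeff (inner_part k s) n = (\<Sum>j<N. if j = m then - \<kappa> * K0_coeff s n else 0)"
    unfolding inner_part_laurent(2)[OF mero N] summand ..
  also have "\<dots> = - \<kappa> * K0_coeff s n"
    using N by (auto simp: K0_bounded_def m)
  finally show ?thesis .
qed

definition outer_part :: "complex \<Rightarrow> (complex \<Rightarrow> complex) \<Rightarrow> K0 \<Rightarrow> K0" where
  "outer_part \<kappa> k s = \<kappa> *\<^sub>C s + inner_part k s"

text \<open>
  Every small z admits a radius on the required side, so the integrals determine the germ.
\<close>

lemma contour_action_eqI:
  assumes d: "d > 0" and g: "\<And>z r. 0 < norm z \<Longrightarrow> norm z < d \<Longrightarrow> 0 < r \<Longrightarrow> r < d \<Longrightarrow>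
       contour_side \<epsilon> r (norm z) \<Longrightarrow>
       rep_K0 g z = contour_integral (circlepath 0 r) (\<lambda>u. k (u - z) * rep_K0 s u) / (2 * of_real pi * \<i>)"
  shows "contour_action \<epsilon> k s = g"
  unfolding contour_action_def
proof (rule the_equality, goal_cases)
  case 1
  show ?case using d g by blast
next
  case (2 g')
  then obtain d' where d': "d' > 0" and g': "\<And>z r. 0 < norm z \<Longrightarrow> norm z < d' \<Longrightarrow> 0 < r \<Longrightarrow> r < d' \<Longrightarrow>
       contour_side \<epsilon> r (norm z) \<Longrightarrow>
       rep_K0 g' z = contour_integral (circlepath 0 r) (\<lambda>u. k (u - z) * rep_K0 s u) / (2 * of_real pi * \<i>)"
    by blast
  have "rep_K0 g' z = rep_K0 g z" if z: "0 < norm z" "norm z < min d d'" for z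
  proof -
    obtain r where "0 < r" "r < min d d'" "contour_side \<epsilon> r (norm z)"
    proof (cases \<epsilon>)
      case Plus
      then show thesis using that[of "(norm z + min d d') / 2"] z by (simp add: min_def split: if_splits)
    next
      case Minus
      have "0 < norm z / 2" "norm z / 2 < norm z"
        using z(1) by auto
      then show thesis using that[of "norm z / 2"] z Minus d d' by auto
    qed
    then show ?thesis using g[of z r] g'[of z r] z by simp
  qed
  then have "\<forall>\<^sub>F z in at 0. rep_K0 g' z = rep_K0 g z"
    unfolding eventually_at using d d' by (intro exI[of _ "min d d'"]) auto
  then show "g' = g" by (rule K0_eqI)
qed

text \<open>
  For |u| < |z| the contour encloses only the singularity 0 of the integrand.  For |u| > |z| it also
  encloses the simple pole at u = z, where the residue is \<kappa> s(z).
\<close>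

lemma contour_action_eq:
  assumes k: "simple_pole \<kappa> k"
  shows "contour_action Minus k s = inner_part k s"
    and "contour_action Plus k s = outer_part \<kappa> k s"
proof -
  have mero: "k meromorphic_on {0}" using k by (simp add: simple_pole_def)
  obtain R1 where R1: "R1 > 0" "k holomorphic_on ball 0 R1 - {0}"
    using meromorphic_punctured_ball[OF mero] .
  obtain R2 where R2: "R2 > 0" "rep_K0 s holomorphic_on ball 0 R2 - {0}"
    using meromorphic_punctured_ball[OF rep_K0_meromorphic] .
  have "\<forall>\<^sub>F z in at 0. rep_K0 (inner_part k s) z = K0_pair (shifted k z) s \<and>
      rep_K0 (outer_part \<kappa> k s) z = \<kappa> * rep_K0 s z + K0_pair (shifted k z) s"
  proof -
    have 1: "\<forall>\<^sub>F z in at 0. rep_K0 (outer_part \<kappa> k s) z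
        = rep_K0 (\<kappa> *\<^sub>C s) z + rep_K0 (inner_part k s) z"
      unfolding outer_part_def plus_K0_def map_fun_def id_def o_def
      by (rule rep_abs_K0) (intro meromorphic_intros)
    have 2: "\<forall>\<^sub>F z in at 0. rep_K0 (\<kappa> *\<^sub>C s) z = \<kappa> * rep_K0 s z"
      unfolding scaleC_K0_def map_fun_def id_def o_def
      by (rule rep_abs_K0) (intro meromorphic_intros)
    show ?thesis
      using 1 2 rep_inner_part[OF mero] by eventually_elim simp
  qed
  then obtain R3 where R3: "R3 > 0" "\<And>z. 0 < norm z \<Longrightarrow> norm z < R3 \<Longrightarrow>
      rep_K0 (inner_part k s) z = K0_pair (shifted k z) s \<and>
      rep_K0 (outer_part \<kappa> k s) z = \<kappa> * rep_K0 s z + K0_pair (shifted k z) s"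
    unfolding eventually_at by auto
  \<comment> \<open>Halving R1 keeps u - z in the domain of k when both u and z are smaller than d.\<close>
  define d where "d = min (R1 / 2) (min R2 R3)"
  have d: "d > 0" "d \<le> R1 / 2" "d \<le> R2" "d \<le> R3"
    using R1 R2 R3 by (auto simp: d_def)
  have hol: "(\<lambda>u. k (u - z) * rep_K0 s u) holomorphic_on ball 0 d - {0, z}" if z: "norm z < d" for z
  proof (intro holomorphic_intros)
    have "u - z \<in> ball 0 R1 - {0}" if "u \<in> ball 0 d - {0, z}" for u
      using that z d norm_triangle_ineq4[of u z] by auto
    then show "(\<lambda>u. k (u - z)) holomorphic_on ball 0 d - {0, z}"
      using holomorphic_on_compose_gen[of "\<lambda>u. u - z" "ball 0 d - {0, z}" k "ball 0 R1 - {0}"] R1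
      by (force simp: o_def intro!: holomorphic_intros)
    show "rep_K0 s holomorphic_on ball 0 d - {0, z}"
      using R2(2) by (rule holomorphic_on_subset) (use d in auto)
  qed
  have res0: "residue (\<lambda>u. k (u - z) * rep_K0 s u) 0 = K0_pair (shifted k z) s"
    if "0 < norm z" "norm z < d" for z
    unfolding shifted_def
    using that d shifted_coeff(1)[OF R1(2), of z] by (intro K0_pair_abs[symmetric]) auto
  show "contour_action Minus k s = inner_part k s"
  proof (rule contour_action_eqI[OF d(1)])
    fix z :: complex and r :: real
    assume z: "0 < norm z" "norm z < d" and r: "0 < r" "r < d" "contour_side Minus r (norm z)"
    have "((\<lambda>u. k (u - z) * rep_K0 s u) has_contour_integral
        2 * of_real pi * \<i> * residue (\<lambda>u. k (u - z) * rep_K0 s u) 0) (circlepath 0 r)"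
      using base_residue[of "ball 0 (norm z)" 0 r "\<lambda>u. k (u - z) * rep_K0 s u"] z r
        holomorphic_on_subset[OF hol[OF z(2)], of "ball 0 (norm z) - {0}"]
      by fastforce
    then show "rep_K0 (inner_part k s) z =
        contour_integral (circlepath 0 r) (\<lambda>u. k (u - z) * rep_K0 s u) / (2 * of_real pi * \<i>)"
      using res0[OF z] R3(2)[of z] z d by (simp add: contour_integral_unique)
  qed
  show "contour_action Plus k s = outer_part \<kappa> k s"
  proof (rule contour_action_eqI[OF d(1)])
    fix z :: complex and r :: real
    assume z: "0 < norm z" "norm z < d" and r: "0 < r" "r < d" "contour_side Plus r (norm z)"
    let ?f = "\<lambda>u. k (u - z) * rep_K0 s u"
    have resz: "residue ?f z = \<kappa> * rep_K0 s z"
    proof (rule residue_simple'[of "ball 0 d - {0}"])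
      show "?f holomorphic_on ball 0 d - {0} - {z}"
        using hol[OF z(2)] by (rule holomorphic_on_subset) auto
      have 1: "(\<lambda>u. k (u - z) * (u - z)) \<midarrow>z\<rightarrow> \<kappa>"
        using simple_pole_limit[OF k] LIM_offset[of "\<lambda>x. k x * x" \<kappa> 0 "- z"] by simp
      have "isCont (rep_K0 s) z"
        using holomorphic_on_imp_continuous_on[OF R2(2)] z d
        by (intro continuous_on_interior[of "ball 0 R2 - {0}"]) (auto simp: interior_open open_Diff)
      then have 2: "rep_K0 s \<midarrow>z\<rightarrow> rep_K0 s z"
        by (simp add: isCont_def)
      show "(\<lambda>w. ?f w * (w - z)) \<midarrow>z\<rightarrow> \<kappa> * rep_K0 s z"
        using tendsto_mult[OF 1 2] by (simp add: mult_ac)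
    qed (use z in auto)
    have wind: "winding_number (circlepath 0 r) w = 1" if "norm w < r" for w
      using that by (intro winding_number_circlepath) simp
    have "contour_integral (circlepath 0 r) ?f
        = complex_of_real (2 * pi) * \<i> * (\<Sum>p\<in>{0, z}. winding_number (circlepath 0 r) p * residue ?f p)"
    proof (rule Residue_theorem[of "ball 0 d"])
      show "\<forall>w. w \<notin> ball 0 d \<longrightarrow> winding_number (circlepath 0 r) w = 0"
        using r by (auto intro!: winding_number_zero_outside[of _ "cball 0 r"])
    qed (use z r hol in auto)
    also have "\<dots> = 2 * of_real pi * \<i> * (K0_pair (shifted k z) s + \<kappa> * rep_K0 s z)"
      using z r wind[of 0] wind[of z] res0[OF z] resz by auto
    finally show "rep_K0 (outer_part \<kappa> k s) z =
        contour_integral (circlepath 0 r) ?f / (2 * of_real pi * \<i>)"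
      using R3(2)[of z] z d by simp
  qed
qed

section \<open>Algebra of the two contour operators\<close>

lemma K0_bounded_mono: "K0_bounded N s \<Longrightarrow> N \<le> M \<Longrightarrow> K0_bounded M s"
  by (auto simp: K0_bounded_def)

lemma K0_bounded_exists2: obtains N where "K0_bounded N s" "K0_bounded N t"
  using K0_bounded_exists[of s] K0_bounded_exists[of t]
  by (metis K0_bounded_mono max.cobounded1 max.cobounded2)

lemma inner_part_regular:
  assumes "k meromorphic_on {0}" "K0_bounded 0 s"
  shows "inner_part k s = 0"
  by (rule K0_eq_coeffI) (simp add: inner_part_laurent(2)[OF assms])

lemma inner_part_add:
  assumes k: "k meromorphic_on {0}"
  shows "inner_part k (s + t) = inner_part k s + inner_part k t"
proof (rule K0_eq_coeffI)
  fix n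
  obtain N where N: "K0_bounded N s" "K0_bounded N t" by (rule K0_bounded_exists2)
  then have "K0_bounded N (s + t)" by (simp add: K0_bounded_def)
  then show "K0_coeff (inner_part k (s + t)) n = K0_coeff (inner_part k s + inner_part k t) n"
    using N by (simp add: inner_part_laurent(2)[OF k] ring_distribs sum.distrib add_divide_distrib)
qed

lemma inner_part_scale:
  assumes k: "k meromorphic_on {0}"
  shows "inner_part k (a *\<^sub>C s) = a *\<^sub>C inner_part k s"
proof (rule K0_eq_coeffI)
  fix n
  obtain N where N: "K0_bounded N s" by (rule K0_bounded_exists)
  then have "K0_bounded N (a *\<^sub>C s)" by (simp add: K0_bounded_def)
  then show "K0_coeff (inner_part k (a *\<^sub>C s)) n = K0_coeff (a *\<^sub>C inner_part k s) n"
    using N by (simp add: inner_part_laurent(2)[OF k] sum_distrib_left mult_ac)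
qed

lemma inner_part_uminus:
  assumes k: "k meromorphic_on {0}"
  shows "inner_part k (- s) = - inner_part k s"
  using inner_part_scale[OF k, of "-1" s] by simp

lemma inner_part_diff:
  assumes k: "k meromorphic_on {0}"
  shows "inner_part k (s - t) = inner_part k s - inner_part k t"
  using inner_part_add[OF k, of s "- t"] inner_part_uminus[OF k, of t] by simp

lemma simple_pole_meromorphic: "simple_pole \<kappa> k \<Longrightarrow> k meromorphic_on {0}"
  by (simp add: simple_pole_def)

lemma outer_part_regular:
  assumes "simple_pole \<kappa> k"
  shows "K0_bounded 0 (outer_part \<kappa> k s)"
  using inner_part_coeff_neg[OF assms] by (simp add: K0_bounded_def outer_part_def)

text \<open>
  Differentiating in u and in z differs by a sign on k(u - z), and integration by parts cancels it; on
  coefficients this is (i + 1) (n + i + 1 choose i + 1) = (n + 1) (n + i + 1 choose i).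
\<close>

lemma inner_part_deriv:
  assumes k: "simple_pole \<kappa> k"
  shows "inner_part k (K0_deriv s) = K0_deriv (inner_part k s)"
proof (rule K0_eq_coeffI)
  fix n
  have mero: "k meromorphic_on {0}" using k by (rule simple_pole_meromorphic)
  obtain N where N: "K0_bounded N s" by (rule K0_bounded_exists)
  then have N': "K0_bounded (Suc N) (K0_deriv s)" by (auto simp: K0_bounded_def)
  consider m where "n = int m" | "n = -1" | "n < -1"
    using nonneg_int_cases[of n] by fastforce
  then show "K0_coeff (inner_part k (K0_deriv s)) n = K0_coeff (K0_deriv (inner_part k s)) n"
  proof cases
    case 1
    have "K0_coeff (inner_part k (K0_deriv s)) n =
      (\<Sum>j<Suc N. (-1) ^ m * fact (m + j) / (fact m * fact j) *
        fls_nth (laurent_expansion k 0) (int m + int j) * (- of_nat j * K0_coeff s (- int j)))"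
      unfolding 1 inner_part_coeff_nonneg[OF mero N'] by simp
    also have "\<dots> = (\<Sum>j<N. (-1) ^ m * fact (m + Suc j) / (fact m * fact (Suc j)) *
        fls_nth (laurent_expansion k 0) (int m + int (Suc j)) * (- of_nat (Suc j) * K0_coeff s (- int (Suc j))))"
      by (subst sum.lessThan_Suc_shift) simp
    also have "\<dots> = of_nat (Suc m) * (\<Sum>j<N. (-1) ^ Suc m * fact (Suc m + j) / (fact (Suc m) * fact j) *
        fls_nth (laurent_expansion k 0) (int (Suc m) + int j) * K0_coeff s (- 1 - int j))"
      unfolding sum_distrib_left
    proof (intro sum.cong refl)
      fix j
      have idx: "int m + int (Suc j) = int (Suc m) + int j" "- int (Suc j) = - 1 - int j"
        "m + Suc j = Suc m + j" by simp_all
      have "(-1) ^ m * F / (fact m * fact (Suc j)) * x * (- of_nat (Suc j) * y)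
        = of_nat (Suc m) * ((-1) ^ Suc m * F / (fact (Suc m) * fact j) * x * y)" for F x y :: complex
        unfolding fact_Suc of_nat_mult using of_nat_neq_0[of j, where 'a = complex] of_nat_neq_0[of m, where 'a = complex]
        by (simp add: divide_simps del: of_nat_Suc)
      then show "(-1) ^ m * fact (m + Suc j) / (fact m * fact (Suc j)) *
        fls_nth (laurent_expansion k 0) (int m + int (Suc j)) * (- of_nat (Suc j) * K0_coeff s (- int (Suc j)))
        = of_nat (Suc m) * ((-1) ^ Suc m * fact (Suc m + j) / (fact (Suc m) * fact j) *
        fls_nth (laurent_expansion k 0) (int (Suc m) + int j) * K0_coeff s (- 1 - int j))"
        unfolding idx by blast
    qed
    also have "\<dots> = K0_coeff (K0_deriv (inner_part k s)) n"
      using inner_part_coeff_nonneg[OF mero N, of "Suc m"] by (simp add: 1 add.commute)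
    finally show ?thesis .
  qed (simp_all add: inner_part_coeff_neg[OF k])
qed

text \<open>
  The kernel of the adjoint operator, up to sign.
\<close>

definition reflect :: "(complex \<Rightarrow> complex) \<Rightarrow> complex \<Rightarrow> complex" where
  "reflect k x = - k (- x)"

lemma laurent_reflect:
  assumes "k meromorphic_on {0}"
  shows "reflect k meromorphic_on {0}"
    and "fls_nth (laurent_expansion (reflect k) 0) n = - ((-1) powi n * fls_nth (laurent_expansion k 0) n)"
proof -
  have "k has_laurent_expansion laurent_expansion k 0"
    using meromorphic_on_imp_has_laurent_expansion[OF assms, of 0] by simp
  then have "(k \<circ> (\<lambda>z. - z)) has_laurent_expansion
      fls_compose_fps (laurent_expansion k 0) (fps_const (- 1) * fps_X)"
    using has_laurent_expansion_minus[OF has_laurent_expansion_fps_X]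
    by (intro has_laurent_expansion_compose) (auto simp flip: fps_const_neg)
  then have "reflect k has_laurent_expansion
      - fls_compose_fps (laurent_expansion k 0) (fps_const (- 1) * fps_X)"
    unfolding reflect_def[abs_def] by (intro has_laurent_expansion_minus) (simp add: o_def)
  note lau = this
  show "reflect k meromorphic_on {0}"
    by (rule laurent_imp_meromorphic[OF lau])
  show "fls_nth (laurent_expansion (reflect k) 0) n = - ((-1) powi n * fls_nth (laurent_expansion k 0) n)"
    unfolding laurent_expansion_0_eqI[OF lau] using fls_nth_fls_compose_fps_linear[of "- 1" "laurent_expansion k 0" n]
    by (simp add: mult.commute[of "fls_nth _ _"])
qed

lemma simple_pole_reflect: "simple_pole \<kappa> k \<Longrightarrow> simple_pole \<kappa> (reflect k)"
  using laurent_reflect[of k] by (simp add: simple_pole_def)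

text \<open>
  Both double sums over the coefficients of the kernel agree after exchanging the order of
  summation.  What remains is \<kappa> times the pairing of s and t, split into the terms where s and
  where t contributes its principal part.
\<close>

lemma outer_part_transpose:
  assumes k: "simple_pole \<kappa> k"
  shows "K0_pair (outer_part \<kappa> k s) t = - K0_pair s (inner_part (reflect k) t)"
proof -
  let ?K = "fls_nth (laurent_expansion k 0)"
  have mero: "k meromorphic_on {0}" using k by (rule simple_pole_meromorphic)
  note reflect = laurent_reflect[OF mero]
  obtain N where s: "K0_bounded N s" and t: "K0_bounded N t" by (rule K0_bounded_exists2)
  let ?C = "\<lambda>n j. (-1) ^ n * fact (n + j) / (fact n * fact j) * ?K (int n + int j)
      * K0_coeff s (- 1 - int j) * K0_coeff t (- 1 - int n)"
  have "K0_pair (outer_part \<kappa> k s) t = (\<Sum>n<N. K0_coeff (outer_part \<kappa> k s) (int n) * K0_coeff t (- 1 - int n))"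
    by (rule K0_pair_regular[OF outer_part_regular[OF k] t])
  also have "\<dots> = \<kappa> * (\<Sum>n<N. K0_coeff s (int n) * K0_coeff t (- 1 - int n)) + (\<Sum>n<N. \<Sum>j<N. ?C n j)"
    by (simp add: outer_part_def inner_part_coeff_nonneg[OF mero s] sum_distrib_left sum_distrib_right
        algebra_simps sum.distrib)
  finally have 1: "K0_pair (outer_part \<kappa> k s) t = \<dots>" .
  have "K0_pair s (outer_part \<kappa> (reflect k) t)
      = (\<Sum>j<N. K0_coeff (outer_part \<kappa> (reflect k) t) (int j) * K0_coeff s (- 1 - int j))"
    by (subst K0_pair_sym) (rule K0_pair_regular[OF outer_part_regular[OF simple_pole_reflect[OF k]] s])
  also have "\<dots> = \<kappa> * (\<Sum>j<N. K0_coeff t (int j) * K0_coeff s (- 1 - int j)) - (\<Sum>j<N. \<Sum>n<N. ?C n j)"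
  proof -
    have sgn: "(-1) ^ j * F * - ((-1) powi (int j + int n) * x) = - ((-1) ^ n * F * x)" for j n and F x :: complex
      by (simp add: power_int_add flip: power_mult_distrib)
    have "(-1) ^ j * fact (j + n) / (fact j * fact n) * fls_nth (laurent_expansion (reflect k) 0) (int j + int n)
        * K0_coeff t (- 1 - int n) * K0_coeff s (- 1 - int j) = - ?C n j" for j n
      using sgn[of j "fact (j + n) / (fact j * fact n)" n "?K (int j + int n)"]
      unfolding reflect(2) by (simp add: add.commute mult_ac)
    then show ?thesis
      by (simp add: outer_part_def inner_part_coeff_nonneg[OF reflect(1) t] sum_distrib_left sum_distrib_right
        sum.distrib distrib_right sum_negf sum_subtractf mult.assoc)
  qed
  finally have 2: "K0_pair s (outer_part \<kappa> (reflect k) t) = \<dots>" .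
  have 3: "K0_pair s t = (\<Sum>n<N. K0_coeff s (int n) * K0_coeff t (- 1 - int n))
      + (\<Sum>j<N. K0_coeff t (int j) * K0_coeff s (- 1 - int j))"
  proof -
    have "{- int N..int N - 1} = int ` {..<N} \<union> (\<lambda>j. - 1 - int j) ` {..<N}"
    proof (intro equalityI subsetI)
      fix i assume i: "i \<in> {- int N..int N - 1}"
      show "i \<in> int ` {..<N} \<union> (\<lambda>j. - 1 - int j) ` {..<N}"
      proof (cases "i \<ge> 0")
        case True
        then show ?thesis using i by (intro UnI1 image_eqI[of _ _ "nat i"]) auto
      next
        case False
        then show ?thesis using i by (intro UnI2 image_eqI[of _ _ "nat (- 1 - i)"]) auto
      qed
    qed auto
    moreover have "int ` {..<N} \<inter> (\<lambda>j. - 1 - int j) ` {..<N} = {}" by auto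
    ultimately show ?thesis
      unfolding K0_pair_bounded[OF s t]
      by (simp add: sum.union_disjoint sum.reindex inj_on_def mult.commute)
  qed
  have 4: "K0_pair s (inner_part (reflect k) t) = K0_pair s (outer_part \<kappa> (reflect k) t) - \<kappa> * K0_pair s t"
    by (simp add: outer_part_def)
  have swap: "(\<Sum>n<N. \<Sum>j<N. ?C n j) = (\<Sum>j<N. \<Sum>n<N. ?C n j)"
    by (rule sum.swap)
  show ?thesis
    unfolding 4 1 2 3 swap by (simp only: distrib_left) simp
qed

text \<open>
  The inner operator kills regular functions and the outer one has regular values.
\<close>

lemma outer_inner_part:
  assumes k: "simple_pole 1 k"
  shows "outer_part 1 k (inner_part k s) = 0"
    and "outer_part 1 k (outer_part 1 k s) = outer_part 1 k s"
proof -
  have mero: "k meromorphic_on {0}" using k by (rule simple_pole_meromorphic)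
  have "inner_part k (outer_part 1 k s) = 0"
    by (rule inner_part_regular[OF mero outer_part_regular[OF k]])
  then show *: "outer_part 1 k (outer_part 1 k s) = outer_part 1 k s"
    by (simp add: outer_part_def scaleC_one)
  then show "outer_part 1 k (inner_part k s) = 0"
    by (simp add: outer_part_def inner_part_add[OF mero] scaleC_one)
qed

section \<open>Kernels built from the theta function\<close>

lemma rep_K0_eval:
  shows rep_K0_one: "\<forall>\<^sub>F u in at 0. rep_K0 1 u = 1"
    and rep_K0_add: "\<forall>\<^sub>F u in at 0. rep_K0 (s + t) u = rep_K0 s u + rep_K0 t u"
    and rep_K0_diff: "\<forall>\<^sub>F u in at 0. rep_K0 (s - t) u = rep_K0 s u - rep_K0 t u"
    and rep_K0_mult: "\<forall>\<^sub>F u in at 0. rep_K0 (s * t) u = rep_K0 s u * rep_K0 t u"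
    and rep_K0_scale: "\<forall>\<^sub>F u in at 0. rep_K0 (a *\<^sub>C s) u = a * rep_K0 s u"
  unfolding one_K0_def plus_K0_def minus_K0_def times_K0_def scaleC_K0_def map_fun_def id_def o_def
  by (rule rep_abs_K0; intro meromorphic_intros)+

context theta
begin

lemma reflect_ker_lam: "reflect (ker_lam l) = ker_lam (- l)"
proof
  fix x
  have "\<theta> (- x + l) = - \<theta> (x + - l)" using theta_minus[of "x + - l"] by simp
  then show "reflect (ker_lam l) x = ker_lam (- l) x"
    by (simp add: reflect_def ker_lam_def theta_minus)
qed

lemma reflect_ker_zeta: "reflect ker_zeta = ker_zeta"
  by (rule ext) (simp add: reflect_def ker_zeta_def theta_minus deriv_theta_minus)

lemma theta_expansion: "(\<lambda>x. \<theta> (x + l)) has_fps_expansion fps_expansion \<theta> l"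
proof -
  have "\<theta> analytic_on {l}"
    using holomorphic_theta by (meson analytic_at open_UNIV UNIV_I)
  from analytic_at_imp_has_fps_expansion[OF this] show ?thesis by (simp add: add.commute)
qed

lemma deriv_theta_expansion: "(\<lambda>x. deriv \<theta> (x + l)) has_fps_expansion fps_expansion (deriv \<theta>) l"
proof -
  have "deriv \<theta> analytic_on {l}"
    using holomorphic_deriv[OF holomorphic_theta open_UNIV] by (meson analytic_at open_UNIV UNIV_I)
  from analytic_at_imp_has_fps_expansion[OF this] show ?thesis by (simp add: add.commute)
qed

text \<open>
  The expansion of x / \<theta>(x), so that division by \<theta> becomes a shift and a product of power series.
\<close>

definition theta_inv :: "complex fps" where
  "theta_inv = inverse (fps_shift 1 (fps_expansion \<theta> 0))"

lemma theta_inv_0: "fps_nth theta_inv 0 = 1"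
  by (simp add: theta_inv_def fps_expansion_def deriv_theta_0)

lemma divide_theta_laurent:
  assumes "f has_fps_expansion F"
  shows "(\<lambda>x. f x / \<theta> x) has_laurent_expansion fls_X_inv * fps_to_fls (F * theta_inv)"
proof -
  let ?T = "fps_expansion \<theta> 0" and ?U = "fps_shift 1 (fps_expansion \<theta> 0)"
  have "?T = ?U * fps_X"
    by (rule fps_ext) (auto simp: fps_mult_fps_X_commute fps_X_mult_nth fps_expansion_def theta_0)
  moreover have "?U * theta_inv = 1"
    unfolding theta_inv_def by (rule inverse_mult_eq_1') (simp add: fps_expansion_def deriv_theta_0)
  ultimately have "?T * theta_inv = fps_X"
    by (metis mult.assoc mult.commute mult_1)
  then have "fps_to_fls ?T * (fls_X_inv * fps_to_fls theta_inv) = fls_X_inv * fls_X"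
    by (metis fls_times_fps_to_fls fps_X_to_fls mult.left_commute)
  then have one: "fps_to_fls ?T * (fls_X_inv * fps_to_fls theta_inv) = 1"
    by (simp flip: fls_inverse_X)
  then have "inverse (fps_to_fls ?T) = fls_X_inv * fps_to_fls theta_inv"
    by (rule inverse_unique)
  then have "fps_to_fls F / fps_to_fls ?T = fls_X_inv * fps_to_fls (F * theta_inv)"
    by (simp add: divide_inverse fls_times_fps_to_fls mult_ac)
  moreover have "(\<lambda>x. f x / \<theta> x) has_laurent_expansion fps_to_fls F / fps_to_fls ?T"
    using assms theta_expansion[of 0]
    by (intro has_laurent_expansion_divide has_laurent_expansion_fps) auto
  ultimately show ?thesis by simp
qed

lemma fls_X_inv_times_nth:
  "fls_nth (fls_X_inv * fps_to_fls G) n = (if n < -1 then 0 else fps_nth G (nat (n + 1)))"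
  for G :: "complex fps"
  by (simp add: fls_X_inv_times_conv_shift)

abbreviation ker_lam_fps :: "complex \<Rightarrow> complex fps" where
  "ker_lam_fps l \<equiv> fps_const (1 / \<theta> l) * fps_expansion \<theta> l"

abbreviation ker_dlam_fps :: "complex \<Rightarrow> complex fps" where
  "ker_dlam_fps l \<equiv> fps_const (1 / \<theta> l) * fps_expansion (deriv \<theta>) l
     - fps_const (deriv \<theta> l / \<theta> l ^ 2) * fps_expansion \<theta> l"

lemma ker_lam_laurent:
  "ker_lam l has_laurent_expansion fls_X_inv * fps_to_fls (ker_lam_fps l * theta_inv)"
proof -
  have "(\<lambda>x. (1 / \<theta> l * \<theta> (x + l)) / \<theta> x) has_laurent_expansion
      fls_X_inv * fps_to_fls (ker_lam_fps l * theta_inv)"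
    by (intro divide_theta_laurent fps_expansion_intros theta_expansion)
  moreover have "(\<lambda>x. (1 / \<theta> l * \<theta> (x + l)) / \<theta> x) = ker_lam l"
    by (rule ext) (simp add: ker_lam_def mult.commute)
  ultimately show ?thesis by simp
qed

lemma ker_dlam_laurent:
  "ker_dlam l has_laurent_expansion fls_X_inv * fps_to_fls (ker_dlam_fps l * theta_inv)"
proof -
  have "(\<lambda>x. (1 / \<theta> l * deriv \<theta> (x + l) - deriv \<theta> l / \<theta> l ^ 2 * \<theta> (x + l)) / \<theta> x) has_laurent_expansion
      fls_X_inv * fps_to_fls (ker_dlam_fps l * theta_inv)"
    by (intro divide_theta_laurent fps_expansion_intros theta_expansion deriv_theta_expansion)
  moreover have "(\<lambda>x. (1 / \<theta> l * deriv \<theta> (x + l) - deriv \<theta> l / \<theta> l ^ 2 * \<theta> (x + l)) / \<theta> x) = ker_dlam l"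
    by (rule ext) (simp add: ker_dlam_def diff_divide_distrib mult_ac)
  ultimately show ?thesis by simp
qed

lemma simple_pole_ker_lam: "simple_pole (if \<theta> l = 0 then 0 else 1) (ker_lam l)"
  by (rule simple_poleI[OF ker_lam_laurent])
    (auto simp: fls_X_inv_times_nth theta_inv_0 fps_expansion_def)

lemma simple_pole_ker_lam_1: "\<theta> l \<noteq> 0 \<Longrightarrow> simple_pole 1 (ker_lam l)"
  using simple_pole_ker_lam[of l] by simp

lemma simple_pole_ker_dlam: "\<theta> l \<noteq> 0 \<Longrightarrow> simple_pole 0 (ker_dlam l)"
  by (rule simple_poleI[OF ker_dlam_laurent])
    (auto simp: fls_X_inv_times_nth theta_inv_0 fps_expansion_def power2_eq_square)

lemma simple_pole_ker_zeta: "simple_pole 1 ker_zeta"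
proof (rule simple_poleI)
  show "ker_zeta has_laurent_expansion fls_X_inv * fps_to_fls (fps_expansion (deriv \<theta>) 0 * theta_inv)"
    using divide_theta_laurent[OF deriv_theta_expansion[of 0]] by (simp add: ker_zeta_def[abs_def])
qed (auto simp: fls_X_inv_times_nth theta_inv_0 fps_expansion_def deriv_theta_0)

text \<open>
  The coefficients of the kernel are finite combinations of the derivatives of \<theta> at l, divided by
  \<theta>(l), and the coefficients of the operator are finite combinations of those.
\<close>

lemma inner_part_dlam:
  assumes "\<theta> l \<noteq> 0"
  shows "((\<lambda>l. K0_coeff (inner_part (ker_lam l) s) n) has_field_derivative
     K0_coeff (inner_part (ker_dlam l) s) n) (at l)"
proof -
  have coeff: "((\<lambda>l. fls_nth (laurent_expansion (ker_lam l) 0) m) has_field_derivative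
     fls_nth (laurent_expansion (ker_dlam l) 0) m) (at l)" for m
  proof -
    have "((deriv ^^ i) \<theta> has_field_derivative (deriv ^^ Suc i) \<theta> l) (at l)" for i
      using holomorphic_derivI[OF holomorphic_higher_deriv[OF holomorphic_theta open_UNIV] open_UNIV, of l i] by simp
    moreover have "(deriv ^^ i) (deriv \<theta>) l = (deriv ^^ Suc i) \<theta> l" for i
      by (simp add: funpow_swap1)
    ultimately have "((\<lambda>l. fps_nth (ker_lam_fps l) i) has_field_derivative fps_nth (ker_dlam_fps l) i) (at l)" for i
      using assms
      by (auto intro!: derivative_eq_intros has_field_derivative_theta
          simp: fps_expansion_def field_simps power2_eq_square simp del: funpow.simps)
    then have "((\<lambda>l. fps_nth (ker_lam_fps l * theta_inv) i) has_field_derivative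
        fps_nth (ker_dlam_fps l * theta_inv) i) (at l)" for i
      unfolding fps_mult_nth[of _ theta_inv] by (intro DERIV_sum DERIV_cmult_right)
    then show ?thesis
      unfolding laurent_expansion_0_eqI[OF ker_lam_laurent] laurent_expansion_0_eqI[OF ker_dlam_laurent]
        fls_X_inv_times_nth by simp
  qed
  obtain N where N: "K0_bounded N s" by (rule K0_bounded_exists)
  show ?thesis
    unfolding inner_part_laurent(2)[OF laurent_imp_meromorphic[OF ker_lam_laurent] N]
      inner_part_laurent(2)[OF laurent_imp_meromorphic[OF ker_dlam_laurent] N]
    by (intro DERIV_sum DERIV_cmult_right DERIV_cmult coeff)
qed

text \<open>
  Inner and outer operators for root currents (P), for the Cartan current (Q), and the derivative
  of P with respect to l (D); the outer and inner operators have the same derivative.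
\<close>

abbreviation "Pm l \<equiv> inner_part (ker_lam l)"
abbreviation "Pp l \<equiv> outer_part 1 (ker_lam l)"
abbreviation "Qm \<equiv> inner_part ker_zeta"
abbreviation "Qp \<equiv> outer_part 1 ker_zeta"
abbreviation "Dm l \<equiv> inner_part (ker_dlam l)"

text \<open>
  For fixed z and u the trisecant identity with x = u - z and y = v - u is an identity of test
  functions in v.  Pairing it with t gives an identity between functions of u, valid for all small z.
\<close>

lemma fay_shifted:
  assumes l: "\<theta> l \<noteq> 0"
  shows "\<forall>\<^sub>F z in at 0. \<forall>t. shifted (ker_lam l) z * Pm l t
    = K0_pair (shifted (ker_lam l) z) t *\<^sub>C shifted ker_zeta z
      + Qm (shifted (ker_lam l) z * t) - K0_pair (shifted (ker_dlam l) z) t *\<^sub>C 1"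
proof -
  let ?g = "ker_lam l" and ?d = "ker_dlam l"
  note mero = simple_pole_meromorphic[OF simple_pole_ker_lam[of l]]
    simple_pole_meromorphic[OF simple_pole_ker_dlam[OF l]] simple_pole_meromorphic[OF simple_pole_ker_zeta]
  have "\<forall>\<^sub>F x in at 0. \<theta> x \<noteq> 0"
  proof (rule has_laurent_expansion_nonzero_imp_eventually_nonzero)
    show "\<theta> has_laurent_expansion fps_to_fls (fps_expansion \<theta> 0)"
      using has_laurent_expansion_fps[OF theta_expansion[of 0]] by simp
    have "fps_nth (fps_expansion \<theta> 0) 1 \<noteq> 0"
      by (simp add: fps_expansion_def deriv_theta_0)
    then show "fps_to_fls (fps_expansion \<theta> 0) \<noteq> 0" by force
  qed
  then obtain R where R: "R > 0" "\<And>x. x \<noteq> 0 \<Longrightarrow> norm x < R \<Longrightarrow> \<theta> x \<noteq> 0"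
    unfolding eventually_at by auto
  have hol: "?g holomorphic_on ball 0 R - {0}" "?d holomorphic_on ball 0 R - {0}"
    "ker_zeta holomorphic_on ball 0 R - {0}"
    unfolding ker_lam_def[abs_def] ker_dlam_def[abs_def] ker_zeta_def[abs_def]
    using R l by (auto intro!: holomorphic_intros)
  have rep_shifted: "\<forall>\<^sub>F u in at 0. rep_K0 (shifted k z) u = k (u - z)"
    if "k holomorphic_on ball 0 R - {0}" "0 < norm z" "norm z < R" for k z
    unfolding shifted_def using shifted_coeff(1)[OF that] by (rule rep_abs_K0)
  have key: "?g (u - z) *\<^sub>C shifted ?g u
      = ker_zeta (u - z) *\<^sub>C shifted ?g z + shifted ker_zeta u * shifted ?g z - shifted ?d z"
    if z: "0 < norm z" "norm z < R / 2" and u: "0 < norm u" "norm u < norm z" for u z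
  proof (rule K0_eqI)
    have uz: "u \<noteq> z" "norm (u - z) < R" "norm u < R" "norm z < R"
      using z u norm_triangle_ineq4[of u z] by (blast | linarith)+
    have "\<forall>\<^sub>F v in at 0. v \<in> ball 0 (norm u) - {0}"
      using u by (intro eventually_at_in_open) auto
    then have "\<forall>\<^sub>F v in at 0. ?g (u - z) * ?g (v - u)
        = ?g (v - z) * (ker_zeta (u - z) + ker_zeta (v - u)) - ?d (v - z)"
    proof eventually_elim
      case (elim v)
      then have "v \<noteq> u" "v \<noteq> z" "norm (v - u) < R" "norm (v - z) < R"
        using z u norm_triangle_ineq4[of v u] norm_triangle_ineq4[of v z] by auto
      then show ?case
        using fay_kernels[OF l, of "u - z" "v - u"] R(2) uz by simp
    qed
    then show "\<forall>\<^sub>F v in at 0. rep_K0 (?g (u - z) *\<^sub>C shifted ?g u) v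
      = rep_K0 (ker_zeta (u - z) *\<^sub>C shifted ?g z + shifted ker_zeta u * shifted ?g z - shifted ?d z) v"
      using rep_K0_scale[of "?g (u - z)" "shifted ?g u"]
        rep_K0_diff[of "ker_zeta (u - z) *\<^sub>C shifted ?g z + shifted ker_zeta u * shifted ?g z" "shifted ?d z"]
        rep_K0_add[of "ker_zeta (u - z) *\<^sub>C shifted ?g z" "shifted ker_zeta u * shifted ?g z"]
        rep_K0_scale[of "ker_zeta (u - z)" "shifted ?g z"]
        rep_K0_mult[of "shifted ker_zeta u" "shifted ?g z"]
        rep_shifted[OF hol(1) u(1) uz(3)] rep_shifted[OF hol(3) u(1) uz(3)]
        rep_shifted[OF hol(1) z(1) uz(4)] rep_shifted[OF hol(2) z(1) uz(4)]
    proof eventually_elim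
      case (elim v)
      show ?case
        unfolding elim(2-) using elim(1) by (simp add: algebra_simps)
    qed
  qed
  have "\<forall>\<^sub>F z in at 0. z \<in> ball 0 (R / 2) - {0}"
    using R(1) by (intro eventually_at_in_open) auto
  then show ?thesis
  proof eventually_elim
    case (elim z)
    then have z: "0 < norm z" "norm z < R / 2" by auto
    with R(1) have zR: "norm z < R" by linarith
    show ?case
    proof (intro allI K0_eqI)
      fix t
      let ?a = "K0_pair (shifted ?g z) t" and ?b = "K0_pair (shifted ?d z) t"
      have "\<forall>\<^sub>F u in at 0. u \<in> ball 0 (norm z) - {0}"
        using z by (intro eventually_at_in_open) auto
      then have "\<forall>\<^sub>F u in at 0. ?g (u - z) * K0_pair (shifted ?g u) t
          = ?a * ker_zeta (u - z) + K0_pair (shifted ker_zeta u) (shifted ?g z * t) - ?b"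
      proof eventually_elim
        case (elim u)
        then have "K0_pair (?g (u - z) *\<^sub>C shifted ?g u) t
            = K0_pair (ker_zeta (u - z) *\<^sub>C shifted ?g z + shifted ker_zeta u * shifted ?g z - shifted ?d z) t"
          using key[of z u] z by simp
        then show ?case by (simp add: K0_pair_assoc mult.commute)
      qed
      then show "\<forall>\<^sub>F u in at 0. rep_K0 (shifted ?g z * Pm l t) u
        = rep_K0 (?a *\<^sub>C shifted ker_zeta z + Qm (shifted ?g z * t) - ?b *\<^sub>C 1) u"
        using rep_K0_mult[of "shifted ?g z" "Pm l t"]
          rep_K0_diff[of "?a *\<^sub>C shifted ker_zeta z + Qm (shifted ?g z * t)" "?b *\<^sub>C 1"]
          rep_K0_add[of "?a *\<^sub>C shifted ker_zeta z" "Qm (shifted ?g z * t)"]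
          rep_K0_scale[of ?a "shifted ker_zeta z"] rep_K0_scale[of ?b 1] rep_K0_one
          rep_shifted[OF hol(1) z(1) zR] rep_shifted[OF hol(3) z(1) zR]
          rep_inner_part[OF mero(1), of t] rep_inner_part[OF mero(3), of "shifted ?g z * t"]
        by eventually_elim simp
    qed
  qed
qed

lemma Qp_transpose: "K0_pair (Qp s) t = - K0_pair s (Qm t)"
  using outer_part_transpose[OF simple_pole_ker_zeta, of s t] by (simp add: reflect_ker_zeta)

lemma Pp_transpose: "\<theta> l \<noteq> 0 \<Longrightarrow> K0_pair (Pp l s) t = - K0_pair s (Pm (- l) t)"
  using outer_part_transpose[OF simple_pole_ker_lam_1, of l s t] by (simp add: reflect_ker_lam)

text \<open>
  Pair \<open>fay_shifted\<close> with s: its left-hand side becomes the value of \<open>Pm l (s * Pm l t)\<close> at z, and moving \<open>Qm\<close>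
  to the other side produces the value of \<open>- Pm l (t * Qp s)\<close>.
\<close>

lemma cartan_root_identity:
  assumes l: "\<theta> l \<noteq> 0"
  shows "Qm s * Pm l t = Pm l (s * Pm l t) + Pm l (t * Qp s) + K0_pair 1 s *\<^sub>C Dm l t"
proof -
  note mero = simple_pole_meromorphic[OF simple_pole_ker_lam[of l]]
    simple_pole_meromorphic[OF simple_pole_ker_dlam[OF l]] simple_pole_meromorphic[OF simple_pole_ker_zeta]
  have "Pm l (s * Pm l t) = Pm l t * Qm s - Pm l (t * Qp s) - K0_pair 1 s *\<^sub>C Dm l t"
  proof (rule K0_eqI)
    show "\<forall>\<^sub>F z in at 0. rep_K0 (Pm l (s * Pm l t)) z
      = rep_K0 (Pm l t * Qm s - Pm l (t * Qp s) - K0_pair 1 s *\<^sub>C Dm l t) z"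
      using fay_shifted[OF l] rep_inner_part[OF mero(1), of "s * Pm l t"]
        rep_inner_part[OF mero(1), of t] rep_inner_part[OF mero(3), of s]
        rep_inner_part[OF mero(1), of "t * Qp s"] rep_inner_part[OF mero(2), of t]
        rep_K0_diff[of "Pm l t * Qm s - Pm l (t * Qp s)" "K0_pair 1 s *\<^sub>C Dm l t"]
        rep_K0_diff[of "Pm l t * Qm s" "Pm l (t * Qp s)"] rep_K0_mult[of "Pm l t" "Qm s"]
        rep_K0_scale[of "K0_pair 1 s" "Dm l t"]
    proof eventually_elim
      case (elim z)
      let ?g = "shifted (ker_lam l) z"
      have "rep_K0 (Pm l (s * Pm l t)) z = K0_pair (?g * Pm l t) s"
        using elim(2) by (simp add: K0_pair_assoc mult.commute[of s])
      also have "\<dots> = K0_pair ?g t * K0_pair (shifted ker_zeta z) s + K0_pair (Qm (?g * t)) s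
          - K0_pair (shifted (ker_dlam l) z) t * K0_pair 1 s"
        using elim(1) by simp
      also have "K0_pair (Qm (?g * t)) s = - K0_pair ?g (t * Qp s)"
        using Qp_transpose[of s "?g * t"] K0_pair_assoc[of ?g t "Qp s"]
        by (simp add: K0_pair_sym[of "Qm (?g * t)" s] K0_pair_sym[of "Qp s"])
      finally show ?case
        using elim by (simp add: mult.commute)
    qed
  qed
  then show ?thesis by (simp add: algebra_simps)
qed

end

context theta
begin

section \<open>Operators defining the half-currents\<close>

text \<open>
  The half-currents \<open>e\<close>, \<open>f\<close> and \<open>h\<close> on a test function s are the currents on \<open>P \<epsilon> l s\<close>, \<open>P \<epsilon> (- l) s\<close>
  and \<open>Q \<epsilon> s\<close>.
\<close>

definition P :: "branch \<Rightarrow> complex \<Rightarrow> K0 \<Rightarrow> K0" where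
  "P \<epsilon> l = contour_action \<epsilon> (ker_lam l)"

definition Q :: "branch \<Rightarrow> K0 \<Rightarrow> K0" where
  "Q \<epsilon> = contour_action \<epsilon> ker_zeta"

lemma P_Minus: "P Minus l s = Pm l s"
  unfolding P_def by (rule contour_action_eq(1)[OF simple_pole_ker_lam])

lemma P_Plus': "P Plus l s = outer_part (if \<theta> l = 0 then 0 else 1) (ker_lam l) s"
  unfolding P_def by (rule contour_action_eq(2)[OF simple_pole_ker_lam])

lemma Q_Minus: "Q Minus s = Qm s" and Q_Plus': "Q Plus s = Qp s"
  unfolding Q_def by (rule contour_action_eq[OF simple_pole_ker_zeta])+

lemma P_Plus: "\<theta> l \<noteq> 0 \<Longrightarrow> P Plus l s = s + P Minus l s"
  by (simp add: P_Plus' P_Minus outer_part_def scaleC_one)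

lemma Q_Plus: "Q Plus s = s + Q Minus s"
  by (simp add: Q_Plus' Q_Minus outer_part_def scaleC_one)

lemmas mero_lam = simple_pole_meromorphic[OF simple_pole_ker_lam]
lemmas mero_zeta = simple_pole_meromorphic[OF simple_pole_ker_zeta]

lemma P_linear [simp]:
  assumes "\<theta> l \<noteq> 0"
  shows "P \<epsilon> l (s + t) = P \<epsilon> l s + P \<epsilon> l t" "P \<epsilon> l (s - t) = P \<epsilon> l s - P \<epsilon> l t"
    "P \<epsilon> l (- s) = - P \<epsilon> l s" "P \<epsilon> l (a *\<^sub>C s) = a *\<^sub>C P \<epsilon> l s"
    "P \<epsilon> l (K0_deriv s) = K0_deriv (P \<epsilon> l s)"
  using assms
  by (cases \<epsilon>; simp add: P_Plus P_Minus inner_part_add inner_part_diff inner_part_uminus inner_part_scale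
      mero_lam scaleC_add_right inner_part_deriv[OF simple_pole_ker_lam]
      K0_fls_inject[symmetric])+

lemma Q_linear [simp]:
  shows "Q \<epsilon> (s + t) = Q \<epsilon> s + Q \<epsilon> t" "Q \<epsilon> (s - t) = Q \<epsilon> s - Q \<epsilon> t"
    "Q \<epsilon> (- s) = - Q \<epsilon> s" "Q \<epsilon> (a *\<^sub>C s) = a *\<^sub>C Q \<epsilon> s"
    "Q \<epsilon> (K0_deriv s) = K0_deriv (Q \<epsilon> s)"
  by (cases \<epsilon>; simp add: Q_Plus Q_Minus inner_part_add inner_part_diff inner_part_uminus inner_part_scale
      mero_zeta scaleC_add_right inner_part_deriv[OF simple_pole_ker_zeta]
      K0_fls_inject[symmetric])+

lemma P_transpose: "\<theta> l \<noteq> 0 \<Longrightarrow> K0_pair (P Plus l s) t = - K0_pair s (P Minus (- l) t)"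
  using Pp_transpose[of l s t] by (simp add: P_Plus' P_Minus)

lemma Q_transpose: "K0_pair (Q Plus s) t = - K0_pair s (Q Minus t)"
  using Qp_transpose[of s t] by (simp add: Q_Plus' Q_Minus)

lemma P_projection: "\<theta> l \<noteq> 0 \<Longrightarrow> P Plus l (P Minus l s) = 0" "\<theta> l \<noteq> 0 \<Longrightarrow> P Plus l (P Plus l s) = P Plus l s"
  using outer_inner_part[OF simple_pole_ker_lam_1, of l s] by (simp_all add: P_Plus' P_Minus)

lemma Q_projection: "Q Plus (Q Minus s) = 0" "Q Plus (Q Plus s) = Q Plus s"
  using outer_inner_part[OF simple_pole_ker_zeta, of s] by (simp_all add: Q_Plus' Q_Minus)

text \<open>
  The sign combinations in which the exchange relations are stated.  For the excluded one the
  identities below fail in general.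
\<close>

fun admissible :: "branch \<Rightarrow> branch \<Rightarrow> bool" where
  "admissible Minus Plus = False"
| "admissible _ _ = True"

text \<open>
  The coefficient of the central term of the exchange relation: 1 for the signs (+, -), and 0 otherwise.
\<close>

definition mixed :: "branch \<Rightarrow> branch \<Rightarrow> complex" where
  "mixed \<epsilon> \<epsilon>' = (if \<epsilon> = Plus \<and> \<epsilon>' = Minus then 1 else 0)"

text \<open>
  Since P^+ = 1 + P^- and Q^+ = 1 + Q^-, passing from one admissible case to another adds the same
  product to both sides, namely s times P^- t or t times Q^+ s; so every case reduces to
  \<open>cartan_root_identity\<close>.
\<close>

lemma cartan_root:
  assumes l: "\<theta> l \<noteq> 0" and "admissible \<epsilon> \<epsilon>'"
  shows "Q \<epsilon> s * P \<epsilon>' l t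
    = P \<epsilon> l (s * P Minus l t) + P \<epsilon>' l (t * Q Plus s) + K0_pair 1 s *\<^sub>C Dm l t"
  using cartan_root_identity[OF l, of s t] assms
  by (cases \<epsilon>; cases \<epsilon>') (simp_all add: P_Plus P_Minus[symmetric] Q_Plus Q_Plus'[symmetric] Q_Minus[symmetric] algebra_simps)

lemma root_cartan:
  assumes l: "\<theta> l \<noteq> 0" and "admissible \<epsilon> \<epsilon>'"
  shows "P \<epsilon> l s * Q \<epsilon>' t
    = P \<epsilon> l (s * Q Minus t) + P \<epsilon>' l (t * P Plus l s) + K0_pair 1 t *\<^sub>C Dm l s"
  using cartan_root_identity[OF l, of t s] assms
  by (cases \<epsilon>; cases \<epsilon>') (simp_all add: P_Plus P_Minus[symmetric] Q_Plus Q_Plus'[symmetric] Q_Minus[symmetric] algebra_simps)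

text \<open>
  Paired with a test function w, this is \<open>cartan_root\<close> for w and t paired with s: the operators
  applied to w are replaced by their adjoints, applied to the rest.
\<close>

lemma root_root:
  assumes l: "\<theta> l \<noteq> 0" and "admissible \<epsilon> \<epsilon>'"
  shows "P \<epsilon> (- l) s * P \<epsilon>' l t
    = Q \<epsilon> (s * P Minus l t) + Q \<epsilon>' (t * P Plus (- l) s) + K0_pair s (Dm l t) *\<^sub>C 1"
proof -
  have l': "\<theta> (- l) \<noteq> 0" using l by (simp add: theta_minus)
  have "P Plus (- l) s * P Minus l t
      = Q Plus (s * P Minus l t) + Q Minus (t * P Plus (- l) s) + K0_pair s (Dm l t) *\<^sub>C 1"
  proof (rule K0_pair_nondegenerate)
    fix w
    let ?p = "P Minus l t" and ?r = "P Plus (- l) s"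
    have "K0_pair s (Q Minus w * ?p) = K0_pair s (P Minus l (w * ?p)) + K0_pair s (P Minus l (t * Q Plus w))
        + K0_pair 1 w * K0_pair s (Dm l t)"
      by (subst cartan_root[OF l]) simp_all
    moreover have "K0_pair s (Q Minus w * ?p) = - K0_pair (Q Plus (s * ?p)) w"
      by (simp add: Q_transpose K0_pair_assoc mult.commute)
    moreover have "K0_pair s (P Minus l (w * ?p)) = - K0_pair (?r * ?p) w"
      using P_transpose[OF l', of s "w * ?p"] K0_pair_assoc[of ?r ?p w] by (simp add: mult.commute[of w])
    moreover have "K0_pair s (P Minus l (t * Q Plus w)) = K0_pair (Q Minus (t * ?r)) w"
      using P_transpose[OF l', of s "t * Q Plus w"] Q_transpose[of w "?r * t"]
        K0_pair_assoc[of ?r t "Q Plus w"] K0_pair_sym[of "Q Plus w" "?r * t"] K0_pair_sym[of w]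
      by (simp add: mult.commute)
    ultimately show "K0_pair (?r * ?p) w
      = K0_pair (Q Plus (s * ?p) + Q Minus (t * ?r) + K0_pair s (Dm l t) *\<^sub>C 1) w"
      by (simp add: algebra_simps)
  qed
  then show ?thesis
    using assms l' by (cases \<epsilon>; cases \<epsilon>') (simp_all add: P_Plus Q_Plus algebra_simps)
qed

text \<open>
  Moving the operator applied to t to the other side makes it act after the one applied to s, so
  the projection property decides whether the pairing vanishes.
\<close>

lemma root_root_central:
  assumes l: "\<theta> l \<noteq> 0" and "admissible \<epsilon> \<epsilon>'"
  shows "K0_pair (P \<epsilon> (- l) s) (P \<epsilon>' l t) = - mixed \<epsilon> \<epsilon>' * K0_pair (P Plus (- l) s) t"
proof -
  have l': "\<theta> (- l) \<noteq> 0" using l by (simp add: theta_minus)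
  have tr: "K0_pair u (P Minus l t) = - K0_pair (P Plus (- l) u) t" for u
    using P_transpose[OF l', of u t] by simp
  have "K0_pair (P Plus (- l) s) (P Plus l t) = 0"
    using tr[of "P Plus (- l) s"] P_projection(2)[OF l', of s] by (simp add: P_Plus[OF l])
  then show ?thesis
    using assms tr by (cases \<epsilon>; cases \<epsilon>') (simp_all add: mixed_def P_projection[OF l'])
qed

lemma cartan_cartan_central:
  assumes "admissible \<epsilon> \<epsilon>'"
  shows "K0_pair (Q \<epsilon> s) (Q \<epsilon>' t) = - mixed \<epsilon> \<epsilon>' * K0_pair (Q Plus s) t"
proof -
  have tr: "K0_pair u (Q Minus t) = - K0_pair (Q Plus u) t" for u
    using Q_transpose[of u t] by simp
  have "K0_pair (Q Plus s) (Q Plus t) = 0"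
    using tr[of "Q Plus s"] Q_projection(2)[of s] by (simp add: Q_Plus[of t])
  then show ?thesis
    using assms tr by (cases \<epsilon>; cases \<epsilon>') (simp_all add: mixed_def Q_projection)
qed

lemma green_eq: "green \<theta> s t = K0_pair (Q Plus s) t"
  by (simp add: green_def Q_def ker_zeta_def[abs_def])

lemma green_lam_eq: "green_lam \<theta> \<epsilon> l s t = K0_pair (P \<epsilon> l s) t"
  by (simp add: green_lam_def P_def ker_lam_def[abs_def])

text \<open>
  The negative Cartan half-current is defined through the transposed Green distribution, whose
  action is that of \<open>- Q Minus\<close>.
\<close>

lemma h_half_eq: "h_half \<theta> \<epsilon> s = hat Bh (Q \<epsilon> s)"
proof (cases \<epsilon>)
  case Plus
  have "partial_fst (green \<theta>) s = Q Plus s"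
    by (rule partial_fst_eq) (rule green_eq)
  then show ?thesis using Plus by (simp add: smear_def)
next
  case Minus
  have "partial_fst (\<lambda>s t. green \<theta> t s) s = - Q Minus s"
    by (rule partial_fst_eq) (simp add: green_eq Q_transpose K0_pair_sym[of "Q Minus s"])
  moreover have "- hat x (- a) = hat x a" for x a
    by (simp add: hat_def uminus_affine_def fun_eq_iff)
  ultimately show ?thesis using Minus by (simp add: smear_def)
qed

lemma e_half_eq: "e_half \<theta> \<epsilon> l s = hat Be (P \<epsilon> l s)"
  unfolding e_half_def smear_def by (subst partial_fst_eq[of "green_lam \<theta> \<epsilon> l" s "P \<epsilon> l s"]) (simp_all add: green_lam_eq)

lemma f_half_eq: "f_half \<theta> \<epsilon> l s = hat Bf (P \<epsilon> (- l) s)"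
  unfolding f_half_def smear_def by (subst partial_fst_eq[of "green_lam \<theta> \<epsilon> (- l)" s "P \<epsilon> (- l) s"]) (simp_all add: green_lam_eq)

text \<open>
  The bound is uniform in l, including the lattice points where the kernel degenerates to 0.
  Convergence of test functions requires a common pole order along the whole sequence.
\<close>

lemma P_bounded:
  assumes "K0_bounded N s"
  shows "K0_bounded N (P \<epsilon> l s)"
  using assms inner_part_coeff_neg[OF simple_pole_ker_lam, of _ l s] outer_part_regular[OF simple_pole_ker_lam, of l s]
  by (cases \<epsilon>) (auto simp: K0_bounded_def P_Minus P_Plus')

lemma Dm_bounded: "\<theta> l \<noteq> 0 \<Longrightarrow> K0_bounded N (Dm l s)"
  using inner_part_coeff_neg[OF simple_pole_ker_dlam, of l _ s] by (simp add: K0_bounded_def)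

lemma P_coeff_dlam:
  assumes "\<theta> l \<noteq> 0"
  shows "((\<lambda>l. K0_coeff (P \<epsilon> l s) n) has_field_derivative K0_coeff (Dm l s) n) (at l)"
proof (cases \<epsilon>)
  case Minus
  then show ?thesis using inner_part_dlam[OF assms] by (simp add: P_Minus)
next
  case Plus
  have "open {l. \<theta> l \<noteq> 0}"
    by (intro open_Collect_neq holomorphic_on_imp_continuous_on holomorphic_theta continuous_on_const)
  then have "\<forall>\<^sub>F l' in nhds l. l' \<in> {l. \<theta> l \<noteq> 0}"
    using assms by (intro eventually_nhds_in_open) auto
  then have ev: "\<forall>\<^sub>F l' in nhds l. K0_coeff (P Plus l' s) n = K0_coeff s n + K0_coeff (Pm l' s) n"
    by eventually_elim (simp add: P_Plus P_Minus)
  have "((\<lambda>l. K0_coeff s n + K0_coeff (Pm l s) n) has_field_derivative K0_coeff (Dm l s) n) (at l)"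
    using DERIV_add[OF DERIV_const inner_part_dlam[OF assms]] by simp
  then show ?thesis
    using Plus DERIV_cong_ev[OF refl ev refl] by simp
qed

lemma green_lam_dlam:
  assumes "\<theta> l \<noteq> 0"
  shows "((\<lambda>l. green_lam \<theta> \<epsilon> l s t) has_field_derivative K0_pair (Dm l s) t) (at l)"
proof -
  obtain N where N: "K0_bounded N s" "K0_bounded N t" by (rule K0_bounded_exists2)
  show ?thesis
    unfolding green_lam_eq K0_pair_bounded[OF P_bounded[OF N(1)] N(2)]
      K0_pair_bounded[OF Dm_bounded[OF assms, of N s] N(2)]
    by (intro DERIV_sum DERIV_cmult_right P_coeff_dlam assms)
qed

end

lemma affine_eqI:
  assumes "cur X Bh = cur Y Bh" "cur X Be = cur Y Be" "cur X Bf = cur Y Bf"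
    "c_part X = c_part Y" "d_part X = d_part Y"
  shows "X = Y"
proof (rule affine.expand)
  have "cur X = cur Y"
  proof
    show "cur X x = cur Y x" for x using assms by (cases x) auto
  qed
  with assms show "cur X = cur Y \<and> c_part X = c_part Y \<and> d_part X = d_part Y" by simp
qed

lemma affine_simps [simp]:
  "cur 0 x = 0" "c_part 0 = 0" "d_part 0 = 0"
  "cur (X + Y) x = cur X x + cur Y x" "c_part (X + Y) = c_part X + c_part Y" "d_part (X + Y) = d_part X + d_part Y"
  "cur (X - Y) x = cur X x - cur Y x" "c_part (X - Y) = c_part X - c_part Y" "d_part (X - Y) = d_part X - d_part Y"
  "cur (- X) x = - cur X x" "c_part (- X) = - c_part X" "d_part (- X) = - d_part X"
  "cur (a *\<^sub>C X) x = a *\<^sub>C cur X x" "c_part (a *\<^sub>C X) = a * c_part X" "d_part (a *\<^sub>C X) = a * d_part X"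
  "cur (hat y s) x = (if x = y then s else 0)" "c_part (hat y s) = 0" "d_part (hat y s) = 0"
  "cur c_elem x = 0" "c_part c_elem = 1" "d_part c_elem = 0"
  "cur d_elem x = 0" "c_part d_elem = 0" "d_part d_elem = 1"
  by (simp_all add: zero_affine_def plus_affine_def minus_affine_def uminus_affine_def scaleC_affine_def
      hat_def c_elem_def d_elem_def)

text \<open>
  Already along a single sequence the coefficients of the difference quotients have unique limits.
\<close>

lemma affine_deriv_eqI:
  assumes "affine_has_deriv X X' a"
  shows "affine_deriv X a = X'"
  unfolding affine_deriv_def
proof (rule the_equality[of "\<lambda>X'. affine_has_deriv X X' a", OF assms])
  fix Y assume Y: "affine_has_deriv X Y a"
  define l where "l n = a + inverse (of_nat (Suc n))" for n
  have l: "(\<forall>n. l n \<noteq> a) \<and> l \<longlonglongrightarrow> a"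
    using tendsto_add[OF tendsto_const LIMSEQ_Suc[OF lim_inverse_n], of a]
    by (simp add: l_def[abs_def] del: of_nat_Suc)
  let ?D = "\<lambda>n. (1 / (l n - a)) *\<^sub>C (X (l n) - X a)"
  have unique: "x = y" if "(\<lambda>n. D n - x) \<longlonglongrightarrow> 0" "(\<lambda>n. D n - y) \<longlonglongrightarrow> 0" for x y :: complex and D
    using tendsto_diff[OF that] LIMSEQ_const_iff[of "y - x" 0] by simp
  have X': "affine_null (\<lambda>n. ?D n - X')" and Y': "affine_null (\<lambda>n. ?D n - Y)"
    using assms Y l unfolding affine_has_deriv_def by blast+
  have "cur Y x = cur X' x" for x
  proof (rule K0_eq_coeffI)
    fix k
    show "K0_coeff (cur Y x) k = K0_coeff (cur X' x) k"
      using X' Y' unfolding affine_null_def K0_null_def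
      by (intro unique[of "\<lambda>n. K0_coeff (cur (?D n) x) k"]) auto
  qed
  moreover have "c_part Y = c_part X'"
    using X' Y' unfolding affine_null_def by (intro unique[of "\<lambda>n. c_part (?D n)"]) auto
  moreover have "d_part Y = d_part X'"
    using X' Y' unfolding affine_null_def by (intro unique[of "\<lambda>n. d_part (?D n)"]) auto
  ultimately show "Y = X'" by (intro affine_eqI) auto
qed

lemma K0_null_0: "K0_null (\<lambda>n. 0)"
  by (simp add: K0_null_def)

lemma affine_deriv_const: "affine_deriv (\<lambda>_. X) a = 0"
  by (rule affine_deriv_eqI) (simp add: affine_has_deriv_def affine_null_def K0_null_0)

text \<open>
  With a common bound on the pole orders, coefficientwise differentiability is differentiability
  in the topology of the test functions.
\<close>

lemma affine_deriv_hat: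
  assumes bd: "\<And>l. K0_bounded N (F l)" "K0_bounded N F'"
    and der: "\<And>n. ((\<lambda>l. K0_coeff (F l) n) has_field_derivative K0_coeff F' n) (at a)"
  shows "affine_deriv (\<lambda>l. hat x (F l)) a = hat x F'"
proof (rule affine_deriv_eqI, unfold affine_has_deriv_def, intro allI impI)
  fix l assume l: "(\<forall>n. l n \<noteq> a) \<and> l \<longlonglongrightarrow> a"
  have "K0_null (\<lambda>n. (1 / (l n - a)) *\<^sub>C (F (l n) - F a) - F')"
    unfolding K0_null_def
  proof (intro conjI exI[of _ N] allI impI)
    fix n k assume "k < - int N"
    then show "K0_coeff ((1 / (l n - a)) *\<^sub>C (F (l n) - F a) - F') k = 0"
      using bd by (simp add: K0_bounded_def)
  next
    fix k
    have "filterlim l (at a) sequentially"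
      using l by (auto simp: filterlim_at)
    moreover have "((\<lambda>z. (K0_coeff (F z) k - K0_coeff (F a) k) / (z - a)) \<longlongrightarrow> K0_coeff F' k) (at a)"
      using der[of k] by (simp add: has_field_derivative_iff)
    ultimately have "(\<lambda>n. (K0_coeff (F (l n)) k - K0_coeff (F a) k) / (l n - a)) \<longlonglongrightarrow> K0_coeff F' k"
      by (rule filterlim_compose[rotated])
    from tendsto_diff[OF this tendsto_const[of "K0_coeff F' k"]]
    show "(\<lambda>n. K0_coeff ((1 / (l n - a)) *\<^sub>C (F (l n) - F a) - F') k) \<longlonglongrightarrow> 0"
      by simp
  qed
  then show "affine_null (\<lambda>n. (1 / (l n - a)) *\<^sub>C (hat x (F (l n)) - hat x (F a)) - hat x F')"
    by (auto simp: affine_null_def K0_null_0 if_distrib[of "\<lambda>t. _ *\<^sub>C t"])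
qed

context theta
begin

lemma P_dlam:
  assumes "\<theta> l \<noteq> 0"
  shows "affine_deriv (\<lambda>l. hat x (P \<epsilon> l s)) l = hat x (Dm l s)"
    and "affine_deriv (\<lambda>l. hat x (P \<epsilon> (- l) s)) l = hat x (- Dm (- l) s)"
proof -
  obtain N where N: "K0_bounded N s" by (rule K0_bounded_exists)
  show "affine_deriv (\<lambda>l. hat x (P \<epsilon> l s)) l = hat x (Dm l s)"
    by (rule affine_deriv_hat[OF P_bounded[OF N] Dm_bounded[OF assms] P_coeff_dlam[OF assms]])
  have l': "\<theta> (- l) \<noteq> 0" using assms by (simp add: theta_minus)
  have "((\<lambda>l. K0_coeff (P \<epsilon> (- l) s) n) has_field_derivative K0_coeff (- Dm (- l) s) n) (at l)" for n
    using DERIV_chain2[OF P_coeff_dlam[OF l', of \<epsilon> s n] DERIV_minus[OF DERIV_ident]] by simp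
  then show "affine_deriv (\<lambda>l. hat x (P \<epsilon> (- l) s)) l = hat x (- Dm (- l) s)"
    using Dm_bounded[OF l', of N s]
    by (intro affine_deriv_hat[OF P_bounded[OF N]]) (simp add: K0_bounded_def)
qed

end

section \<open>Brackets of currents\<close>

lemma complex_linearD:
  assumes "complex_linear \<rho>"
  shows "\<rho> (X + Y) = \<rho> X + \<rho> Y" "\<rho> (a *\<^sub>C X) = a *\<^sub>C \<rho> X" "\<rho> 0 = 0" "\<rho> (- X) = - \<rho> X" "\<rho> (X - Y) = \<rho> X - \<rho> Y"
proof -
  show add: "\<rho> (X + Y) = \<rho> X + \<rho> Y" and sc: "\<rho> (a *\<^sub>C X) = a *\<^sub>C \<rho> X" for X Y a
    using assms by (simp_all add: complex_linear_def)
  show "\<rho> 0 = 0" using sc[of 0 0] by simp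
  show minus: "\<rho> (- X) = - \<rho> X" for X using sc[of "-1" X] by simp
  show "\<rho> (X - Y) = \<rho> X - \<rho> Y" using add[of X "- Y"] minus[of Y] by simp
qed

lemma UNIV_sl2: "UNIV = {Bh, Be, Bf}"
  using sl2_basis.exhaust by auto

lemma hat_linear [simp]:
  "hat x (s + t) = hat x s + hat x t" "hat x (s - t) = hat x s - hat x t" "hat x (- s) = - hat x s"
  "hat x (a *\<^sub>C s) = a *\<^sub>C hat x s" "hat x 0 = 0"
  by (rule affine_eqI; simp)+

lemma K0_deriv_linear [simp]:
  "K0_deriv (s + t) = K0_deriv s + K0_deriv t" "K0_deriv (s - t) = K0_deriv s - K0_deriv t"
  "K0_deriv (- s) = - K0_deriv s" "K0_deriv (a *\<^sub>C s) = a *\<^sub>C K0_deriv s" "K0_deriv 0 = 0" "K0_deriv 1 = 0"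
  by (simp_all add: K0_fls_inject[symmetric])

lemma lie_linear [simp]:
  "lie (X + Y) Z = lie X Z + lie Y Z" "lie Z (X + Y) = lie Z X + lie Z Y"
  "lie (- X) Z = - lie X Z" "lie Z (- X) = - lie Z X"
  "lie (X - Y) Z = lie X Z - lie Y Z" "lie Z (X - Y) = lie Z X - lie Z Y"
  "lie (a *\<^sub>C X) Z = a *\<^sub>C lie X Z" "lie Z (a *\<^sub>C X) = a *\<^sub>C lie Z X"
  "lie 0 X = 0" "lie X 0 = 0"
  by (rule affine_eqI; simp add: lie_def UNIV_sl2 scaleC_add_left scaleC_add_right scaleC_diff_left
      scaleC_diff_right mult_scaleC_left mult_scaleC_right algebra_simps)+

lemma lie_hat:
  "lie (hat Bh s) (hat Bh t) = (2 * K0_pair (K0_deriv s) t) *\<^sub>C c_elem"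
  "lie (hat Be s) (hat Be t) = 0" "lie (hat Bf s) (hat Bf t) = 0"
  "lie (hat Bh s) (hat Be t) = 2 *\<^sub>C hat Be (s * t)" "lie (hat Be s) (hat Bh t) = - (2 *\<^sub>C hat Be (s * t))"
  "lie (hat Bh s) (hat Bf t) = - (2 *\<^sub>C hat Bf (s * t))" "lie (hat Bf s) (hat Bh t) = 2 *\<^sub>C hat Bf (s * t)"
  "lie (hat Be s) (hat Bf t) = hat Bh (s * t) + K0_pair (K0_deriv s) t *\<^sub>C c_elem"
  "lie (hat Bf s) (hat Be t) = - hat Bh (s * t) + K0_pair (K0_deriv s) t *\<^sub>C c_elem"
  "lie d_elem (hat x t) = hat x (K0_deriv t)" "lie (hat x s) d_elem = - hat x (K0_deriv s)"
  "lie c_elem X = 0" "lie X c_elem = 0" "lie d_elem d_elem = 0"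
  by (rule affine_eqI; simp add: lie_def UNIV_sl2)+

lemma affine_decompose:
  "X = hat Bh (cur X Bh) + hat Be (cur X Be) + hat Bf (cur X Bf) + c_part X *\<^sub>C c_elem + d_part X *\<^sub>C d_elem"
  by (rule affine_eqI) simp_all

section \<open>The exchange relations entry by entry\<close>

lemma sum_2x2:
  fixes f :: "2 \<times> 2 \<Rightarrow> 'a :: comm_monoid_add"
  shows "(\<Sum>k\<in>UNIV. f k) = f (1, 1) + f (1, 2) + f (2, 1) + f (2, 2)"
proof -
  have "(\<Sum>k\<in>UNIV. f k) = (\<Sum>i\<in>UNIV. \<Sum>j\<in>UNIV. f (i, j))"
    by (simp add: sum.cartesian_product)
  then show ?thesis by (simp add: UNIV_2 add.assoc)
qed

lemma forall_2x2: "(\<forall>p. R p) \<longleftrightarrow> R (1, 1) \<and> R (1, 2) \<and> R (2, 1) \<and> R (2, 2)" for R :: "2 \<times> 2 \<Rightarrow> bool"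
  by (simp add: forall_2 split_paired_All)

lemma leg_mult:
  fixes A B :: "'a :: ring_1 mat2"
  shows "(leg1 A ** leg2 B) $ p $ q = A $ fst p $ fst q * B $ snd p $ snd q"
  "(leg2 B ** leg1 A) $ p $ q = B $ snd p $ snd q * A $ fst p $ fst q"
  using exhaust_2[of "fst p"] exhaust_2[of "snd p"] exhaust_2[of "fst q"] exhaust_2[of "snd q"]
  by (auto simp: matrix_matrix_mult_def kron_def mat_def sum_2x2)

lemma H_mat_nth: "H_mat $ 1 $ 1 = 1" "H_mat $ 1 $ 2 = 0" "H_mat $ 2 $ 1 = 0" "H_mat $ 2 $ 2 = -1"
  by (simp_all add: H_mat_def)

context theta
begin

lemma L_op_nth:
  "L_op \<theta> \<epsilon> l s $ 1 $ 1 = (1/2) *\<^sub>C hat Bh (Q \<epsilon> s)"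
  "L_op \<theta> \<epsilon> l s $ 1 $ 2 = hat Bf (P \<epsilon> (- l) s)"
  "L_op \<theta> \<epsilon> l s $ 2 $ 1 = hat Be (P \<epsilon> l s)"
  "L_op \<theta> \<epsilon> l s $ 2 $ 2 = - ((1/2) *\<^sub>C hat Bh (Q \<epsilon> s))"
  by (simp_all add: L_op_def h_half_eq e_half_eq f_half_eq)

lemma L_op_dlam_nth:
  assumes "\<theta> l \<noteq> 0"
  shows "L_op_dlam \<theta> \<epsilon> l s $ 1 $ 1 = 0" "L_op_dlam \<theta> \<epsilon> l s $ 1 $ 2 = - hat Bf (Dm (- l) s)"
    "L_op_dlam \<theta> \<epsilon> l s $ 2 $ 1 = hat Be (Dm l s)" "L_op_dlam \<theta> \<epsilon> l s $ 2 $ 2 = 0"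
  using P_dlam[OF assms] by (simp_all add: L_op_dlam_def L_op_nth affine_deriv_const)

text \<open>
  The actions of the entries of the r-matrix on a test function of the second and of the first
  variable.
\<close>

definition r_snd :: "complex \<Rightarrow> 2 \<times> 2 \<Rightarrow> 2 \<times> 2 \<Rightarrow> K0 \<Rightarrow> K0" where
  "r_snd l p q t = (if p = q then (if fst p = snd p then - ((1/2) *\<^sub>C Q Minus t) else (1/2) *\<^sub>C Q Minus t)
     else if p = (1, 2) \<and> q = (2, 1) then - P Minus l t
     else if p = (2, 1) \<and> q = (1, 2) then - P Minus (- l) t else 0)"

definition r_fst :: "complex \<Rightarrow> 2 \<times> 2 \<Rightarrow> 2 \<times> 2 \<Rightarrow> K0 \<Rightarrow> K0" where
  "r_fst l p q s = (if p = q then (if fst p = snd p then (1/2) *\<^sub>C Q Plus s else - ((1/2) *\<^sub>C Q Plus s))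
     else if p = (1, 2) \<and> q = (2, 1) then P Plus (- l) s
     else if p = (2, 1) \<and> q = (1, 2) then P Plus l s else 0)"

lemma r_mat_nth: "r_mat \<theta> l s t $ p $ q = K0_pair (r_fst l p q s) t"
proof -
  have "\<forall>p q. r_mat \<theta> l s t $ p $ q = K0_pair (r_fst l p q s) t"
    unfolding forall_2x2
    by (simp add: r_mat_def Let_def mat22_of_rows_def basis_pos_def r_fst_def green_eq green_lam_eq)
  then show ?thesis by blast
qed

lemma r_fst_transpose:
  assumes "\<theta> l \<noteq> 0"
  shows "K0_pair (r_fst l p q s) t = K0_pair (r_snd l p q t) s"
proof -
  have l': "\<theta> (- l) \<noteq> 0" using assms by (simp add: theta_minus)
  show ?thesis
    using assms l'
    by (simp add: r_fst_def r_snd_def Q_transpose P_transpose K0_pair_sym[of "Q Minus t"]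
        K0_pair_sym[of "P Minus _ t"])
qed

lemma partial_r_mat:
  assumes "\<theta> l \<noteq> 0"
  shows "partial_fst (\<lambda>s t. r_mat \<theta> l s t $ p $ q) s = r_fst l p q s"
    and "partial_snd (\<lambda>s t. r_mat \<theta> l s t $ p $ q) t = r_snd l p q t"
  by (rule partial_fst_eq partial_snd_eq, simp add: r_mat_nth r_fst_transpose[OF assms])+

lemma r_mat_dlam_nth:
  assumes l: "\<theta> l \<noteq> 0"
  shows "r_mat_dlam \<theta> l s t $ p $ q =
    (if p = (1, 2) \<and> q = (2, 1) then - K0_pair (Dm (- l) s) t
     else if p = (2, 1) \<and> q = (1, 2) then K0_pair (Dm l s) t else 0)"
proof -
  have l': "\<theta> (- l) \<noteq> 0" using l by (simp add: theta_minus)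
  have 1: "deriv (\<lambda>l. green_lam \<theta> Plus l s t) l = K0_pair (Dm l s) t"
    by (rule DERIV_imp_deriv[OF green_lam_dlam[OF l]])
  have 2: "deriv (\<lambda>l. green_lam \<theta> Plus (- l) s t) l = - K0_pair (Dm (- l) s) t"
    using DERIV_chain2[OF green_lam_dlam[OF l', of Plus s t] DERIV_minus[OF DERIV_ident]]
    by (intro DERIV_imp_deriv) simp
  have "\<forall>p q. r_mat_dlam \<theta> l s t $ p $ q =
    (if p = (1, 2) \<and> q = (2, 1) then - K0_pair (Dm (- l) s) t
     else if p = (2, 1) \<and> q = (1, 2) then K0_pair (Dm l s) t else 0)"
    unfolding forall_2x2 using 1 2
    by (simp add: r_mat_dlam_def r_mat_def Let_def mat22_of_rows_def basis_pos_def)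
  then show ?thesis by blast
qed

text \<open>
  Differentiate the adjunction between the operators P for - l and l with respect to l.
\<close>

lemma Dm_transpose:
  assumes l: "\<theta> l \<noteq> 0"
  shows "K0_pair (Dm (- l) s) t = K0_pair s (Dm l t)"
proof -
  have l': "\<theta> (- l) \<noteq> 0" using l by (simp add: theta_minus)
  have "open {l. \<theta> l \<noteq> 0}"
    by (intro open_Collect_neq holomorphic_on_imp_continuous_on holomorphic_theta continuous_on_const)
  then have "\<forall>\<^sub>F l' in nhds (- l). l' \<in> {l. \<theta> l \<noteq> 0}"
    using l' by (intro eventually_nhds_in_open) auto
  then have ev: "\<forall>\<^sub>F l' in nhds (- l). green_lam \<theta> Plus l' s t = - green_lam \<theta> Minus (- l') t s"
    by eventually_elim (simp add: green_lam_eq P_transpose K0_pair_sym[of s])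
  have "((\<lambda>l. green_lam \<theta> Plus l s t) has_field_derivative K0_pair (Dm (- l) s) t) (at (- l))"
    by (rule green_lam_dlam[OF l'])
  moreover have "((\<lambda>l'. - green_lam \<theta> Minus (- l') t s) has_field_derivative K0_pair (Dm l t) s) (at (- l))"
    using DERIV_minus[OF DERIV_chain2[OF _ DERIV_minus[OF DERIV_ident], of "\<lambda>l. green_lam \<theta> Minus l t s"
        "K0_pair (Dm l t) s" "- l"]] green_lam_dlam[OF l, of Minus t s] by simp
  ultimately have "K0_pair (Dm (- l) s) t = K0_pair (Dm l t) s"
    using DERIV_cong_ev[OF refl ev refl] DERIV_unique by blast
  then show ?thesis by (simp add: K0_pair_sym[of s])
qed

lemma P_zero: "\<theta> l \<noteq> 0 \<Longrightarrow> P \<epsilon> l 0 = 0" and Q_zero: "Q \<epsilon> 0 = 0"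
  using P_linear(4)[of l \<epsilon> 0 0] Q_linear(4)[of \<epsilon> 0 0] by simp_all

text \<open>
  The identity in the other leg reduces the sum over the four basis vectors to a sum over two.
\<close>

lemma commutator_dist_leg1:
  fixes A :: "K0 \<Rightarrow> 'a :: ring_1 mat2"
  assumes "\<theta> l \<noteq> 0"
  shows "commutator_dist prod_u (\<lambda>s. leg1 (A s)) (r_mat \<theta> l) s t $ p $ q =
    (\<Sum>i\<in>UNIV. A (s * r_snd l (i, snd p) q t) $ fst p $ i - A (s * r_snd l p (i, snd q) t) $ i $ fst q)"
  unfolding commutator_dist_def prod_u_def partial_r_mat[OF assms]
  using exhaust_2[of "fst p"] exhaust_2[of "snd p"] exhaust_2[of "fst q"] exhaust_2[of "snd q"]
  by (cases p; cases q) (auto simp: kron_def mat_def sum_2x2 UNIV_2)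

lemma commutator_dist_leg2:
  fixes A :: "K0 \<Rightarrow> 'a :: ring_1 mat2"
  assumes "\<theta> l \<noteq> 0"
  shows "commutator_dist prod_v (\<lambda>s. leg2 (A s)) (r_mat \<theta> l) s t $ p $ q =
    (\<Sum>i\<in>UNIV. A (t * r_fst l (fst p, i) q s) $ snd p $ i - A (t * r_fst l p (fst q, i) s) $ i $ snd q)"
  unfolding commutator_dist_def prod_v_def partial_r_mat[OF assms]
  using exhaust_2[of "fst p"] exhaust_2[of "snd p"] exhaust_2[of "fst q"] exhaust_2[of "snd q"]
  by (cases p; cases q) (auto simp: kron_def mat_def sum_2x2 UNIV_2)

text \<open>
  After inserting the actions of the r-matrix, the sixteen entries reduce, up to signs and
  \<open>l \<mapsto> - l\<close>, to \<open>cartan_root\<close>, \<open>root_cartan\<close>, \<open>root_root\<close> and the two formulas for the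
  central terms.  Both sides are linear in \<rho>, so they are compared inside the Lie algebra.
\<close>

lemma exchange_entry:
  fixes \<rho> :: "affine \<Rightarrow> 'a :: complex_algebra_1"
  assumes lin: "complex_linear \<rho>" and l: "\<theta> l \<noteq> 0" and adm: "admissible \<epsilon> \<epsilon>'"
  shows "exchange_rhs \<rho> \<theta> \<epsilon> \<epsilon>' l s t $ p $ q
      + mixed \<epsilon> \<epsilon>' *\<^sub>C dist_deriv (\<lambda>s. r_mat \<theta> l s t) s $ p $ q *\<^sub>C \<rho> c_elem
    = \<rho> (lie (L_op \<theta> \<epsilon> l s $ fst p $ fst q) (L_op \<theta> \<epsilon>' l t $ snd p $ snd q))"
proof -
  have l': "\<theta> (- l) \<noteq> 0" using l by (simp add: theta_minus)
  have "\<forall>p q. exchange_rhs \<rho> \<theta> \<epsilon> \<epsilon>' l s t $ p $ q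
      + mixed \<epsilon> \<epsilon>' *\<^sub>C dist_deriv (\<lambda>s. r_mat \<theta> l s t) s $ p $ q *\<^sub>C \<rho> c_elem
    = \<rho> (lie (L_op \<theta> \<epsilon> l s $ fst p $ fst q) (L_op \<theta> \<epsilon>' l t $ snd p $ snd q))"
    unfolding forall_2x2 exchange_rhs_def
    using l l' adm
    by (simp add: commutator_dist_leg1[OF l] commutator_dist_leg2[OF l] leg_mult map_mat_def
        L_img_def L_img_dlam_def H_mat_nth L_op_nth L_op_dlam_nth[OF l] r_mat_dlam_nth[OF l] UNIV_2
        r_snd_def r_fst_def dist_deriv_def r_mat_nth complex_linearD[OF lin] lie_hat
        cartan_root[OF l adm] cartan_root[OF l' adm] root_cartan[OF l adm] root_cartan[OF l' adm]
        root_root[OF l adm] root_root[OF l' adm, simplified]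
        P_linear(5)[symmetric] Q_linear(5)[symmetric] 
        root_root_central[OF l adm] root_root_central[OF l' adm, simplified] cartan_cartan_central[OF adm]
        scaleC_diff_right scaleC_add_right P_zero Q_zero mult_scaleC_right Dm_transpose[OF l] Dm_transpose[OF l', simplified]
        del: P_linear(5) Q_linear(5))
  then show ?thesis by blast
qed

abbreviation L_entry :: "branch \<Rightarrow> complex \<Rightarrow> K0 \<Rightarrow> 2 \<Rightarrow> 2 \<Rightarrow> affine" where
  "L_entry \<epsilon> l s i j \<equiv> L_op \<theta> \<epsilon> l s $ i $ j"

section \<open>Half-current relations and Lie algebra homomorphisms\<close>

lemma lie_d_L_op:
  assumes "\<theta> l \<noteq> 0"
  shows "lie d_elem (L_entry \<epsilon> l s i j) = L_entry \<epsilon> l (K0_deriv s) i j"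
proof -
  have "\<theta> (- l) \<noteq> 0" using assms by (simp add: theta_minus)
  then show ?thesis
    using assms exhaust_2[of i] exhaust_2[of j] by (auto simp: L_op_nth lie_hat)
qed

text \<open>
  Entrywise, the left-hand side of an exchange relation is a commutator and, by \<open>exchange_entry\<close>, the right-hand
  side is \<rho> of the corresponding bracket.
\<close>

lemma half_current_relations_iff:
  fixes \<rho> :: "affine \<Rightarrow> 'a :: complex_algebra_1"
  assumes lin: "complex_linear \<rho>" and l: "\<theta> l \<noteq> 0"
  shows "half_current_relations \<rho> \<theta> l \<longleftrightarrow>
    (\<forall>\<epsilon> s i j. \<rho> d_elem * \<rho> (L_entry \<epsilon> l s i j) - \<rho> (L_entry \<epsilon> l s i j) * \<rho> d_elem
       = \<rho> (lie d_elem (L_entry \<epsilon> l s i j))) \<and>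
    (\<forall>\<epsilon> \<epsilon>'. admissible \<epsilon> \<epsilon>' \<longrightarrow> (\<forall>s t i j k m.
       \<rho> (L_entry \<epsilon> l s i j) * \<rho> (L_entry \<epsilon>' l t k m)
         - \<rho> (L_entry \<epsilon>' l t k m) * \<rho> (L_entry \<epsilon> l s i j)
       = \<rho> (lie (L_entry \<epsilon> l s i j) (L_entry \<epsilon>' l t k m))))"
proof -
  have d: "commutator (mat (\<rho> d_elem)) (L_img \<rho> \<theta> \<epsilon> l s) = - dist_deriv (L_img \<rho> \<theta> \<epsilon> l) s \<longleftrightarrow>
      (\<forall>i j. \<rho> d_elem * \<rho> (L_entry \<epsilon> l s i j) - \<rho> (L_entry \<epsilon> l s i j) * \<rho> d_elem
        = \<rho> (lie d_elem (L_entry \<epsilon> l s i j)))" for \<epsilon> s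
    by (simp add: vec_eq_iff commutator_def dist_deriv_def L_img_def map_mat_def lie_d_L_op[OF l]
        matrix_matrix_mult_def mat_def UNIV_2 forall_2)
  have comm: "commutator (leg1 (L_img \<rho> \<theta> \<epsilon> l s)) (leg2 (L_img \<rho> \<theta> \<epsilon>' l t)) =
        exchange_rhs \<rho> \<theta> \<epsilon> \<epsilon>' l s t
          + map_mat (\<lambda>a. (mixed \<epsilon> \<epsilon>' * a) *\<^sub>C \<rho> c_elem) (dist_deriv (\<lambda>s. r_mat \<theta> l s t) s)
      \<longleftrightarrow> (\<forall>i j k m. \<rho> (L_entry \<epsilon> l s i j) * \<rho> (L_entry \<epsilon>' l t k m) - \<rho> (L_entry \<epsilon>' l t k m) * \<rho> (L_entry \<epsilon> l s i j)
        = \<rho> (lie (L_entry \<epsilon> l s i j) (L_entry \<epsilon>' l t k m)))" (is "?lhs = ?rhs")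
    if "admissible \<epsilon> \<epsilon>'" for \<epsilon> \<epsilon>' s t
  proof -
    have "?lhs \<longleftrightarrow> (\<forall>p q. \<rho> (L_entry \<epsilon> l s (fst p) (fst q)) * \<rho> (L_entry \<epsilon>' l t (snd p) (snd q))
        - \<rho> (L_entry \<epsilon>' l t (snd p) (snd q)) * \<rho> (L_entry \<epsilon> l s (fst p) (fst q))
        = \<rho> (lie (L_entry \<epsilon> l s (fst p) (fst q)) (L_entry \<epsilon>' l t (snd p) (snd q))))"
      unfolding vec_eq_iff commutator_def vector_minus_component vector_add_component leg_mult
        exchange_entry[OF lin l that, symmetric]
      by (simp add: L_img_def map_mat_def)
    also have "\<dots> \<longleftrightarrow> ?rhs"
      by (simp add: split_paired_All) blast
    finally show ?thesis .
  qed
  have split: "(\<forall>\<epsilon> \<epsilon>'. admissible \<epsilon> \<epsilon>' \<longrightarrow> R \<epsilon> \<epsilon>') \<longleftrightarrow> (\<forall>\<epsilon>. R \<epsilon> \<epsilon>) \<and> R Plus Minus" for R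
    by (metis admissible.simps branch.exhaust)
  have same: "map_mat (\<lambda>a. (mixed \<epsilon> \<epsilon> * a) *\<^sub>C \<rho> c_elem) A = 0" for \<epsilon> A
    by (cases \<epsilon>) (simp_all add: vec_eq_iff map_mat_def mixed_def)
  have plus_minus: "map_mat (\<lambda>a. (mixed Plus Minus * a) *\<^sub>C \<rho> c_elem) A = map_mat (\<lambda>a. a *\<^sub>C \<rho> c_elem) A" for A
    by (simp add: vec_eq_iff map_mat_def mixed_def)
  let ?R = "\<lambda>\<epsilon> \<epsilon>'. \<forall>s t. \<forall>i j k m. \<rho> (L_entry \<epsilon> l s i j) * \<rho> (L_entry \<epsilon>' l t k m)
      - \<rho> (L_entry \<epsilon>' l t k m) * \<rho> (L_entry \<epsilon> l s i j) = \<rho> (lie (L_entry \<epsilon> l s i j) (L_entry \<epsilon>' l t k m))"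
  have 1: "(\<forall>s t. commutator (leg1 (L_img \<rho> \<theta> \<epsilon> l s)) (leg2 (L_img \<rho> \<theta> \<epsilon> l t)) = exchange_rhs \<rho> \<theta> \<epsilon> \<epsilon> l s t) = ?R \<epsilon> \<epsilon>" for \<epsilon>
    using comm[of \<epsilon> \<epsilon>] by (cases \<epsilon>) (simp_all add: same)
  have 2: "(\<forall>s t. commutator (leg1 (L_img \<rho> \<theta> Plus l s)) (leg2 (L_img \<rho> \<theta> Minus l t)) =
        exchange_rhs \<rho> \<theta> Plus Minus l s t + map_mat (\<lambda>a. a *\<^sub>C \<rho> c_elem) (dist_deriv (\<lambda>s. r_mat \<theta> l s t) s)) = ?R Plus Minus"
    using comm[of Plus Minus] by (simp add: plus_minus)
  show ?thesis
    unfolding half_current_relations_def d 1 2 split[of ?R] ..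
qed

lemma hat_eq_half_currents:
  assumes "\<theta> l \<noteq> 0"
  shows "hat Bh s = 2 *\<^sub>C L_entry Plus l s 1 1 - 2 *\<^sub>C L_entry Minus l s 1 1"
    and "hat Be s = L_entry Plus l s 2 1 - L_entry Minus l s 2 1"
    and "hat Bf s = L_entry Plus l s 1 2 - L_entry Minus l s 1 2"
proof -
  have "\<theta> (- l) \<noteq> 0" using assms by (simp add: theta_minus)
  then show "hat Bh s = 2 *\<^sub>C L_entry Plus l s 1 1 - 2 *\<^sub>C L_entry Minus l s 1 1"
    "hat Be s = L_entry Plus l s 2 1 - L_entry Minus l s 2 1"
    "hat Bf s = L_entry Plus l s 1 2 - L_entry Minus l s 1 2"
    using assms by (simp_all add: L_op_nth P_Plus Q_Plus)
qed

end

lemma lie_antisym: "lie Y X = - lie X Y"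
proof -
  have "K0_pair (K0_deriv s) t = - K0_pair (K0_deriv t) s" for s t
    by (simp add: K0_pair_deriv[of s] K0_pair_sym[of s])
  note pair = this[of "cur Y Bh" "cur X Bh"] this[of "cur Y Be" "cur X Bf"] this[of "cur Y Bf" "cur X Be"]
  show ?thesis
    by (rule affine_eqI) (simp_all add: lie_def UNIV_sl2 pair mult.commute)
qed

text \<open>
  Both sides are bilinear, and the Lie algebra is spanned by the currents, c and d.
\<close>

lemma represents_bracket:
  fixes \<rho> :: "affine \<Rightarrow> 'a :: complex_algebra_1"
  assumes lin: "complex_linear \<rho>"
    and central: "\<And>X. \<rho> c_elem * \<rho> X = \<rho> X * \<rho> c_elem"
    and hat: "\<And>x y s t. \<rho> (hat x s) * \<rho> (hat y t) - \<rho> (hat y t) * \<rho> (hat x s) = \<rho> (lie (hat x s) (hat y t))"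
    and d: "\<And>x s. \<rho> d_elem * \<rho> (hat x s) - \<rho> (hat x s) * \<rho> d_elem = \<rho> (lie d_elem (hat x s))"
  shows "\<rho> (lie X Y) = \<rho> X * \<rho> Y - \<rho> Y * \<rho> X"
proof -
  define G where "G X Y \<longleftrightarrow> \<rho> (lie X Y) = \<rho> X * \<rho> Y - \<rho> Y * \<rho> X" for X Y
  note lin = complex_linearD[OF lin]
  have add: "G X Y \<Longrightarrow> G X' Y \<Longrightarrow> G (X + X') Y" "G Y X \<Longrightarrow> G Y X' \<Longrightarrow> G Y (X + X')" for X X' Y
    by (simp_all add: G_def lin algebra_simps)
  have scale: "G X Y \<Longrightarrow> G (a *\<^sub>C X) Y" "G Y X \<Longrightarrow> G Y (a *\<^sub>C X)" for X Y a
    by (simp_all add: G_def lin mult_scaleC_left mult_scaleC_right flip: scaleC_diff_right)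
  have c: "G c_elem X" "G X c_elem" for X
    using central[of X] by (simp_all add: G_def lie_hat lin)
  have dd: "G d_elem d_elem" by (simp add: G_def lie_hat lin)
  have hh: "G (hat x s) (hat y t)" for x y s t
    using hat by (simp add: G_def)
  have dh: "G d_elem (hat x s)" for x s
    using d by (simp add: G_def)
  have hd: "G (hat x s) d_elem" for x s
    using arg_cong[OF d[of x s], of uminus] by (simp add: G_def lie_antisym[of "hat x s" d_elem] lin)
  have left: "G X Y" if "\<And>x s. G (hat x s) Y" "G c_elem Y" "G d_elem Y" for X Y
    by (subst affine_decompose[of X]) (intro add scale that)
  have right: "G Y X" if "\<And>x s. G Y (hat x s)" "G Y c_elem" "G Y d_elem" for X Y
    by (subst affine_decompose[of X]) (intro add scale that)
  have "G X Y"
    by (rule left; (rule c)?; rule right; rule c dd hh dh hd)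
  then show ?thesis by (simp add: G_def)
qed

lemma env_incl_linear: "complex_linear env_incl"
  unfolding complex_linear_def
proof (intro conjI allI)
  show "env_incl (X + Y) = env_incl X + env_incl Y" for X Y
    by transfer (rule env_ideal.gen_add)
  show "env_incl (a *\<^sub>C X) = a *\<^sub>C env_incl X" for a X
    by transfer (rule env_ideal.gen_scale)
qed

lemma env_incl_lie: "env_incl (lie X Y) = env_incl X * env_incl Y - env_incl Y * env_incl X"
  by transfer (rule env_ideal.gen_lie)

context theta
begin

text \<open>
  The combination (-, +) of signs is covered by antisymmetry, so brackets of arbitrary
  half-currents, hence of their differences, are respected.
\<close>

lemma relations_imp_bracket:
  fixes \<rho> :: "affine \<Rightarrow> 'a :: complex_algebra_1"
  assumes lin: "complex_linear \<rho>" and l: "\<theta> l \<noteq> 0"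
    and central: "\<And>X. \<rho> c_elem * \<rho> X = \<rho> X * \<rho> c_elem"
    and rel: "half_current_relations \<rho> \<theta> l"
  shows "\<rho> (lie X Y) = \<rho> X * \<rho> Y - \<rho> Y * \<rho> X"
proof (rule represents_bracket[OF lin central])
  define G where "G X Y \<longleftrightarrow> \<rho> X * \<rho> Y - \<rho> Y * \<rho> X = \<rho> (lie X Y)" for X Y
  note lin = complex_linearD[OF lin]
  have rel': "G d_elem (L_entry \<epsilon> l s i j)" "admissible \<epsilon> \<epsilon>' \<Longrightarrow> G (L_entry \<epsilon> l s i j) (L_entry \<epsilon>' l t k m)"
    for \<epsilon> \<epsilon>' s t i j k m
    using rel unfolding half_current_relations_iff[OF \<open>complex_linear \<rho>\<close> l] G_def by blast+
  have sym: "G X Y" if "G Y X" for X Y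
    using arg_cong[OF that[unfolded G_def], of uminus] by (simp add: G_def lie_antisym[of X Y] lin)
  have LL: "G (L_entry \<epsilon> l s i j) (L_entry \<epsilon>' l t k m)" for \<epsilon> \<epsilon>' s t i j k m
  proof (cases "admissible \<epsilon> \<epsilon>'")
    case False
    then have "\<epsilon> = Minus" "\<epsilon>' = Plus"
      by (cases \<epsilon>; cases \<epsilon>'; simp)+
    then show ?thesis
      using sym[OF rel'(2)[of Plus Minus]] by simp
  qed (rule rel'(2))
  have diff: "G X Y \<Longrightarrow> G X' Y \<Longrightarrow> G (X - X') Y" "G Y X \<Longrightarrow> G Y X' \<Longrightarrow> G Y (X - X')" for X X' Y
    by (simp_all only: G_def lin lie_linear ring_distribs left_diff_distrib right_diff_distrib) (simp_all add: algebra_simps)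
  have scale: "G X Y \<Longrightarrow> G (a *\<^sub>C X) Y" "G Y X \<Longrightarrow> G Y (a *\<^sub>C X)" for X Y a
    by (simp_all add: G_def lin mult_scaleC_left mult_scaleC_right flip: scaleC_diff_right)
  have hL: "G (hat x s) (L_entry \<epsilon> l t k m)" for x s \<epsilon> t k m
    by (cases x; simp only: hat_eq_half_currents[OF l]; intro diff scale LL)
  show "\<rho> (hat x s) * \<rho> (hat y t) - \<rho> (hat y t) * \<rho> (hat x s) = \<rho> (lie (hat x s) (hat y t))" for x y s t
    unfolding G_def[symmetric]
    by (cases y; simp only: hat_eq_half_currents[OF l, of t]; intro diff scale hL)
  show "\<rho> d_elem * \<rho> (hat x s) - \<rho> (hat x s) * \<rho> d_elem = \<rho> (lie d_elem (hat x s))" for x s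
    unfolding G_def[symmetric]
    by (cases x; simp only: hat_eq_half_currents[OF l, of s]; intro diff scale rel'(1))
qed

lemma zero_weight:
  "commutator (H_mat + mat (env_incl (hat Bh 1))) (L_img env_incl \<theta> \<epsilon> l s) = 0"
proof -
  note lin = complex_linearD[OF env_incl_linear]
  have "env_incl (hat Bh 1) * env_incl (hat x s) - env_incl (hat x s) * env_incl (hat Bh 1)
      = env_incl (lie (hat Bh 1) (hat x s))" for x s
    by (simp add: env_incl_lie)
  note comm = this[of Bh] this[of Be] this[of Bf]
  have two: "2 *\<^sub>C y = y + y" for y :: env
    using scaleC_add_left[of 1 1 y] by simp
  show ?thesis
    using comm[of "Q \<epsilon> s"] comm[of "P \<epsilon> l s"] comm[of "P \<epsilon> (- l) s"]
    by (simp add: vec_eq_iff forall_2 commutator_def matrix_matrix_mult_def UNIV_2 mat_def H_mat_nth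
        L_img_def map_mat_def L_op_nth lin lie_hat two mult_scaleC_left mult_scaleC_right algebra_simps
        flip: scaleC_diff_right)
qed

end

theorem proposition3:
  fixes \<tau> l :: complex and \<theta> :: "complex \<Rightarrow> complex"
  assumes "Im \<tau> > 0"
    and "l \<notin> {of_int m + \<tau> * of_int n | m n. True}"
    and "theta_function \<tau> \<theta>"
  shows "half_current_relations env_incl \<theta> l \<and>
    (\<forall>\<epsilon> s. commutator (H_mat + mat (env_incl (hat Bh 1))) (L_img env_incl \<theta> \<epsilon> l s) = 0) \<and>
    (\<forall>\<rho> :: affine \<Rightarrow> 'a::complex_algebra_1.
       complex_linear \<rho> \<and> (\<forall>X. \<rho> c_elem * \<rho> X = \<rho> X * \<rho> c_elem) \<and>
       half_current_relations \<rho> \<theta> l \<longrightarrow>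
       (\<forall>X Y. \<rho> (lie X Y) = \<rho> X * \<rho> Y - \<rho> Y * \<rho> X))"
proof -
  interpret theta \<tau> \<theta>
    using assms by unfold_locales
  have l: "\<theta> l \<noteq> 0"
    using assms(2) theta_eq_0_iff by blast
  show ?thesis
  proof (intro conjI allI impI)
    show "half_current_relations env_incl \<theta> l"
      unfolding half_current_relations_iff[OF env_incl_linear l] by (simp add: env_incl_lie)
    show "commutator (H_mat + mat (env_incl (hat Bh 1))) (L_img env_incl \<theta> \<epsilon> l s) = 0" for \<epsilon> s
      by (rule zero_weight)
  next
    fix \<rho> :: "affine \<Rightarrow> 'a" and X Y
    assume "complex_linear \<rho> \<and> (\<forall>X. \<rho> c_elem * \<rho> X = \<rho> X * \<rho> c_elem) \<and> half_current_relations \<rho> \<theta> l"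
    then show "\<rho> (lie X Y) = \<rho> X * \<rho> Y - \<rho> Y * \<rho> X"
      by (intro relations_imp_bracket[OF _ l]) blast+
  qed
qed

end
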